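(* Let $r\ge 6$. Austere 4-folds of type A in $\mathbb{R}^{4+r}$ with first normal space of maximal dimension ($\delta=6$, i.e. with $|\mathrm{II}_p|$ at every point $O(4)$-conjugate to all of $\mathcal{Q}_A$) depend on a choice of $2(r-1)$ functions of 2 variables.
   Context: For an immersed submanifold $M^4\subset\mathbb{R}^{4+r}$ the second fundamental form is $\mathrm{II}(X,Y)=\pi_N\nabla_XY$, and $|\mathrm{II}_p|\subset S^2T_p^*M$ is the space of all quadratic forms $\nu\cdot\mathrm{II}_p$, with $\nu$ normal to $M$ at $p$. $M$ is austere if, for every normal vector $\nu$, the eigenvalues of $\nu\cdot\mathrm{II}$ with respect to the induced metric are symmetrically arranged around zero. The first normal space $N^1_pM$ is the image of $\mathrm{II}:S^2T_pM\to N_pM$, and $\delta=\dim N^1_pM=\dim|\mathrm{II}_p|$. $$\mathcal{Q}_A=\left\{\begin{bmatrix}A&B\\ B&-A\end{bmatrix}: A,B \text{ real symmetric } 2\times2\right\},$$ which has dimension 6; type A means $|\mathrm{II}_p|$ is $O(4)$-conjugate to a subspace of $\mathcal{Q}_A$ for every $p$ (in orthonormal bases of $T_pM$ that locally form a smooth frame). "Depend on a choice of $k$ functions of 2 variables" is meant in the sense of the Cartan–Kähler Theorem: adapted moving frames along such submanifolds are the integral manifolds, satisfying the independence condition that the tangential canonical 1-forms are linearly independent, of an involutive Pfaffian exterior differential system whose last nonzero Cartan character is $s_2=k$. The involutive system used is as follows. On the bundle $\mathcal F$ of frames $(e_1,\dots,e_4,\nu_1,\dots,\nu_r)$ of $\mathbb{R}^{4+r}$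 with the $e_i$ orthonormal and orthogonal to the $\nu$'s, and additionally $\nu_7,\dots,\nu_r$ orthogonal to $\nu_1,\dots,\nu_6$ along $M$ (where $\nu_1,\dots,\nu_6$ span $N^1_pM$), define 1-forms by $dp=e_i\omega^i+\nu_a\theta^a+\nu_\beta\theta^\beta$, $de_i=e_j\phi^j_i+\nu_a\eta^a_i+\nu_\beta\eta^\beta_i$ ($1\le a\le6$, $7\le\beta\le r$). The system is generated by $\theta^a,\theta^\beta$, $\tfrac12(\phi^2_1-\phi^4_3)$, $\tfrac12(\phi^3_2-\phi^4_1)$, $\eta^a_i-\hat S^a_{ij}\omega^j$, $\eta^\beta_i$, restricted to the locus $g_{13}-g_{22}-g_{46}+g_{55}=0$, $g_{16}-2g_{25}+g_{34}=0$, with $g_{ab}=\nu_a\cdot\nu_b$. Here, with $E_{ij}$ the elementary $4\times 4$ matrices, $\hat S^1=E_{11}-E_{33}$, $\hat S^2=E_{12}+E_{21}-E_{34}-E_{43}$, $\hat S^3=E_{22}-E_{44}$, $\hat S^4=E_{13}+E_{31}$, $\hat S^5=E_{14}+E_{41}+E_{23}+E_{32}$, $\hat S^6=E_{24}+E_{42}$. *)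

theory Defs
  imports "HOL-Analysis.Analysis"
begin

section \<open>Smooth maps and submanifolds\<close>

text \<open>Only used for open \<open>S\<close>.\<close>

primrec Ck_on :: "nat \<Rightarrow> 'a::euclidean_space set \<Rightarrow> ('a \<Rightarrow> 'b::real_normed_vector) \<Rightarrow> bool" where
  "Ck_on 0 S f \<longleftrightarrow> continuous_on S f"
| "Ck_on (Suc k) S f \<longleftrightarrow>
     (\<forall>x\<in>S. f differentiable (at x)) \<and> (\<forall>v. Ck_on k S (\<lambda>x. frechet_derivative f (at x) v))"

definition smooth_on :: "'a::euclidean_space set \<Rightarrow> ('a \<Rightarrow> 'b::real_normed_vector) \<Rightarrow> bool" where
  "smooth_on S f \<longleftrightarrow> (\<forall>k. Ck_on k S f)"

text \<open>Embedded submanifolds of a Euclidean space as local regular level sets: the differentials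
  of the finitely many local defining functions are jointly surjective.\<close>

definition submanifold :: "'e::euclidean_space set \<Rightarrow> bool" where
  "submanifold M \<longleftrightarrow> (\<forall>x\<in>M. \<exists>U (G :: ('e \<Rightarrow> real) set).
     open U \<and> x \<in> U \<and> finite G \<and> (\<forall>g\<in>G. smooth_on U g) \<and>
     M \<inter> U = {y\<in>U. \<forall>g\<in>G. g y = 0} \<and>
     (\<forall>y\<in>M \<inter> U. \<forall>c. \<exists>v. \<forall>g\<in>G. frechet_derivative g (at y) v = c g))"

definition tangent_at :: "'e::euclidean_space set \<Rightarrow> 'e \<Rightarrow> 'e set" where
  "tangent_at M x =
     {v. \<exists>\<gamma>::real \<Rightarrow> 'e. \<gamma> 0 = x \<and> (\<forall>t. \<gamma> t \<in> M) \<and> (\<gamma> has_vector_derivative v) (at 0)}"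

section \<open>Pfaffian systems with independence condition\<close>

text \<open>A 1-form on a submanifold is given by a smooth 1-form \<open>\<alpha> x v\<close> (\<open>v\<close> a tangent vector at \<open>x\<close>)
  on an open neighbourhood in the ambient space; since pullback commutes with \<open>d\<close>, its exterior
  derivative on the submanifold is the restriction of the ambient one to tangent vectors.\<close>

definition smooth_form_on :: "'e::euclidean_space set \<Rightarrow> ('e \<Rightarrow> 'e \<Rightarrow> real) \<Rightarrow> bool" where
  "smooth_form_on U \<alpha> \<longleftrightarrow> (\<forall>x\<in>U. linear (\<alpha> x)) \<and> (\<forall>v. smooth_on U (\<lambda>x. \<alpha> x v))"

definition ext_d :: "('e::euclidean_space \<Rightarrow> 'e \<Rightarrow> real) \<Rightarrow> 'e \<Rightarrow> 'e \<Rightarrow> 'e \<Rightarrow> real" where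
  "ext_d \<alpha> x u v =
     frechet_derivative (\<lambda>y. \<alpha> y v) (at x) u - frechet_derivative (\<lambda>y. \<alpha> y u) (at x) v"

text \<open>Below \<open>\<theta> k\<close> are the generators of \<open>I\<close>, and \<open>J\<close> is spanned by the \<open>\<theta> k\<close> and the independence
  forms \<open>\<omega> i\<close>; \<open>ann_I\<close> and \<open>ann_J\<close> are the annihilators of \<open>I\<close> and \<open>J\<close> in the tangent space.\<close>

definition ann_I :: "'e::euclidean_space set \<Rightarrow> ('k \<Rightarrow> 'e \<Rightarrow> 'e \<Rightarrow> real) \<Rightarrow> 'e \<Rightarrow> 'e set" where
  "ann_I M \<theta> x = {v \<in> tangent_at M x. \<forall>k. \<theta> k x v = 0}"

definition ann_J :: "'e::euclidean_space set \<Rightarrow> ('k \<Rightarrow> 'e \<Rightarrow> 'e \<Rightarrow> real) \<Rightarrow> ('m \<Rightarrow> 'e \<Rightarrow> 'e \<Rightarrow> real)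
    \<Rightarrow> 'e \<Rightarrow> 'e set" where
  "ann_J M \<theta> \<omega> x = {v \<in> ann_I M \<theta> x. \<forall>i. \<omega> i x v = 0}"

text \<open>The last clause is the linearity condition that \<open>d\<theta>\<close> vanishes modulo \<open>J\<close>.\<close>

definition linear_pfaffian :: "'e::euclidean_space set \<Rightarrow> ('k::finite \<Rightarrow> 'e \<Rightarrow> 'e \<Rightarrow> real)
    \<Rightarrow> ('m::finite \<Rightarrow> 'e \<Rightarrow> 'e \<Rightarrow> real) \<Rightarrow> bool" where
  "linear_pfaffian M \<theta> \<omega> \<longleftrightarrow>
     submanifold M \<and>
     (\<exists>U. open U \<and> M \<subseteq> U \<and> (\<forall>k. smooth_form_on U (\<theta> k)) \<and> (\<forall>i. smooth_form_on U (\<omega> i))) \<and>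
     (\<forall>x\<in>M. \<forall>a b. (\<forall>v\<in>tangent_at M x. (\<Sum>k\<in>UNIV. a k * \<theta> k x v) + (\<Sum>i\<in>UNIV. b i * \<omega> i x v) = 0)
        \<longrightarrow> (\<forall>k. a k = 0) \<and> (\<forall>i. b i = 0)) \<and>
     (\<forall>x\<in>M. \<forall>u\<in>ann_J M \<theta> \<omega> x. \<forall>v\<in>ann_J M \<theta> \<omega> x. \<forall>k. ext_d (\<theta> k) x u v = 0)"

definition integral_element :: "'e::euclidean_space set \<Rightarrow> ('k \<Rightarrow> 'e \<Rightarrow> 'e \<Rightarrow> real)
    \<Rightarrow> ('m::finite \<Rightarrow> 'e \<Rightarrow> 'e \<Rightarrow> real) \<Rightarrow> 'e \<Rightarrow> 'e set \<Rightarrow> bool" where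
  "integral_element M \<theta> \<omega> x E \<longleftrightarrow>
     subspace E \<and> E \<subseteq> ann_I M \<theta> x \<and>
     (\<forall>u\<in>E. \<forall>v\<in>E. \<forall>k. ext_d (\<theta> k) x u v = 0) \<and>
     bij_betw (\<lambda>v. \<chi> i. \<omega> i x v) E (UNIV :: (real^'m) set)"

text \<open>The tableau, a subspace of \<open>I\<^sup>* \<otimes> (J/I)\<close>, written as matrices in the
  bases \<open>\<theta> k\<close> and \<open>\<omega> i\<close>: modulo \<open>I\<close> one has \<open>d\<theta>\<^sup>k = \<pi>\<^sup>k\<^sub>i \<and> \<omega>\<^sup>i + (torsion)\<close>, and the tableau
  consists of the values \<open>\<pi>(u)\<close> for \<open>u\<close> in the annihilator of \<open>J\<close>. Directions \<open>u\<close> that are Cauchy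
  characteristic contribute \<open>0\<close>.\<close>

definition tableau :: "'e::euclidean_space set \<Rightarrow> ('k::finite \<Rightarrow> 'e \<Rightarrow> 'e \<Rightarrow> real)
    \<Rightarrow> ('m::finite \<Rightarrow> 'e \<Rightarrow> 'e \<Rightarrow> real) \<Rightarrow> 'e \<Rightarrow> (real^'m^'k) set" where
  "tableau M \<theta> \<omega> x = {P. \<exists>u\<in>ann_J M \<theta> \<omega> x. \<forall>v\<in>ann_I M \<theta> x. \<forall>k.
      ext_d (\<theta> k) x u v = (P *v (\<chi> i. \<omega> i x v)) $ k}"

definition prolongation :: "(real^'m::finite^'k::finite) set \<Rightarrow> (real^'m^'m^'k) set" where
  "prolongation A = {P. (\<forall>k i j. P $ k $ i $ j = P $ k $ j $ i) \<and> (\<forall>j. (\<chi> k i. P $ k $ i $ j) \<in> A)}"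

text \<open>\<open>cartan_sum A p = s\<^sub>1 + \<dots> + s\<^sub>p\<close>: the codimension in \<open>A\<close> of the subspace annihilating a generic
  \<open>p\<close>-tuple of vectors.\<close>

definition cartan_sum :: "(real^'m::finite^'k::finite) set \<Rightarrow> nat \<Rightarrow> nat" where
  "cartan_sum A p =
     Max (range (\<lambda>v :: nat \<Rightarrow> real^'m. dim A - dim {P\<in>A. \<forall>q<p. P *v v q = 0}))"

definition cartan_char :: "(real^'m::finite^'k::finite) set \<Rightarrow> nat \<Rightarrow> nat" where
  "cartan_char A p = cartan_sum A p - cartan_sum A (p - 1)"

definition involutive_tableau :: "(real^'m::finite^'k::finite) set \<Rightarrow> bool" where
  "involutive_tableau A \<longleftrightarrow> dim (prolongation A) = (\<Sum>p=1..CARD('m). p * cartan_char A p)"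

text \<open>The existence of an integral element at \<open>x\<close> says that the torsion at \<open>x\<close> can be absorbed.\<close>

definition involutive_pfaffian :: "'e::euclidean_space set \<Rightarrow> ('k::finite \<Rightarrow> 'e \<Rightarrow> 'e \<Rightarrow> real)
    \<Rightarrow> ('m::finite \<Rightarrow> 'e \<Rightarrow> 'e \<Rightarrow> real) \<Rightarrow> bool" where
  "involutive_pfaffian M \<theta> \<omega> \<longleftrightarrow>
     linear_pfaffian M \<theta> \<omega> \<and>
     (\<forall>x\<in>M. (\<exists>E. integral_element M \<theta> \<omega> x E) \<and> involutive_tableau (tableau M \<theta> \<omega> x))"

definition last_character :: "'e::euclidean_space set \<Rightarrow> ('k::finite \<Rightarrow> 'e \<Rightarrow> 'e \<Rightarrow> real)
    \<Rightarrow> ('m::finite \<Rightarrow> 'e \<Rightarrow> 'e \<Rightarrow> real) \<Rightarrow> nat \<Rightarrow> nat \<Rightarrow> bool" where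
  "last_character M \<theta> \<omega> l s \<longleftrightarrow>
     s \<noteq> 0 \<and> l \<in> {1..CARD('m)} \<and>
     (\<forall>x\<in>M. cartan_char (tableau M \<theta> \<omega> x) l = s \<and>
        (\<forall>p. l < p \<and> p \<le> CARD('m) \<longrightarrow> cartan_char (tableau M \<theta> \<omega> x) p = 0))"

definition integral_manifold :: "'e::euclidean_space set \<Rightarrow> ('k \<Rightarrow> 'e \<Rightarrow> 'e \<Rightarrow> real)
    \<Rightarrow> ('m::finite \<Rightarrow> 'e \<Rightarrow> 'e \<Rightarrow> real) \<Rightarrow> (real^'m) set \<Rightarrow> (real^'m \<Rightarrow> 'e) \<Rightarrow> bool" where
  "integral_manifold M \<theta> \<omega> U F \<longleftrightarrow>
     open U \<and> smooth_on U F \<and> F ` U \<subseteq> M \<and>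
     (\<forall>x\<in>U. \<forall>u k. \<theta> k (F x) (frechet_derivative F (at x) u) = 0) \<and>
     (\<forall>x\<in>U. \<forall>b. (\<forall>u. (\<Sum>i\<in>UNIV. b i * \<omega> i (F x) (frechet_derivative F (at x) u)) = 0)
        \<longrightarrow> (\<forall>i. b i = 0))"

section \<open>Immersed 4-manifolds and austerity\<close>

text \<open>All notions are local, so immersed 4-manifolds are given by smooth immersions
  \<open>f\<close> of open sets \<open>U\<close> of \<open>\<real>\<^sup>4\<close>; tangent vectors to the image are vectors of the ambient space.\<close>

definition immersion_on :: "(real^4) set \<Rightarrow> (real^4 \<Rightarrow> 'v::euclidean_space) \<Rightarrow> bool" where
  "immersion_on U f \<longleftrightarrow> open U \<and> smooth_on U f \<and> (\<forall>x\<in>U. inj (frechet_derivative f (at x)))"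

definition TM :: "(real^4 \<Rightarrow> 'v::euclidean_space) \<Rightarrow> real^4 \<Rightarrow> 'v set" where
  "TM f x = range (frechet_derivative f (at x))"

definition NM :: "(real^4 \<Rightarrow> 'v::euclidean_space) \<Rightarrow> real^4 \<Rightarrow> 'v set" where
  "NM f x = {n. \<forall>X\<in>TM f x. n \<bullet> X = 0}"

definition normal_proj :: "(real^4 \<Rightarrow> 'v::euclidean_space) \<Rightarrow> real^4 \<Rightarrow> 'v \<Rightarrow> 'v" where
  "normal_proj f x w = (THE n. n \<in> NM f x \<and> w - n \<in> TM f x)"

text \<open>\<open>II(X,Y) = \<pi>\<^sub>N \<nabla>\<^sub>X Y\<close>, where \<open>Y = df(w)\<close> is extended along \<open>f\<close> by keeping \<open>w\<close> constant and
  \<open>X = df(u)\<close>.\<close>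

definition II :: "(real^4 \<Rightarrow> 'v::euclidean_space) \<Rightarrow> real^4 \<Rightarrow> 'v \<Rightarrow> 'v \<Rightarrow> 'v" where
  "II f x X Y =
     (let u = inv (frechet_derivative f (at x)) X; w = inv (frechet_derivative f (at x)) Y
      in normal_proj f x (frechet_derivative (\<lambda>y. frechet_derivative f (at y) w) (at x) u))"

text \<open>Multiplicity of \<open>\<lambda>\<close> as an eigenvalue of the quadratic form \<open>n \<bullet> II\<close> with respect to the
  induced metric (geometric and algebraic multiplicities agree, the form being symmetric).\<close>

definition eig_mult :: "(real^4 \<Rightarrow> 'v::euclidean_space) \<Rightarrow> real^4 \<Rightarrow> 'v \<Rightarrow> real \<Rightarrow> nat" where
  "eig_mult f x n lam = dim {X\<in>TM f x. \<forall>Y\<in>TM f x. n \<bullet> II f x X Y = lam * (X \<bullet> Y)}"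

definition austere_on :: "(real^4) set \<Rightarrow> (real^4 \<Rightarrow> 'v::euclidean_space) \<Rightarrow> bool" where
  "austere_on U f \<longleftrightarrow> (\<forall>x\<in>U. \<forall>n\<in>NM f x. \<forall>lam. eig_mult f x n lam = eig_mult f x n (- lam))"

definition first_normal :: "(real^4 \<Rightarrow> 'v::euclidean_space) \<Rightarrow> real^4 \<Rightarrow> 'v set" where
  "first_normal f x = span {II f x X Y | X Y. X \<in> TM f x \<and> Y \<in> TM f x}"

definition QA :: "(real^4^4) set" where
  "QA = {vector [vector [A$1$1, A$1$2,   B$1$1,   B$1$2],
                 vector [A$2$1, A$2$2,   B$2$1,   B$2$2],
                 vector [B$1$1, B$1$2, - A$1$1, - A$1$2],
                 vector [B$2$1, B$2$2, - A$2$1, - A$2$2]]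
        | (A :: real^2^2) (B :: real^2^2). transpose A = A \<and> transpose B = B}"

definition orthonormal4 :: "'v::euclidean_space^4 \<Rightarrow> bool" where
  "orthonormal4 e \<longleftrightarrow> (\<forall>i j. e $ i \<bullet> e $ j = (if i = j then 1 else 0))"

text \<open>The space \<open>|II|\<close>, written as matrices in the orthonormal basis \<open>e\<close> of the tangent space.\<close>

definition II_space :: "(real^4 \<Rightarrow> 'v::euclidean_space) \<Rightarrow> real^4 \<Rightarrow> 'v^4 \<Rightarrow> (real^4^4) set" where
  "II_space f x e = {(\<chi> i j. n \<bullet> II f x (e $ i) (e $ j)) | n. n \<in> NM f x}"

definition type_A_on :: "(real^4) set \<Rightarrow> (real^4 \<Rightarrow> 'v::euclidean_space) \<Rightarrow> bool" where
  "type_A_on U f \<longleftrightarrow> (\<forall>p\<in>U. \<exists>V (e :: real^4 \<Rightarrow> 'v^4).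
     open V \<and> p \<in> V \<and> V \<subseteq> U \<and> smooth_on V e \<and>
     (\<forall>x\<in>V. orthonormal4 (e x) \<and> (\<forall>i. e x $ i \<in> TM f x) \<and> II_space f x (e x) \<subseteq> QA))"

definition austere_A_max :: "(real^4) set \<Rightarrow> (real^4 \<Rightarrow> 'v::euclidean_space) \<Rightarrow> bool" where
  "austere_A_max U f \<longleftrightarrow>
     immersion_on U f \<and> austere_on U f \<and> type_A_on U f \<and> (\<forall>x\<in>U. dim (first_normal f x) = 6)"

section \<open>Adapted frames and the Pfaffian system\<close>

text \<open>A frame is \<open>(p, e, \<nu>)\<close>. The normal vectors are indexed by a finite type \<open>'r\<close> with
  \<open>CARD('r) = r\<close>; a bijection \<open>num\<close> onto \<open>{1..r}\<close> supplies their numbering.\<close>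

type_synonym ('v, 'r) frame = "'v \<times> ('v^4) \<times> ('v^'r)"

abbreviation pt :: "('v, 'r) frame \<Rightarrow> 'v" where "pt x \<equiv> fst x"
abbreviation ee :: "('v, 'r) frame \<Rightarrow> 'v^4" where "ee x \<equiv> fst (snd x)"
abbreviation nu :: "('v, 'r) frame \<Rightarrow> 'v^'r" where "nu x \<equiv> snd (snd x)"

definition nu_at :: "('r::finite \<Rightarrow> nat) \<Rightarrow> ('v, 'r) frame \<Rightarrow> nat \<Rightarrow> 'v" where
  "nu_at num x a = nu x $ (inv num a)"

definition frame_map :: "('v::euclidean_space, 'r::finite) frame \<Rightarrow> (real^4) \<times> (real^'r) \<Rightarrow> 'v" where
  "frame_map x c = (\<Sum>i\<in>UNIV. fst c $ i *\<^sub>R ee x $ i) + (\<Sum>k\<in>UNIV. snd c $ k *\<^sub>R nu x $ k)"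

definition frame_bundle :: "('r::finite \<Rightarrow> nat) \<Rightarrow> ('v::euclidean_space, 'r) frame set" where
  "frame_bundle num = {x. bij (frame_map x) \<and> orthonormal4 (ee x) \<and>
     (\<forall>i k. ee x $ i \<bullet> nu x $ k = 0) \<and>
     (\<forall>k l. num k \<le> 6 \<and> 6 < num l \<longrightarrow> nu x $ k \<bullet> nu x $ l = 0)}"

definition gram :: "('r::finite \<Rightarrow> nat) \<Rightarrow> ('v::euclidean_space, 'r) frame \<Rightarrow> nat \<Rightarrow> nat \<Rightarrow> real" where
  "gram num x a b = nu_at num x a \<bullet> nu_at num x b"

definition locus :: "('r::finite \<Rightarrow> nat) \<Rightarrow> ('v::euclidean_space, 'r) frame set" where
  "locus num = {x \<in> frame_bundle num.
     gram num x 1 3 - gram num x 2 2 - gram num x 4 6 + gram num x 5 5 = 0 \<and>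
     gram num x 1 6 - 2 * gram num x 2 5 + gram num x 3 4 = 0}"

text \<open>The forms defined by \<open>dp = e\<^sub>i \<omega>\<^sup>i + \<nu>\<^sub>k \<theta>\<^sup>k\<close> and \<open>de\<^sub>i = e\<^sub>j \<phi>\<^sup>j\<^sub>i + \<nu>\<^sub>k \<eta>\<^sup>k\<^sub>i\<close>.\<close>

definition omega :: "4 \<Rightarrow> ('v::euclidean_space, 'r::finite) frame \<Rightarrow> ('v, 'r) frame \<Rightarrow> real" where
  "omega i x v = fst (inv (frame_map x) (pt v)) $ i"

definition theta :: "'r \<Rightarrow> ('v::euclidean_space, 'r::finite) frame \<Rightarrow> ('v, 'r) frame \<Rightarrow> real" where
  "theta k x v = snd (inv (frame_map x) (pt v)) $ k"

definition phi :: "4 \<Rightarrow> 4 \<Rightarrow> ('v::euclidean_space, 'r::finite) frame \<Rightarrow> ('v, 'r) frame \<Rightarrow> real" where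
  "phi j i x v = fst (inv (frame_map x) (ee v $ i)) $ j"

definition eta :: "'r \<Rightarrow> 4 \<Rightarrow> ('v::euclidean_space, 'r::finite) frame \<Rightarrow> ('v, 'r) frame \<Rightarrow> real" where
  "eta k i x v = snd (inv (frame_map x) (ee v $ i)) $ k"

definition EE :: "4 \<Rightarrow> 4 \<Rightarrow> real^4^4" where
  "EE i j = (\<chi> a b. if a = i \<and> b = j then 1 else 0)"

text \<open>Extended by \<open>0\<close>, so that \<open>\<eta>\<^sup>k\<^sub>i - Shat k\<^sub>i\<^sub>j \<omega>\<^sup>j\<close> is \<open>\<eta>\<^sup>k\<^sub>i\<close> for \<open>k > 6\<close>.\<close>

definition Shat :: "nat \<Rightarrow> real^4^4" where
  "Shat a =
     (if a = 1 then EE 1 1 - EE 3 3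
      else if a = 2 then EE 1 2 + EE 2 1 - EE 3 4 - EE 4 3
      else if a = 3 then EE 2 2 - EE 4 4
      else if a = 4 then EE 1 3 + EE 3 1
      else if a = 5 then EE 1 4 + EE 4 1 + EE 2 3 + EE 3 2
      else if a = 6 then EE 2 4 + EE 4 2
      else 0)"

definition generators :: "('r::finite \<Rightarrow> nat) \<Rightarrow> 'r + 2 + 'r \<times> 4
    \<Rightarrow> ('v::euclidean_space, 'r) frame \<Rightarrow> ('v, 'r) frame \<Rightarrow> real" where
  "generators num g x v = (case g of
      Inl k \<Rightarrow> theta k x v
    | Inr (Inl b) \<Rightarrow> (if b = 1 then (phi 2 1 x v - phi 4 3 x v) / 2
                               else (phi 3 2 x v - phi 4 1 x v) / 2)
    | Inr (Inr (k, i)) \<Rightarrow> eta k i x v - (\<Sum>j\<in>UNIV. Shat (num k) $ i $ j * omega j x v))"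

text \<open>Adapted moving frames along the immersion \<open>pt \<circ> F\<close>; the last condition says that in the frame
  \<open>e\<close> the second fundamental form is \<open>\<nu>\<^sub>a Shat\<^sup>a\<close>, so that \<open>\<nu>\<^sub>1, \<dots>, \<nu>\<^sub>6\<close> span the first normal space.\<close>

definition adapted_frame_on :: "('r::finite \<Rightarrow> nat) \<Rightarrow> (real^4) set
    \<Rightarrow> (real^4 \<Rightarrow> ('v::euclidean_space, 'r) frame) \<Rightarrow> bool" where
  "adapted_frame_on num U F \<longleftrightarrow> open U \<and> smooth_on U F \<and> (\<forall>x\<in>U.
     F x \<in> frame_bundle num \<and>
     (\<forall>i. ee (F x) $ i \<in> TM (\<lambda>y. pt (F y)) x) \<and>
     (\<forall>i j. II (\<lambda>y. pt (F y)) x (ee (F x) $ i) (ee (F x) $ j)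
              = (\<Sum>a=1..6. Shat a $ i $ j *\<^sub>R nu_at num (F x) a)))"

end

theory Submission
  imports Defs
begin

text \<open>Identify \<open>\<real>\<^sup>4\<close> with \<open>\<complex>\<^sup>2\<close>. Then \<open>QA\<close> consists of the real parts of complex quadratic forms, i.e. of the
  symmetric matrices anticommuting with the complex structure, so every form in it is austere, and its
  stabilizer in \<open>so(4)\<close> is \<open>u(2)\<close>. Along an austere submanifold of type A with \<open>\<delta> = 6\<close> the Codazzi equations
  force the components of the connection transverse to \<open>u(2)\<close> to vanish, and the Gauss equation of these
  components is the vanishing of the complex determinant of the vector-valued form \<open>II\<close>, which is the locus.
  Conversely, on the locus the flat lift (zero connection) is an integral element. Modulo the action of
  \<open>u(2)\<close>, which is absorbed, the tableau consists of the \<open>\<real>\<^sup>r\<close>-valued complex quadratic forms whose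
  polarized determinant with \<open>II\<close> is zero (dimension \<open>6r - 2\<close>). Those vanishing along a fixed complex direction
  have one complex coefficient subject to one complex equation, hence \<open>s\<^sub>1 = 4r\<close> and \<open>s\<^sub>2 = 2r - 2\<close>.
  The prolongation consists of complex cubic forms subject to two complex equations, of dimension
  \<open>8r - 4 = s\<^sub>1 + 2 s\<^sub>2\<close>, so Cartan's test holds.\<close>

section \<open>Calculus of smooth maps\<close>

text \<open>The forms of the system are coordinates of \<open>dp\<close> and
  \<open>de\<^sub>i\<close> in the moving frame, hence values of \<open>inv (frame_map x)\<close>.
  Their smoothness and the structure equations therefore rest on differentiating the inverse of a
  smooth family of linear isomorphisms. They are treated as forms on the open set of all bases;
  orthogonality and the Gram relations enter only through tangent vectors of the locus, a level set
  there. The delicate direction leads from submanifolds to integral manifolds, because an adapted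
  frame is not known in advance to lie in the locus. The pointwise identities are therefore stated
  under \<open>adapt\<close>, which holds for the velocities of every adapted frame; Codazzi must
  yield \<open>psi0\<close> before the Gauss expressions reduce to the Gram relations, since
  otherwise they contain further connection terms. In the Cartan characters, genericity is witnessed
  by the explicit direction \<open>axis 1 1\<close>: a lower bound on the kernel holds in every
  direction, and this one attains it because the determinant condition can be solved for the
  coefficient that is still free.\<close>

abbreviation fderiv where "fderiv f x \<equiv> frechet_derivative f (at x)"

lemma frechet_derivative_apply: "(f has_derivative f') (at x) \<Longrightarrow> fderiv f x u = f' u"
  using frechet_derivative_at[of f f' x] by simp

lemma Ck_on_cong:
  assumes "open S" "\<And>x. x \<in> S \<Longrightarrow> f x = g x" "Ck_on k S f"
  shows "Ck_on k S g"
  using assms(2,3)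
proof (induction k arbitrary: f g)
  case 0
  then show ?case by (simp cong: continuous_on_cong)
next
  case (Suc k)
  have d: "(g has_derivative fderiv f x) (at x)" if "x \<in> S" for x
    using Suc.prems that assms(1)
    by (metis Ck_on.simps(2) frechet_derivative_works has_derivative_transform_within_open)
  then have e: "fderiv f x = fderiv g x" if "x \<in> S" for x
    using that by (metis frechet_derivative_at)
  have "Ck_on k S (\<lambda>x. fderiv g x v)" for v
    by (rule Suc.IH[of "\<lambda>x. fderiv f x v"]) (use e Suc.prems in auto)
  then show ?case using d by (auto simp: differentiable_def)
qed

lemma Ck_on_SucI:
  assumes "open S" "\<And>x. x \<in> S \<Longrightarrow> (f has_derivative f' x) (at x)"
    "\<And>v. Ck_on k S (\<lambda>x. f' x v)"
  shows "Ck_on (Suc k) S f"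
proof -
  have "Ck_on k S (\<lambda>x. fderiv f x v)" for v
    by (rule Ck_on_cong[OF assms(1) _ assms(3)[of v]])
      (use assms(2) in \<open>metis frechet_derivative_at\<close>)
  then show ?thesis using assms(2) by (auto simp: differentiable_def)
qed

lemma Ck_on_SucD: "Ck_on (Suc k) S f \<Longrightarrow> Ck_on k S f"
proof (induction k arbitrary: f)
  case 0
  then show ?case
    by (auto intro!: differentiable_imp_continuous_on simp: differentiable_on_def
        differentiable_at_withinI)
next
  case (Suc k)
  then show ?case by (metis Ck_on.simps(2))
qed

lemma Ck_on_subset: "T \<subseteq> S \<Longrightarrow> Ck_on k S f \<Longrightarrow> Ck_on k T f"
  by (induction k arbitrary: f) (auto intro: continuous_on_subset)

lemma Ck_on_const: "Ck_on k S (\<lambda>x. c)"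
  by (induction k arbitrary: c) auto

lemma Ck_on_add:
  assumes "open S" shows "Ck_on k S f \<Longrightarrow> Ck_on k S g \<Longrightarrow> Ck_on k S (\<lambda>x. f x + g x)"
proof (induction k arbitrary: f g)
  case 0
  then show ?case by (auto intro: continuous_on_add)
next
  case (Suc k)
  show ?case
    by (rule Ck_on_SucI[OF assms, where f' = "\<lambda>x v. fderiv f x v + fderiv g x v"])
      (use Suc in \<open>auto intro!: has_derivative_add simp: frechet_derivative_works\<close>)
qed

lemma Ck_on_linear:
  assumes "open S" "bounded_linear L" shows "Ck_on k S f \<Longrightarrow> Ck_on k S (\<lambda>x. L (f x))"
proof (induction k arbitrary: f)
  case 0
  then show ?case using assms(2) by (auto intro: linear_continuous_on_compose bounded_linear.continuous_on)
next
  case (Suc k)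
  show ?case
    by (rule Ck_on_SucI[OF assms(1), where f' = "\<lambda>x v. L (fderiv f x v)"])
      (use Suc in \<open>auto intro!: bounded_linear.has_derivative[OF assms(2)] simp: frechet_derivative_works\<close>)
qed

lemma Ck_on_bilinear:
  assumes "open S" "bounded_bilinear B"
  shows "Ck_on k S f \<Longrightarrow> Ck_on k S g \<Longrightarrow> Ck_on k S (\<lambda>x. B (f x) (g x))"
proof (induction k arbitrary: f g)
  case 0
  then show ?case using assms(2) by (auto intro: bounded_bilinear.continuous_on)
next
  case (Suc k)
  then have fg: "Ck_on k S f" "Ck_on k S g" by (blast dest: Ck_on_SucD)+
  show ?case
    by (rule Ck_on_SucI[OF assms(1), where f' = "\<lambda>x v. B (f x) (fderiv g x v) + B (fderiv f x v) (g x)"])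
      (use Suc fg in \<open>auto intro!: bounded_bilinear.FDERIV[OF assms(2)] Ck_on_add[OF assms(1)] simp: frechet_derivative_works\<close>)
qed

lemma Ck_on_id: "Ck_on k S (\<lambda>x. x)"
  by (cases k) (auto intro: Ck_on_const)

lemma smooth_on_cong:
  "open S \<Longrightarrow> (\<And>x. x \<in> S \<Longrightarrow> f x = g x) \<Longrightarrow> smooth_on S f \<Longrightarrow> smooth_on S g"
  unfolding smooth_on_def by (blast intro: Ck_on_cong)

lemma smooth_on_subset: "smooth_on S f \<Longrightarrow> T \<subseteq> S \<Longrightarrow> smooth_on T f"
  unfolding smooth_on_def by (blast intro: Ck_on_subset)

lemma smooth_on_const: "smooth_on S (\<lambda>x. c)"
  unfolding smooth_on_def by (blast intro: Ck_on_const)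

lemma smooth_on_id: "smooth_on S (\<lambda>x. x)"
  unfolding smooth_on_def by (blast intro: Ck_on_id)

lemma smooth_on_add:
  "open S \<Longrightarrow> smooth_on S f \<Longrightarrow> smooth_on S g \<Longrightarrow> smooth_on S (\<lambda>x. f x + g x)"
  unfolding smooth_on_def by (blast intro: Ck_on_add)

lemma smooth_on_bounded_linear:
  "open S \<Longrightarrow> bounded_linear L \<Longrightarrow> smooth_on S f \<Longrightarrow> smooth_on S (\<lambda>x. L (f x))"
  unfolding smooth_on_def by (blast intro: Ck_on_linear)

lemma smooth_on_bilinear:
  "open S \<Longrightarrow> bounded_bilinear B \<Longrightarrow> smooth_on S f \<Longrightarrow> smooth_on S g \<Longrightarrow> smooth_on S (\<lambda>x. B (f x) (g x))"
  unfolding smooth_on_def by (blast intro: Ck_on_bilinear)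

lemmas smooth_on_scaleR = smooth_on_bilinear[OF _ bounded_bilinear_scaleR]
lemmas smooth_on_inner = smooth_on_bilinear[OF _ bounded_bilinear_inner]
lemmas smooth_on_mult = smooth_on_bilinear[OF _ bounded_bilinear_mult]

lemma smooth_on_diff:
  "open S \<Longrightarrow> smooth_on S f \<Longrightarrow> smooth_on S g \<Longrightarrow> smooth_on S (\<lambda>x. f x - g x)"
  using smooth_on_add[of S f "\<lambda>x. - g x"] smooth_on_bounded_linear[OF _ bounded_linear_minus[OF bounded_linear_ident], of S g]
  by simp

lemma Ck_on_sum:
  assumes "open S" "\<And>i. i \<in> I \<Longrightarrow> Ck_on k S (f i)"
  shows "Ck_on k S (\<lambda>x. \<Sum>i\<in>I. f i x)"
  using assms(2)
  by (induction I rule: infinite_finite_induct) (auto intro: Ck_on_const Ck_on_add assms(1))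

lemma smooth_on_sum:
  "open S \<Longrightarrow> (\<And>i. i \<in> I \<Longrightarrow> smooth_on S (f i)) \<Longrightarrow> smooth_on S (\<lambda>x. \<Sum>i\<in>I. f i x)"
  unfolding smooth_on_def by (blast intro: Ck_on_sum)

lemma smooth_on_Pair:
  fixes f :: "'a::euclidean_space \<Rightarrow> 'b::euclidean_space" and g :: "'a \<Rightarrow> 'c::euclidean_space"
  assumes "open S" "smooth_on S f" "smooth_on S g"
  shows "smooth_on S (\<lambda>x. (f x, g x))"
proof -
  have 1: "bounded_linear (\<lambda>z::'b. (z, 0::'c))" "bounded_linear (\<lambda>z::'c. (0::'b, z))"
    by (auto simp: linear_conv_bounded_linear[symmetric] intro!: linearI)
  have "smooth_on S (\<lambda>x. (f x, 0) + (0, g x))"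
    by (intro smooth_on_add assms smooth_on_bounded_linear[OF _ 1(1)] smooth_on_bounded_linear[OF _ 1(2)])
  then show ?thesis by simp
qed

lemma smooth_on_vec_lambda:
  fixes f :: "'i::finite \<Rightarrow> 'a::euclidean_space \<Rightarrow> 'b::euclidean_space"
  assumes "open S" "\<And>i. smooth_on S (f i)"
  shows "smooth_on S (\<lambda>x. \<chi> i. f i x)"
proof -
  have 1: "bounded_linear (\<lambda>z::'b. (\<chi> j. if j = i then z else 0) :: 'b^'i)" for i
    by (auto simp: linear_conv_bounded_linear[symmetric] vec_eq_iff intro!: linearI)
  have "smooth_on S (\<lambda>x. \<Sum>i\<in>UNIV. (\<chi> j. if j = i then f i x else 0))"
    by (intro smooth_on_sum assms smooth_on_bounded_linear[OF _ 1])
  moreover have "(\<Sum>i\<in>UNIV. (\<chi> j. if j = i then f i x else 0)) = (\<chi> i. f i x)" for x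
    by (simp add: vec_eq_iff if_distrib cong: if_cong)
  ultimately show ?thesis by simp
qed

lemma smooth_on_nth:
  "open S \<Longrightarrow> smooth_on S f \<Longrightarrow> smooth_on S (\<lambda>x. f x $ i)"
  by (rule smooth_on_bounded_linear[OF _ bounded_linear_vec_nth])

lemma smooth_on_fst:
  "open S \<Longrightarrow> smooth_on S f \<Longrightarrow> smooth_on S (\<lambda>x. fst (f x))"
  by (rule smooth_on_bounded_linear[OF _ bounded_linear_fst])

lemma smooth_on_snd:
  "open S \<Longrightarrow> smooth_on S f \<Longrightarrow> smooth_on S (\<lambda>x. snd (f x))"
  by (rule smooth_on_bounded_linear[OF _ bounded_linear_snd])

lemma smooth_on_derivative:
  "smooth_on S f \<Longrightarrow> smooth_on S (\<lambda>x. fderiv f x v)"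
  unfolding smooth_on_def by (metis Ck_on.simps(2))

lemma smooth_on_has_derivative:
  "smooth_on S f \<Longrightarrow> x \<in> S \<Longrightarrow> (f has_derivative fderiv f x) (at x)"
  unfolding smooth_on_def by (metis Ck_on.simps(2) frechet_derivative_works)

lemma smooth_on_continuous: "smooth_on S f \<Longrightarrow> continuous_on S f"
  unfolding smooth_on_def by (metis Ck_on.simps(1))

section \<open>Smooth families of linear isomorphisms\<close>

lemma linear_expand_Basis:
  fixes L :: "'a::euclidean_space \<Rightarrow> 'b::real_vector"
  assumes "linear L"
  shows "L c = (\<Sum>b\<in>Basis. (c \<bullet> b) *\<^sub>R L b)"
  by (subst euclidean_representation[of c, symmetric]) (simp only: linear_sum[OF assms] linear_scale[OF assms])

text \<open>The image of \<open>c\<close> moves by at most \<open>norm c\<close> times the total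
  movement of the images of the basis vectors. The bound \<open>\<epsilon>\<close> on each movement
  is \<open>B\<close> divided by twice the dimension, so half of the lower bound \<open>B\<close> at
  \<open>y0\<close> survives nearby.\<close>

lemma linear_family_bounded_below:
  fixes T :: "'a::metric_space \<Rightarrow> 'c::euclidean_space \<Rightarrow> 'v::euclidean_space"
  assumes S: "open S" "y0 \<in> S" and lin: "\<And>y. y \<in> S \<Longrightarrow> linear (T y)"
    and cont: "\<And>b. continuous_on S (\<lambda>y. T y b)" and inj: "inj (T y0)"
  obtains m R where "m > 0" "open R" "y0 \<in> R" "R \<subseteq> S" "\<And>y c. y \<in> R \<Longrightarrow> m * norm c \<le> norm (T y c)"
proof -
  obtain B where B: "B > 0" "\<And>c. B * norm c \<le> norm (T y0 c)"
    using linear_inj_bounded_below_pos[OF lin[OF S(2)] inj] by blast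
  define \<epsilon> where "\<epsilon> = B / (2 * DIM('c))"
  have \<epsilon>: "\<epsilon> > 0" "\<epsilon> * DIM('c) = B / 2" using B(1) by (auto simp: \<epsilon>_def)
  define R where "R = (\<Inter>b\<in>Basis. {y\<in>S. dist (T y b) (T y0 b) < \<epsilon>}) \<inter> S"
  have "open {y\<in>S. dist (T y b) (T y0 b) < \<epsilon>}" for b
    using continuous_open_preimage[OF cont S(1) open_ball[of "T y0 b" \<epsilon>], of b]
    by (auto simp: vimage_def Int_def dist_commute)
  then have oR: "open R" unfolding R_def using S(1) by (intro open_Int open_INT) auto
  have "B / 2 * norm c \<le> norm (T y c)" if "y \<in> R" for y c
  proof -
    have yS: "y \<in> S" using that by (auto simp: R_def)
    have r: "T z c = (\<Sum>b\<in>Basis. (c \<bullet> b) *\<^sub>R T z b)" if "z \<in> S" for z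
      by (rule linear_expand_Basis[OF lin[OF that]])
    have "norm (T y c - T y0 c) = norm (\<Sum>b\<in>Basis. (c \<bullet> b) *\<^sub>R (T y b - T y0 b))"
      by (simp add: r yS S(2) scaleR_diff_right sum_subtractf)
    also have "\<dots> \<le> (\<Sum>b\<in>(Basis::'c set). norm c * \<epsilon>)"
    proof (rule sum_norm_le)
      fix b :: 'c assume b: "b \<in> Basis"
      have "\<bar>c \<bullet> b\<bar> * norm (T y b - T y0 b) \<le> norm c * \<epsilon>"
        using that b \<epsilon>(1) by (intro mult_mono[OF Basis_le_norm[OF b]]) (auto simp: R_def dist_norm less_imp_le)
      then show "norm ((c \<bullet> b) *\<^sub>R (T y b - T y0 b)) \<le> norm c * \<epsilon>" by simp
    qed
    also have "\<dots> = B / 2 * norm c" using \<epsilon>(2) by (simp add: mult.commute mult.left_commute)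
    finally have "norm (T y c - T y0 c) \<le> B / 2 * norm c" .
    moreover have "norm (T y0 c) \<le> norm (T y c) + norm (T y c - T y0 c)"
      by (metis norm_triangle_sub norm_minus_commute)
    ultimately show ?thesis using B(2)[of c] by linarith
  qed
  then show thesis using that[of "B/2" R] B(1) oR S \<epsilon>(1) by (auto simp: R_def)
qed

lemma linear_family_inj_open:
  fixes T :: "'a::metric_space \<Rightarrow> 'c::euclidean_space \<Rightarrow> 'v::euclidean_space"
  assumes "open S" and lin: "\<And>y. y \<in> S \<Longrightarrow> linear (T y)"
    and cont: "\<And>b. continuous_on S (\<lambda>y. T y b)"
  shows "open {y\<in>S. inj (T y)}"
proof (subst open_subopen, safe)
  fix y0 assume y0: "y0 \<in> S" "inj (T y0)"
  obtain m R where mR: "m > 0" "open R" "y0 \<in> R" "R \<subseteq> S" "\<And>y c. y \<in> R \<Longrightarrow> m * norm c \<le> norm (T y c)"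
    using linear_family_bounded_below[OF assms(1) y0(1) lin cont y0(2)] by blast
  have "inj (T y)" if "y \<in> R" for y
  proof -
    have "c = 0" if "T y c = 0" for c
      using mR(5)[OF \<open>y \<in> R\<close>, of c] mR(1) that by (simp add: mult_le_0_iff)
    then show ?thesis using linear_injective_0[OF lin[of y]] that mR(4) by blast
  qed
  then show "\<exists>R. open R \<and> y0 \<in> R \<and> R \<subseteq> {y\<in>S. inj (T y)}" using mR by blast
qed

text \<open>At a zero of the differentiable factor, mere continuity of the other factor is enough
  for the product rule. This lets the inverse of a family be differentiated when only its continuity
  is known.\<close>

lemma has_derivative_mult_vanishing:
  fixes h :: "'x::real_normed_vector \<Rightarrow> real" and k :: "'x \<Rightarrow> 'y::real_normed_vector"
  assumes h: "(h has_derivative h') (at y0)" "h y0 = 0" and k: "isCont k y0"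
  shows "((\<lambda>y. h y *\<^sub>R k y) has_derivative (\<lambda>u. h' u *\<^sub>R k y0)) (at y0)"
proof -
  interpret h': bounded_linear h' using h(1) by (rule has_derivative_bounded_linear)
  obtain K where K: "K > 0" "\<And>u. norm (h' u) \<le> norm u * K" using h'.pos_bounded by blast
  have l1: "((\<lambda>y. norm (h y - h y0 - h' (y - y0)) / norm (y - y0)) \<longlongrightarrow> 0) (at y0)"
    using h(1) unfolding has_derivative_iff_norm by blast
  have l2: "((\<lambda>y. norm (k y - k y0)) \<longlongrightarrow> 0) (at y0)"
    using k unfolding isCont_def by (simp add: LIM_zero_iff tendsto_norm_zero_iff)
  have l3: "((\<lambda>y. norm (h y - h y0 - h' (y - y0)) / norm (y - y0) * norm (k y) + K * norm (k y - k y0)) \<longlongrightarrow> 0 * norm (k y0) + K * 0) (at y0)"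
    by (intro tendsto_intros l1 l2) (use k in \<open>simp add: isCont_def\<close>)
  have "((\<lambda>y. norm (h y *\<^sub>R k y - h y0 *\<^sub>R k y0 - h' (y - y0) *\<^sub>R k y0) / norm (y - y0)) \<longlongrightarrow> 0) (at y0)"
  proof (rule tendsto_sandwich[OF _ _ tendsto_const[of 0]])
    show "\<forall>\<^sub>F y in at y0. norm (h y *\<^sub>R k y - h y0 *\<^sub>R k y0 - h' (y - y0) *\<^sub>R k y0) / norm (y - y0)
        \<le> norm (h y - h y0 - h' (y - y0)) / norm (y - y0) * norm (k y) + K * norm (k y - k y0)"
    proof (rule eventually_at_filter[THEN iffD2], rule always_eventually, intro allI impI)
      fix y assume "y \<noteq> y0"
      then have n: "norm (y - y0) > 0" by simp
      have "h y *\<^sub>R k y - h y0 *\<^sub>R k y0 - h' (y - y0) *\<^sub>R k y0 = (h y - h y0 - h' (y - y0)) *\<^sub>R k y + h' (y - y0) *\<^sub>R (k y - k y0)"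
        using h(2) by (simp add: algebra_simps)
      then have "norm (h y *\<^sub>R k y - h y0 *\<^sub>R k y0 - h' (y - y0) *\<^sub>R k y0) \<le>
          norm (h y - h y0 - h' (y - y0)) * norm (k y) + norm (h' (y - y0)) * norm (k y - k y0)"
        by (metis norm_scaleR norm_triangle_ineq real_norm_def)
      also have "\<dots> \<le> norm (h y - h y0 - h' (y - y0)) * norm (k y) + (norm (y - y0) * K) * norm (k y - k y0)"
        by (intro add_left_mono mult_right_mono K(2)) auto
      finally show "norm (h y *\<^sub>R k y - h y0 *\<^sub>R k y0 - h' (y - y0) *\<^sub>R k y0) / norm (y - y0)
        \<le> norm (h y - h y0 - h' (y - y0)) / norm (y - y0) * norm (k y) + K * norm (k y - k y0)"
        using n by (simp add: field_simps)
    qed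
  qed (use l3 in auto)
  then show ?thesis
    unfolding has_derivative_iff_norm by (auto intro: bounded_linear_scaleR_const h'.bounded_linear_axioms)
qed

lemma linear_bij_inv:
  fixes T :: "'c::euclidean_space \<Rightarrow> 'v::euclidean_space"
  assumes "linear T" "bij T"
  shows "T (inv T w) = w" "inv T (T c) = c" "linear (inv T)"
proof -
  show "T (inv T w) = w" "inv T (T c) = c"
    using assms(2) by (simp_all add: bij_is_surj surj_f_inv_f bij_is_inj)
  obtain g where g: "linear g" "T \<circ> g = id"
    using linear_surjective_right_inverse[OF assms(1) bij_is_surj[OF assms(2)]] by blast
  then have "inv T = g"
    by (metis assms(2) bij_is_inj inv_o_cancel fun.map_id0 id_apply comp_assoc comp_id id_comp)
  then show "linear (inv T)" using g by simp
qed

context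
  fixes S :: "'a::euclidean_space set" and T :: "'a \<Rightarrow> 'c::euclidean_space \<Rightarrow> 'v::euclidean_space"
  assumes S: "open S" and lin: "\<And>y. y \<in> S \<Longrightarrow> linear (T y)" and bij: "\<And>y. y \<in> S \<Longrightarrow> bij (T y)"
begin

lemmas inv_family = linear_bij_inv[OF lin bij]

text \<open>Resolvent identity: the difference of the inverses at \<open>y\<close> and
  \<open>y0\<close> is the inverse at \<open>y\<close> applied to
  \<open>w - T y (inv (T y0) w)\<close>. Expanding this vector in the basis makes every summand a
  product whose scalar factor vanishes at \<open>y0\<close>.\<close>

lemma inv_family_expand:
  assumes "y \<in> S" "y0 \<in> S"
  shows "inv (T y) w = inv (T y0) w + (\<Sum>b\<in>Basis. ((w - T y (inv (T y0) w)) \<bullet> b) *\<^sub>R inv (T y) b)"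
proof -
  have "(\<Sum>b\<in>Basis. ((w - T y (inv (T y0) w)) \<bullet> b) *\<^sub>R inv (T y) b) = inv (T y) (w - T y (inv (T y0) w))"
    by (rule linear_expand_Basis[OF inv_family(3)[OF assms(1) assms(1)], symmetric])
  also have "\<dots> = inv (T y) w - inv (T y0) w"
    by (simp add: linear_diff[OF inv_family(3)[OF assms(1) assms(1)]] inv_family(2) assms)
  finally show ?thesis by simp
qed

lemma inv_family_continuous:
  assumes cont: "\<And>c. continuous_on S (\<lambda>y. T y c)"
  shows "continuous_on S (\<lambda>y. inv (T y) w)"
proof (rule continuous_at_imp_continuous_on, intro ballI)
  fix y0 assume y0: "y0 \<in> S"
  obtain m R where mR: "m > 0" "open R" "y0 \<in> R" "R \<subseteq> S" "\<And>y c. y \<in> R \<Longrightarrow> m * norm c \<le> norm (T y c)"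
    using linear_family_bounded_below[OF S y0 lin cont bij_is_inj[OF bij[OF y0]]] by blast
  define c0 where "c0 = inv (T y0) w"
  have b: "norm (inv (T y) w - c0) \<le> norm (w - T y c0) / m" if "y \<in> R" for y
  proof -
    have "y \<in> S" using that mR(4) by auto
    then have "T y (inv (T y) w - c0) = w - T y c0"
      by (simp add: linear_diff[OF lin] inv_family(1))
    then have "m * norm (inv (T y) w - c0) \<le> norm (w - T y c0)"
      using mR(5)[OF that, of "inv (T y) w - c0"] by metis
    then show ?thesis using mR(1) by (simp add: field_simps)
  qed
  have "isCont (\<lambda>y. T y c0) y0" using cont S y0 by (simp add: continuous_on_eq_continuous_at)
  then have "((\<lambda>y. T y c0) \<longlongrightarrow> w) (at y0)"
    by (simp add: isCont_def c0_def inv_family y0)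
  then have "((\<lambda>y. norm (w - T y c0) / m) \<longlongrightarrow> norm (w - w) / m) (at y0)"
    by (intro tendsto_intros) (use mR(1) in auto)
  then have t: "((\<lambda>y. norm (w - T y c0) / m) \<longlongrightarrow> 0) (at y0)" by simp
  have ev: "\<forall>\<^sub>F y in at y0. norm (inv (T y) w - c0) \<le> norm (w - T y c0) / m"
    unfolding eventually_at_topological using mR b by blast
  have "((\<lambda>y. inv (T y) w - c0) \<longlongrightarrow> 0) (at y0)"
    by (rule Lim_null_comparison[OF ev t])
  then show "isCont (\<lambda>y. inv (T y) w) y0"
    by (simp add: isCont_def LIM_zero_iff c0_def)
qed

lemma inv_family_has_derivative:
  assumes sm: "\<And>c. smooth_on S (\<lambda>y. T y c)" and y0: "y0 \<in> S"
  shows "((\<lambda>y. inv (T y) w) has_derivative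
     (\<lambda>u. - inv (T y0) (fderiv (\<lambda>y. T y (inv (T y0) w)) y0 u))) (at y0)"
proof -
  let ?D = "fderiv (\<lambda>y. T y (inv (T y0) w)) y0"
  have d: "((\<lambda>y. T y (inv (T y0) w)) has_derivative ?D) (at y0)"
    by (rule smooth_on_has_derivative[OF sm y0])
  have "isCont (\<lambda>y. inv (T y) b) y0" for b
    using inv_family_continuous[OF smooth_on_continuous[OF sm]] S y0
    by (simp add: continuous_on_eq_continuous_at)
  then have "((\<lambda>y. inv (T y0) w + (\<Sum>b\<in>Basis. ((w - T y (inv (T y0) w)) \<bullet> b) *\<^sub>R inv (T y) b))
     has_derivative (\<lambda>u. 0 + (\<Sum>b\<in>Basis. ((0 - ?D u) \<bullet> b) *\<^sub>R inv (T y0) b))) (at y0)"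
    by (intro has_derivative_add has_derivative_const has_derivative_sum has_derivative_mult_vanishing
        has_derivative_inner_left has_derivative_diff d) (auto simp: inv_family y0)
  moreover have "0 + (\<Sum>b\<in>Basis. ((0 - ?D u) \<bullet> b) *\<^sub>R inv (T y0) b) = - inv (T y0) (?D u)" for u
  proof -
    have "inv (T y0) (?D u) = (\<Sum>b\<in>Basis. (?D u \<bullet> b) *\<^sub>R inv (T y0) b)"
      by (rule linear_expand_Basis[OF inv_family(3)[OF y0 y0]])
    then show ?thesis by (simp add: sum_negf)
  qed
  ultimately have "((\<lambda>y. inv (T y0) w + (\<Sum>b\<in>Basis. ((w - T y (inv (T y0) w)) \<bullet> b) *\<^sub>R inv (T y) b))
     has_derivative (\<lambda>u. - inv (T y0) (?D u))) (at y0)" by simp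
  then show ?thesis
    by (rule has_derivative_transform_within_open[OF _ S y0]) (simp add: inv_family_expand[OF _ y0, symmetric])
qed

text \<open>The derivative of the inverse is, by \<open>e\<close>, a polynomial in the inverse
  itself and in derivatives of \<open>T\<close>, so each order of differentiability of the inverse
  yields the next.\<close>

lemma inv_family_smooth:
  assumes sm: "\<And>c. smooth_on S (\<lambda>y. T y c)"
  shows "smooth_on S (\<lambda>y. inv (T y) w)"
proof -
  let ?D = "\<lambda>c y. fderiv (\<lambda>y. T y c) y"
  have "Ck_on k S (\<lambda>y. inv (T y) w)" for k w
  proof (induction k arbitrary: w)
    case 0
    then show ?case using inv_family_continuous smooth_on_continuous[OF sm] by simp
  next
    case (Suc k)
    have e: "- inv (T y) (?D c y u) =
       - (\<Sum>b\<in>Basis. \<Sum>b'\<in>Basis. ((c \<bullet> b') * (?D b' y u \<bullet> b)) *\<^sub>R inv (T y) b)" if "y \<in> S" for y c u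
    proof -
      have "((\<lambda>y. \<Sum>b'\<in>Basis. (c \<bullet> b') *\<^sub>R T y b') has_derivative (\<lambda>u. \<Sum>b'\<in>Basis. (c \<bullet> b') *\<^sub>R ?D b' y u)) (at y)"
        by (intro has_derivative_sum has_derivative_scaleR_right smooth_on_has_derivative[OF sm that])
      then have "((\<lambda>y. T y c) has_derivative (\<lambda>u. \<Sum>b'\<in>Basis. (c \<bullet> b') *\<^sub>R ?D b' y u)) (at y)"
        by (rule has_derivative_transform_within_open[OF _ S that])
          (rule linear_expand_Basis[OF lin, symmetric])
      then have D: "?D c y u = (\<Sum>b'\<in>Basis. (c \<bullet> b') *\<^sub>R ?D b' y u)"
        by (rule frechet_derivative_apply)
      have "inv (T y) (?D c y u) = (\<Sum>b\<in>Basis. (?D c y u \<bullet> b) *\<^sub>R inv (T y) b)"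
        by (rule linear_expand_Basis[OF inv_family(3)[OF that that]])
      then show ?thesis by (simp add: D inner_sum_left scaleR_sum_left)
    qed
    show ?case
    proof (rule Ck_on_SucI[OF S inv_family_has_derivative[OF sm]])
      fix v
      have "Ck_on k S (\<lambda>y. - (\<Sum>b\<in>Basis. \<Sum>b'\<in>Basis. ((inv (T y) w \<bullet> b') * (?D b' y v \<bullet> b)) *\<^sub>R inv (T y) b))"
        using smooth_on_derivative[OF sm] unfolding smooth_on_def
        by (intro Ck_on_linear[OF S bounded_linear_minus[OF bounded_linear_ident]] Ck_on_sum S
            Ck_on_bilinear[OF S bounded_bilinear_scaleR] Ck_on_bilinear[OF S bounded_bilinear_mult]
            Ck_on_bilinear[OF S bounded_bilinear_inner] Suc Ck_on_const) auto
      then show "Ck_on k S (\<lambda>x. - inv (T x) (?D (inv (T x) w) x v))"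
        by (rule Ck_on_cong[OF S, rotated]) (simp add: e)
    qed
  qed
  then show ?thesis unfolding smooth_on_def by blast
qed

end

section \<open>Symmetry of second derivatives and pullback of forms\<close>

text \<open>The mean value theorem acts on the difference of \<open>f\<close> along two segments
  parallel to \<open>u\<close> and displaced by \<open>h *\<^sub>R v\<close>, and again on the
  \<open>u\<close>-derivative along \<open>v\<close>. The second difference on the left is symmetric
  in \<open>u\<close> and \<open>v\<close>, which forces the mixed derivatives to agree in the
  limit.\<close>

lemma second_difference_mean_value:
  fixes f :: "'a::euclidean_space \<Rightarrow> real"
  assumes f: "smooth_on S f" and h: "h > 0"
    and S: "\<And>a b. 0 \<le> a \<Longrightarrow> a \<le> h \<Longrightarrow> 0 \<le> b \<Longrightarrow> b \<le> h \<Longrightarrow> x + a *\<^sub>R u + b *\<^sub>R v \<in> S"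
  obtains a b where "0 \<le> a" "a \<le> h" "0 \<le> b" "b \<le> h"
    "f (x + h *\<^sub>R u + h *\<^sub>R v) - f (x + h *\<^sub>R u) - f (x + h *\<^sub>R v) + f x =
     h * h * fderiv (\<lambda>y. fderiv f y u) (x + a *\<^sub>R u + b *\<^sub>R v) v"
proof -
  let ?Du = "\<lambda>y. fderiv f y u"
  have line: "((\<lambda>t. g (p + t *\<^sub>R w)) has_real_derivative fderiv g (p + t *\<^sub>R w) w) (at t)"
    if "smooth_on S g" "p + t *\<^sub>R w \<in> S" for g :: "'a \<Rightarrow> real" and p w t
  proof -
    have g: "(g has_derivative fderiv g (p + t *\<^sub>R w)) (at (p + t *\<^sub>R w))"
      by (rule smooth_on_has_derivative[OF that])
    have "((\<lambda>t. g (p + t *\<^sub>R w)) has_derivative (\<lambda>s. fderiv g (p + t *\<^sub>R w) (s *\<^sub>R w))) (at t)"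
      by (rule has_derivative_compose[where g = g and f = "\<lambda>t. p + t *\<^sub>R w", OF _ g]) (auto intro!: derivative_eq_intros)
    then show ?thesis
      by (simp add: has_field_derivative_def linear_scale[OF has_derivative_linear[OF g]] mult_commute_abs)
  qed
  let ?A = "\<lambda>t. f ((x + h *\<^sub>R v) + t *\<^sub>R u) - f (x + t *\<^sub>R u)"
  have "\<exists>a>0. a < h \<and> ?A h - ?A 0 = (h - 0) * (?Du ((x + h *\<^sub>R v) + a *\<^sub>R u) - ?Du (x + a *\<^sub>R u))"
  proof (rule MVT2[OF h])
    fix t assume "0 \<le> t" "t \<le> h"
    then show "(?A has_real_derivative ?Du ((x + h *\<^sub>R v) + t *\<^sub>R u) - ?Du (x + t *\<^sub>R u)) (at t)"
      using S[of t 0] S[of t h] h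
      by (intro DERIV_diff line f) (auto simp: algebra_simps)
  qed
  then obtain a where a: "0 < a" "a < h"
    "?A h - ?A 0 = h * (?Du ((x + a *\<^sub>R u) + h *\<^sub>R v) - ?Du ((x + a *\<^sub>R u) + 0 *\<^sub>R v))"
    by (auto simp: algebra_simps)
  have "\<exists>b>0. b < h \<and> ?Du ((x + a *\<^sub>R u) + h *\<^sub>R v) - ?Du ((x + a *\<^sub>R u) + 0 *\<^sub>R v) =
    (h - 0) * fderiv ?Du ((x + a *\<^sub>R u) + b *\<^sub>R v) v"
  proof (rule MVT2[OF h])
    fix t assume "0 \<le> t" "t \<le> h"
    then show "((\<lambda>t. ?Du ((x + a *\<^sub>R u) + t *\<^sub>R v)) has_real_derivative
       fderiv ?Du ((x + a *\<^sub>R u) + t *\<^sub>R v) v) (at t)"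
      using S[of a t] a by (intro line smooth_on_derivative f) auto
  qed
  then obtain b where b: "0 < b" "b < h" "?A h - ?A 0 = h * h * fderiv ?Du (x + a *\<^sub>R u + b *\<^sub>R v) v"
    using a(3) by auto
  show thesis
    by (rule that[of a b]) (use a b in \<open>auto simp: algebra_simps\<close>)
qed

lemma second_derivative_symmetric_real:
  fixes f :: "'a::euclidean_space \<Rightarrow> real"
  assumes S: "open S" "x \<in> S" and f: "smooth_on S f"
  shows "fderiv (\<lambda>y. fderiv f y u) x v =
    fderiv (\<lambda>y. fderiv f y v) x u"
    (is "?P u v x = ?P v u x")
proof (rule ccontr)
  assume "?P u v x \<noteq> ?P v u x"
  define \<epsilon> where "\<epsilon> = \<bar>?P u v x - ?P v u x\<bar> / 2"
  then have \<epsilon>: "\<epsilon> > 0" using \<open>?P u v x \<noteq> ?P v u x\<close> by simp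
  have "isCont (?P u v) x" "isCont (?P v u) x"
    using smooth_on_continuous[OF smooth_on_derivative[OF smooth_on_derivative[OF f]]] S
    by (auto simp: continuous_on_eq_continuous_at)
  then obtain d1 d2 where d12: "d1 > 0" "d2 > 0" "\<And>y. dist y x < d1 \<Longrightarrow> dist (?P u v y) (?P u v x) < \<epsilon>"
    "\<And>y. dist y x < d2 \<Longrightarrow> dist (?P v u y) (?P v u x) < \<epsilon>"
    using \<epsilon> unfolding continuous_at_eps_delta by metis
  obtain d3 where d3: "d3 > 0" "ball x d3 \<subseteq> S" using S openE by blast
  define d where "d = min d1 (min d2 d3)"
  \<comment> \<open>The norms make the parallelogram with sides \<open>h *\<^sub>R u\<close> and
    \<open>h *\<^sub>R v\<close> fit into the ball of radius \<open>d\<close>; the summand 1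
    excludes division by zero and makes the estimate strict.\<close>
  define h where "h = d / (norm u + norm v + 1)"
  have d: "d > 0" using d12 d3 by (auto simp: d_def)
  have n: "norm u + norm v + 1 > 0" by (simp add: add_nonneg_pos)
  then have h: "h > 0" using d by (simp add: h_def)
  have near: "dist (x + a *\<^sub>R p + b *\<^sub>R q) x < d"
    if "0 \<le> a" "a \<le> h" "0 \<le> b" "b \<le> h" "{p, q} = {u, v}" for a b p q
  proof -
    have "dist (x + a *\<^sub>R p + b *\<^sub>R q) x = norm (a *\<^sub>R p + b *\<^sub>R q)" by (simp add: dist_norm)
    also have "\<dots> \<le> a * norm p + b * norm q"
      using that by (metis abs_of_nonneg norm_scaleR norm_triangle_ineq)
    also have "\<dots> \<le> h * norm p + h * norm q" using that by (intro add_mono mult_right_mono) auto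
    also have "\<dots> = h * (norm u + norm v)" using that(5) by (auto simp: doubleton_eq_iff algebra_simps)
    also have "\<dots> < h * (norm u + norm v + 1)" using h by (simp add: algebra_simps)
    also have "\<dots> = d" using n by (simp add: h_def)
    finally show ?thesis .
  qed
  have inS: "y \<in> S" if "dist y x < d" for y using that d3 by (auto simp: d_def dist_commute)
  obtain a b where ab: "0 \<le> a" "a \<le> h" "0 \<le> b" "b \<le> h"
    "f (x + h *\<^sub>R u + h *\<^sub>R v) - f (x + h *\<^sub>R u) - f (x + h *\<^sub>R v) + f x = h * h * ?P u v (x + a *\<^sub>R u + b *\<^sub>R v)"
    by (rule second_difference_mean_value[OF f h, of x u v]) (auto intro!: inS near)
  obtain a' b' where ab': "0 \<le> a'" "a' \<le> h" "0 \<le> b'" "b' \<le> h"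
    "f (x + h *\<^sub>R v + h *\<^sub>R u) - f (x + h *\<^sub>R v) - f (x + h *\<^sub>R u) + f x = h * h * ?P v u (x + a' *\<^sub>R v + b' *\<^sub>R u)"
    by (rule second_difference_mean_value[OF f h, of x v u]) (auto intro!: inS near)
  have "h * h * ?P u v (x + a *\<^sub>R u + b *\<^sub>R v) = h * h * ?P v u (x + a' *\<^sub>R v + b' *\<^sub>R u)"
    using ab(5) ab'(5) by (simp add: algebra_simps)
  then have "?P u v (x + a *\<^sub>R u + b *\<^sub>R v) = ?P v u (x + a' *\<^sub>R v + b' *\<^sub>R u)" using h by simp
  moreover have "dist (?P u v (x + a *\<^sub>R u + b *\<^sub>R v)) (?P u v x) < \<epsilon>"
    using near[OF ab(1-4), of u v] by (intro d12) (auto simp: d_def)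
  moreover have "dist (?P v u (x + a' *\<^sub>R v + b' *\<^sub>R u)) (?P v u x) < \<epsilon>"
    using near[OF ab'(1-4), of v u] by (intro d12) (auto simp: d_def)
  ultimately show False unfolding \<epsilon>_def dist_real_def by (simp add: abs_if split: if_splits)
qed

lemma second_derivative_symmetric:
  fixes f :: "'a::euclidean_space \<Rightarrow> 'b::euclidean_space"
  assumes S: "open S" "x \<in> S" and f: "smooth_on S f"
  shows "fderiv (\<lambda>y. fderiv f y u) x v =
    fderiv (\<lambda>y. fderiv f y v) x u"
proof (rule euclidean_eqI)
  fix b :: 'b
  let ?g = "\<lambda>y. f y \<bullet> b"
  have g: "smooth_on S ?g" by (intro smooth_on_inner S f smooth_on_const)
  have D: "fderiv ?g y w = fderiv f y w \<bullet> b" if "y \<in> S" for y w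
    by (rule frechet_derivative_apply[OF has_derivative_inner_left[OF smooth_on_has_derivative[OF f that]]])
  have DD: "fderiv (\<lambda>y. fderiv ?g y w) x z =
      fderiv (\<lambda>y. fderiv f y w) x z \<bullet> b" for w z
  proof -
    have "((\<lambda>y. fderiv f y w \<bullet> b) has_derivative
        (\<lambda>z. fderiv (\<lambda>y. fderiv f y w) x z \<bullet> b)) (at x)"
      by (intro has_derivative_inner_left smooth_on_has_derivative[OF smooth_on_derivative[OF f] S(2)])
    then have "((\<lambda>y. fderiv ?g y w) has_derivative
        (\<lambda>z. fderiv (\<lambda>y. fderiv f y w) x z \<bullet> b)) (at x)"
      by (rule has_derivative_transform_within_open[OF _ S]) (simp add: D)
    then show ?thesis by (rule frechet_derivative_apply)
  qed
  show "fderiv (\<lambda>y. fderiv f y u) x v \<bullet> b =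
    fderiv (\<lambda>y. fderiv f y v) x u \<bullet> b"
    using second_derivative_symmetric_real[OF S g, of u v] by (simp add: DD)
qed

text \<open>Differentiating \<open>\<alpha> (F y) (fderiv F y v) = 0\<close> in the direction
  \<open>u\<close> replaces the derivative of \<open>\<alpha>\<close> by the value of
  \<open>\<alpha>\<close> on a second derivative of \<open>F\<close>, which is symmetric in
  \<open>u\<close> and \<open>v\<close> and disappears on antisymmetrization.\<close>

lemma ext_d_eq_0_of_pullback_eq_0:
  fixes F :: "'a::euclidean_space \<Rightarrow> 'e::euclidean_space"
  assumes S: "open S" "x \<in> S" and F: "smooth_on S F"
    and U: "open U" "F x \<in> U" and \<alpha>: "smooth_form_on U \<alpha>"
    and 0: "\<And>y u. y \<in> S \<Longrightarrow> \<alpha> (F y) (fderiv F y u) = 0"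
  shows "ext_d \<alpha> (F x) (fderiv F x u) (fderiv F x v) = 0"
proof -
  let ?D = "frechet_derivative F"
  let ?DD = "\<lambda>u v. fderiv (\<lambda>y. ?D (at y) v) x u"
  have linU: "linear (\<alpha> z)" if "z \<in> U" for z using \<alpha> that by (auto simp: smooth_form_on_def)
  have sm: "smooth_on U (\<lambda>z. \<alpha> z w)" for w using \<alpha> by (auto simp: smooth_form_on_def)
  define S' where "S' = S \<inter> F -` U"
  have S': "open S'" "x \<in> S'" "S' \<subseteq> S"
    unfolding S'_def using continuous_open_preimage[OF smooth_on_continuous[OF F] S(1) U(1)] S U by auto
  have rep: "\<alpha> z w = (\<Sum>b\<in>Basis. (w \<bullet> b) * \<alpha> z b)" if "z \<in> U" for z w
    using linear_expand_Basis[OF linU[OF that], of w] by simp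
  have Fx: "(F has_derivative ?D (at x)) (at x)" by (rule smooth_on_has_derivative[OF F S(2)])
  have key: "fderiv (\<lambda>z. \<alpha> z (?D (at x) v)) (F x) (?D (at x) u) = - \<alpha> (F x) (?DD u v)" for u v
  proof -
    let ?A = "\<lambda>b. fderiv (\<lambda>z. \<alpha> z b) (F x)"
    have a: "((\<lambda>z. \<alpha> z b) has_derivative ?A b) (at (F x))" for b
      by (rule smooth_on_has_derivative[OF sm U(2)])
    have b: "((\<lambda>y. \<alpha> (F y) b) has_derivative (\<lambda>u. ?A b (?D (at x) u))) (at x)" for b
      by (rule has_derivative_compose[OF Fx a])
    have "((\<lambda>y. \<Sum>b\<in>Basis. (?D (at y) v \<bullet> b) * \<alpha> (F y) b) has_derivative
       (\<lambda>u. \<Sum>b\<in>Basis. (?D (at x) v \<bullet> b) * ?A b (?D (at x) u) + (?DD u v \<bullet> b) * \<alpha> (F x) b)) (at x)"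
      by (intro has_derivative_sum has_derivative_mult b has_derivative_inner_left
          smooth_on_has_derivative[OF smooth_on_derivative[OF F] S(2)])
    moreover have "(\<Sum>b\<in>Basis. (?D (at y) v \<bullet> b) * \<alpha> (F y) b) = 0" if "y \<in> S'" for y
      using 0[of y v] rep[of "F y" "?D (at y) v"] that by (auto simp: S'_def)
    ultimately have "((\<lambda>y. 0) has_derivative
       (\<lambda>u. \<Sum>b\<in>Basis. (?D (at x) v \<bullet> b) * ?A b (?D (at x) u) + (?DD u v \<bullet> b) * \<alpha> (F x) b)) (at x)"
      by (rule has_derivative_transform_within_open[OF _ S'(1,2)])
    then have z: "(\<Sum>b\<in>Basis. (?D (at x) v \<bullet> b) * ?A b (?D (at x) u)) + (\<Sum>b\<in>Basis. (?DD u v \<bullet> b) * \<alpha> (F x) b) = 0"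
      using fun_cong[OF has_derivative_unique[OF _ has_derivative_const[of 0 "at x"]], of _ u] by (simp add: sum.distrib)
    have "((\<lambda>z. \<Sum>b\<in>Basis. (?D (at x) v \<bullet> b) * \<alpha> z b) has_derivative
       (\<lambda>w. \<Sum>b\<in>Basis. (?D (at x) v \<bullet> b) * ?A b w)) (at (F x))"
      by (intro has_derivative_sum has_derivative_mult_right a)
    then have "((\<lambda>z. \<alpha> z (?D (at x) v)) has_derivative
       (\<lambda>w. \<Sum>b\<in>Basis. (?D (at x) v \<bullet> b) * ?A b w)) (at (F x))"
      by (rule has_derivative_transform_within_open[OF _ U]) (simp add: rep[symmetric])
    then have "fderiv (\<lambda>z. \<alpha> z (?D (at x) v)) (F x) (?D (at x) u) =
      (\<Sum>b\<in>Basis. (?D (at x) v \<bullet> b) * ?A b (?D (at x) u))"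
      by (rule frechet_derivative_apply)
    then show ?thesis using z rep[OF U(2), of "?DD u v"] by simp
  qed
  show ?thesis unfolding ext_d_def key
    using second_derivative_symmetric[OF S F, of u v] by simp
qed

section \<open>Level sets and dimension counts\<close>

text \<open>The curve with velocity \<open>v\<close> is the preimage of the line \<open>x + t v\<close> under the local diffeomorphism
  \<open>\<Phi> y = y + B (g y - Dg(x) (y - x))\<close>, where \<open>B\<close> is a right inverse of \<open>Dg(x)\<close>.\<close>

lemma tangent_at_level_set:
  fixes g :: "'i \<Rightarrow> 'e::euclidean_space \<Rightarrow> real"
  assumes I: "finite I" and U: "open U" "x \<in> U" "x \<in> M"
    and M: "M \<inter> U = {y\<in>U. \<forall>i\<in>I. g i y = 0}"
    and g: "\<And>i. i \<in> I \<Longrightarrow> smooth_on U (g i)"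
    and surj: "\<And>c. \<exists>v. \<forall>i\<in>I. fderiv (g i) x v = c i"
  shows "tangent_at M x = {v. \<forall>i\<in>I. fderiv (g i) x v = 0}"
proof (intro equalityI subsetI CollectI ballI)
  fix v i assume "v \<in> tangent_at M x" and i: "i \<in> I"
  then obtain \<gamma> where \<gamma>: "\<gamma> 0 = x" "\<And>t. \<gamma> t \<in> M" "(\<gamma> has_vector_derivative v) (at 0)"
    unfolding tangent_at_def by blast
  have d: "(g i has_derivative fderiv (g i) (\<gamma> 0)) (at (\<gamma> 0))"
    using smooth_on_has_derivative[OF g[OF i] U(2)] \<gamma>(1) by simp
  have "((\<lambda>t. g i (\<gamma> t)) has_derivative (\<lambda>t. fderiv (g i) (\<gamma> 0) (t *\<^sub>R v))) (at 0)"
    by (rule has_derivative_compose[OF \<gamma>(3)[unfolded has_vector_derivative_def] d])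
  moreover obtain T where T: "open T" "0 \<in> T" "\<And>t. t \<in> T \<Longrightarrow> \<gamma> t \<in> U"
  proof -
    have "isCont \<gamma> 0" using \<gamma>(3) has_vector_derivative_continuous by blast
    then have "\<forall>\<^sub>F t in nhds 0. \<gamma> t \<in> U"
      using U \<gamma>(1) by (simp add: continuous_at_open eventually_nhds)
    then show thesis using that unfolding eventually_nhds by blast
  qed
  moreover have "g i (\<gamma> t) = 0" if "t \<in> T" for t using T(3)[OF that] \<gamma>(2)[of t] M i by blast
  ultimately have "((\<lambda>t. 0) has_derivative (\<lambda>t. fderiv (g i) (\<gamma> 0) (t *\<^sub>R v))) (at 0)"
    by (meson has_derivative_transform_within_open)
  from fun_cong[OF has_derivative_unique[OF this has_derivative_const], of 1]
  show "fderiv (g i) x v = 0" using \<gamma>(1) by simp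
next
  fix v assume "v \<in> {v. \<forall>i\<in>I. fderiv (g i) x v = 0}"
  then have v: "\<And>i. i \<in> I \<Longrightarrow> fderiv (g i) x v = 0" by blast
  let ?D = "\<lambda>i. fderiv (g i) x"
  have D: "linear (?D i)" if "i \<in> I" for i
    using smooth_on_has_derivative[OF g[OF that] U(2)] by (rule has_derivative_linear)
  have bD: "bounded_linear (?D i)" if "i \<in> I" for i
    using D[OF that] by (simp add: linear_conv_bounded_linear)
  have "\<exists>b. \<forall>j\<in>I. ?D j b = (if j = i then 1 else 0)" for i by (rule surj)
  then obtain B where B: "\<And>i j. j \<in> I \<Longrightarrow> ?D j (B i) = (if j = i then 1 else 0)" by metis
  define \<Phi> where "\<Phi> y = y + (\<Sum>i\<in>I. (g i y - ?D i (y - x)) *\<^sub>R B i)" for y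
  define \<Phi>' where "\<Phi>' y u = u + (\<Sum>i\<in>I. (fderiv (g i) y u - ?D i u) *\<^sub>R B i)" for y u
  have gx: "g i x = 0" if "i \<in> I" for i using M U that by blast
  have \<Phi>x: "\<Phi> x = x" by (simp add: \<Phi>_def gx linear_0[OF D])
  have \<Phi>'x: "\<Phi>' x = id" by (rule ext) (simp add: \<Phi>'_def)
  have d: "(\<Phi> has_derivative \<Phi>' y) (at y)" if "y \<in> U" for y
    unfolding \<Phi>_def \<Phi>'_def
    by (auto intro!: derivative_eq_intros smooth_on_has_derivative[OF g] that
        bounded_linear.has_derivative[OF bD])
  have bl: "bounded_linear (\<Phi>' y)" if "y \<in> U" for y using d[OF that] by (rule has_derivative_bounded_linear)
  have app: "blinfun_apply (Blinfun (\<Phi>' y)) = \<Phi>' y" if "y \<in> U" for y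
    by (rule bounded_linear_Blinfun_apply[OF bl[OF that]])
  have cont: "continuous_on U (\<lambda>y. Blinfun (\<Phi>' y))"
  proof (rule continuous_on_blinfun_componentwise)
    fix b
    have "continuous_on U (\<lambda>y. \<Phi>' y b)" unfolding \<Phi>'_def
      by (intro continuous_intros smooth_on_continuous smooth_on_derivative g)
    then show "continuous_on U (\<lambda>y. blinfun_apply (Blinfun (\<Phi>' y)) b)"
      by (simp add: app cong: continuous_on_cong)
  qed
  have "id_blinfun o\<^sub>L Blinfun (\<Phi>' x) = id_blinfun"
    by (rule blinfun_eqI) (use app[OF U(2)] \<Phi>'x in simp)
  then obtain U' V h h' where h: "open U'" "U' \<subseteq> U" "x \<in> U'" "open V" "\<Phi> x \<in> V" "homeomorphism U' V \<Phi> h"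
    "\<And>y. y \<in> V \<Longrightarrow> (h has_derivative (h' y)) (at y)"
    "\<And>y. y \<in> V \<Longrightarrow> h' y = inv (blinfun_apply (Blinfun (\<Phi>' (h y))))"
    using inverse_function_theorem[OF U(1) _ cont U(2), of \<Phi> id_blinfun] d app by metis
  have hx: "h x = x" using h(3,6) \<Phi>x by (metis homeomorphism_apply1)
  have xV: "x \<in> V" using h(5) \<Phi>x by simp
  have h'x: "h' x = id" using h(8)[OF xV] app[OF U(2)] by (simp add: hx \<Phi>'x)
  \<comment> \<open>\<open>tangent_at\<close> asks for a curve that stays in \<open>M\<close> at all
    times, so the curve rests at \<open>x\<close> whenever the line is outside
    \<open>V\<close>.\<close>
  define \<gamma> where "\<gamma> t = (if x + t *\<^sub>R v \<in> V then h (x + t *\<^sub>R v) else x)" for t :: real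
  have "\<gamma> t \<in> M" for t
  proof (cases "x + t *\<^sub>R v \<in> V")
    case True
    define y where "y = h (x + t *\<^sub>R v)"
    have y: "y \<in> U'" "\<Phi> y = x + t *\<^sub>R v"
      using True h(6) unfolding y_def homeomorphism_def by auto
    have "g j y = 0" if "j \<in> I" for j
    proof -
      \<comment> \<open>Applying \<open>?D j\<close> to this equation cancels
        \<open>?D j (y - x)\<close>, because the vectors \<open>B i\<close> are dual to the
        differentials, and leaves \<open>g j y = 0\<close>.\<close>
      have "y - x + (\<Sum>i\<in>I. (g i y - ?D i (y - x)) *\<^sub>R B i) = t *\<^sub>R v"
        using y(2) by (simp add: \<Phi>_def algebra_simps)
      then have "?D j (y - x + (\<Sum>i\<in>I. (g i y - ?D i (y - x)) *\<^sub>R B i)) = ?D j (t *\<^sub>R v)"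
        by (rule arg_cong)
      then have "?D j (y - x) + (\<Sum>i\<in>I. (g i y - ?D i (y - x)) * ?D j (B i)) = t * ?D j v"
        unfolding linear_add[OF D[OF that]] linear_sum[OF D[OF that]] linear_scale[OF D[OF that]]
        by simp
      moreover have "(\<Sum>i\<in>I. (g i y - ?D i (y - x)) * ?D j (B i)) = (\<Sum>i\<in>I. if j = i then g i y - ?D i (y - x) else 0)"
        by (rule sum.cong) (auto simp: B that)
      ultimately show ?thesis using I that v[OF that] by simp
    qed
    then have "y \<in> M" using y(1) h(2) M by blast
    then show ?thesis using True by (simp add: \<gamma>_def y_def)
  qed (simp add: \<gamma>_def U)
  moreover have "\<gamma> 0 = x" by (simp add: \<gamma>_def xV hx)
  moreover have "(\<gamma> has_vector_derivative v) (at 0)"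
  proof -
    have "(h has_derivative id) (at (x + 0 *\<^sub>R v))" using h(7)[OF xV] h'x by simp
    then have "((\<lambda>t. h (x + t *\<^sub>R v)) has_derivative (\<lambda>t. id (t *\<^sub>R v))) (at 0)"
      by (rule has_derivative_compose[where g = h and f = "\<lambda>t. x + t *\<^sub>R v", rotated])
        (auto intro!: derivative_eq_intros)
    then have *: "((\<lambda>t. h (x + t *\<^sub>R v)) has_vector_derivative v) (at 0)"
      by (simp add: has_vector_derivative_def)
    have "continuous_on UNIV (\<lambda>t. x + t *\<^sub>R v)" by (intro continuous_intros)
    then have o: "open ((\<lambda>t. x + t *\<^sub>R v) -` V)"
      using h(4) continuous_open_vimage[of V "\<lambda>t. x + t *\<^sub>R v"] by (simp add: continuous_on_eq_continuous_at)
    show ?thesis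
      by (rule has_vector_derivative_transform_within_open[OF * o]) (auto simp: \<gamma>_def xV)
  qed
  ultimately show "v \<in> tangent_at M x" unfolding tangent_at_def by blast
qed

text \<open>The orthogonal complement of the kernel is mapped isomorphically onto the range.\<close>

lemma dim_kernel_plus_dim_range:
  fixes f :: "'a::euclidean_space \<Rightarrow> 'b::euclidean_space"
  assumes f: "linear f"
  shows "dim {x. f x = 0} + dim (range f) = DIM('a)"
proof -
  let ?K = "{x. f x = 0}"
  let ?T = "{y \<in> UNIV. \<forall>x\<in>?K. orthogonal x y}"
  have K: "subspace ?K" by (rule linear_subspace_kernel[OF f])
  have d: "dim ?T + dim ?K = DIM('a)"
    using dim_subspace_orthogonal_to_vectors[OF K subspace_UNIV] by simp
  have T: "subspace ?T" using subspace_orthogonal_to_vectors[of ?K] by simp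
  have "inj_on f (span ?T)"
  proof (rule inj_onI)
    fix a b assume "a \<in> span ?T" "b \<in> span ?T" "f a = f b"
    then have "a \<in> ?T" "b \<in> ?T" using T by (simp_all add: span_eq_iff[THEN iffD2])
    then have "a - b \<in> ?T" "a - b \<in> ?K" using subspace_diff[OF T, of a b] \<open>f a = f b\<close>
      by (simp_all add: linear_diff[OF f])
    then show "a = b" by (auto simp: orthogonal_def)
  qed
  then have "dim (f ` ?T) = dim ?T" by (rule dim_image_eq[OF f])
  moreover have "f ` ?T = range f"
  proof (intro equalityI subsetI)
    fix z assume "z \<in> range f"
    then obtain x where x: "z = f x" by blast
    obtain y w where yw: "y \<in> span ?K" "\<And>u. u \<in> span ?K \<Longrightarrow> orthogonal w u" "x = y + w"
      using orthogonal_subspace_decomp_exists[of ?K x] by blast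
    then have "w \<in> ?T" "f y = 0"
      using K by (auto simp: span_eq_iff[THEN iffD2] orthogonal_commute)
    then show "z \<in> f ` ?T" using x yw(3) by (auto simp: linear_add[OF f])
  qed auto
  ultimately show ?thesis using d by simp
qed

lemma dim_kernel_surj:
  fixes f :: "'a::euclidean_space \<Rightarrow> 'b::euclidean_space"
  assumes "linear f" "\<And>y. \<exists>x. f x = y"
  shows "dim {x. f x = 0} + DIM('b) = DIM('a)"
proof -
  have "range f = UNIV" using assms(2) by (metis surj_def)
  then show ?thesis using dim_kernel_plus_dim_range[OF assms(1)] by simp
qed

lemma dim_kernel_ge:
  fixes f :: "'a::euclidean_space \<Rightarrow> 'b::euclidean_space"
  assumes "linear f"
  shows "DIM('a) \<le> dim {x. f x = 0} + DIM('b)"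
  using dim_kernel_plus_dim_range[OF assms] dim_subset_UNIV[of "range f"] by linarith

lemma dim_inj_image:
  fixes f :: "'a::euclidean_space \<Rightarrow> 'b::euclidean_space"
  assumes "linear f" "inj f"
  shows "dim (f ` S) = dim S"
  using dim_image_eq[OF assms(1)] assms(2) inj_on_subset by blast

section \<open>The structure equations\<close>

lemma linear_frame_map: "linear (frame_map x)"
  unfolding frame_map_def by (rule linearI) (simp_all add: algebra_simps sum.distrib scaleR_sum_right)

lemma linear_frame_map_left: "linear (\<lambda>x. frame_map x c)"
  unfolding frame_map_def by (rule linearI) (simp_all add: algebra_simps sum.distrib scaleR_sum_right)

lemma frame_map_axis [simp]:
  "frame_map x (axis i 1, 0) = ee x $ i" "frame_map x (0, axis k 1) = nu x $ k"
  by (simp_all add: frame_map_def axis_def if_distrib[of "\<lambda>c. c *\<^sub>R _"] cong: if_cong)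

lemma inner_representation:
  fixes f :: "'v::euclidean_space \<Rightarrow> real"
  assumes "linear f"
  obtains w where "\<And>z. f z = w \<bullet> z"
proof -
  have "f z = (\<Sum>b\<in>Basis. f b *\<^sub>R b) \<bullet> z" for z
    using linear_expand_Basis[OF assms, of z] by (simp add: inner_sum_left inner_sum_right inner_commute[of _ z] mult.commute)
  then show thesis using that by blast
qed

section \<open>Connection forms as coordinates of the velocity of a moving basis\<close>

definition tau :: "('v::euclidean_space, 'r::finite) frame \<Rightarrow> ('v, 'r) frame \<Rightarrow> (real^4) \<times> (real^'r)" where
  "tau x v = inv (frame_map x) (pt v)"

text \<open>The Maurer-Cartan form: the velocity of the frame map read in the coordinates of the
  frame itself. Its four blocks are \<open>phi\<close>, \<open>eta\<close>, \<open>zeta\<close> and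
  \<open>kappa\<close>.\<close>

definition kap :: "('v::euclidean_space, 'r::finite) frame \<Rightarrow> ('v, 'r) frame \<Rightarrow> (real^4) \<times> (real^'r) \<Rightarrow> (real^4) \<times> (real^'r)" where
  "kap x v c = inv (frame_map x) (frame_map v c)"

text \<open>With \<open>kappa\<close>, the components of the velocity of the normals:
  \<open>d\<nu>\<^sub>k = e\<^sub>i zeta\<^sup>i\<^sub>k + \<nu>\<^sub>l
  kappa\<^sup>l\<^sub>k\<close>. These forms are not generators but occur in the exterior
  derivatives of the generators.\<close>

definition zeta :: "4 \<Rightarrow> 'r \<Rightarrow> ('v::euclidean_space, 'r::finite) frame \<Rightarrow> ('v, 'r) frame \<Rightarrow> real" where
  "zeta i k x v = fst (inv (frame_map x) (nu v $ k)) $ i"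

definition kappa :: "'r \<Rightarrow> 'r \<Rightarrow> ('v::euclidean_space, 'r::finite) frame \<Rightarrow> ('v, 'r) frame \<Rightarrow> real" where
  "kappa l k x v = snd (inv (frame_map x) (nu v $ k)) $ l"

lemma forms_conv:
  "omega i x v = fst (tau x v) $ i" "theta k x v = snd (tau x v) $ k"
  "phi j i x v = fst (kap x v (axis i 1, 0)) $ j" "eta k i x v = snd (kap x v (axis i 1, 0)) $ k"
  "zeta j k x v = fst (kap x v (0, axis k 1)) $ j" "kappa l k x v = snd (kap x v (0, axis k 1)) $ l"
  by (simp_all add: omega_def theta_def phi_def eta_def zeta_def kappa_def tau_def kap_def)

definition bases :: "('v::euclidean_space, 'r::finite) frame set" where
  "bases = {x. bij (frame_map x)}"

lemma frame_map_inv: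
  assumes "x \<in> bases"
  shows "frame_map x (inv (frame_map x) w) = w" "inv (frame_map x) (frame_map x c) = c"
    "linear (inv (frame_map x))"
  using linear_bij_inv[OF linear_frame_map, of x] assms by (auto simp: bases_def)

lemma linear_kap: assumes "x \<in> bases" shows "linear (kap x v)" "linear (\<lambda>v. kap x v c)"
  unfolding kap_def
  using linear_compose[OF linear_frame_map[of v] frame_map_inv(3)[OF assms]]
    linear_compose[OF linear_frame_map_left[of c] frame_map_inv(3)[OF assms]] by (simp_all add: o_def)

lemma linear_tau: assumes "x \<in> bases" shows "linear (tau x)"
  unfolding tau_def
  using linear_compose[OF linear_fst frame_map_inv(3)[OF assms]] by (simp add: o_def)

lemma linear_forms:
  assumes "x \<in> bases"
  shows "linear (omega i x)" "linear (theta k x)" "linear (phi j i x)" "linear (eta k i x)" "linear (zeta j k x)" "linear (kappa l k x)"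
  by (rule linearI; simp only: forms_conv linear_add[OF linear_tau[OF assms]] linear_scale[OF linear_tau[OF assms]]
    linear_add[OF linear_kap(2)[OF assms]] linear_scale[OF linear_kap(2)[OF assms]]
    fst_add snd_add fst_scaleR snd_scaleR vector_add_component vector_scaleR_component)+

lemmas linear_forms_simps = linear_forms[THEN linear_add] linear_forms[THEN linear_scale]

lemma pair_expand:
  "(c :: (real^4) \<times> (real^'r::finite)) =
    (\<Sum>i\<in>UNIV. fst c $ i *\<^sub>R (axis i 1, 0)) + (\<Sum>k\<in>UNIV. snd c $ k *\<^sub>R (0, axis k 1))"
proof -
  have a: "(\<Sum>i\<in>UNIV. z $ i *\<^sub>R axis i 1) = z" for z :: "real^'z::finite"
    using basis_expansion[of z] by (simp add: scalar_mult_eq_scaleR)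
  show ?thesis by (simp add: prod_eq_iff fst_sum snd_sum a)
qed

lemma kap_expand:
  assumes "x \<in> bases"
  shows "fst (kap x v c) $ j = (\<Sum>i\<in>UNIV. phi j i x v * fst c $ i) + (\<Sum>k\<in>UNIV. zeta j k x v * snd c $ k)"
    "snd (kap x v c) $ l = (\<Sum>i\<in>UNIV. eta l i x v * fst c $ i) + (\<Sum>k\<in>UNIV. kappa l k x v * snd c $ k)"
proof -
  have "kap x v c = (\<Sum>i\<in>UNIV. fst c $ i *\<^sub>R kap x v (axis i 1, 0)) + (\<Sum>k\<in>UNIV. snd c $ k *\<^sub>R kap x v (0, axis k 1))"
    by (subst pair_expand[of c])
      (simp only: linear_add[OF linear_kap(1)[OF assms]] linear_sum[OF linear_kap(1)[OF assms]]
        linear_scale[OF linear_kap(1)[OF assms]])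
  then show "fst (kap x v c) $ j = (\<Sum>i\<in>UNIV. phi j i x v * fst c $ i) + (\<Sum>k\<in>UNIV. zeta j k x v * snd c $ k)"
    "snd (kap x v c) $ l = (\<Sum>i\<in>UNIV. eta l i x v * fst c $ i) + (\<Sum>k\<in>UNIV. kappa l k x v * snd c $ k)"
    by (simp_all add: forms_conv fst_sum snd_sum mult.commute)
qed

lemma frame_expand:
  assumes "x \<in> bases"
  shows "pt v = (\<Sum>j\<in>UNIV. omega j x v *\<^sub>R ee x $ j) + (\<Sum>l\<in>UNIV. theta l x v *\<^sub>R nu x $ l)"
    "ee v $ i = (\<Sum>j\<in>UNIV. phi j i x v *\<^sub>R ee x $ j) + (\<Sum>l\<in>UNIV. eta l i x v *\<^sub>R nu x $ l)"
    "nu v $ k = (\<Sum>j\<in>UNIV. zeta j k x v *\<^sub>R ee x $ j) + (\<Sum>l\<in>UNIV. kappa l k x v *\<^sub>R nu x $ l)"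
  using frame_map_inv(1)[OF assms, unfolded frame_map_def, of "pt v"]
    frame_map_inv(1)[OF assms, unfolded frame_map_def, of "ee v $ i"]
    frame_map_inv(1)[OF assms, unfolded frame_map_def, of "nu v $ k"]
  by (simp_all add: omega_def theta_def phi_def eta_def zeta_def kappa_def frame_map_def[abs_def])

text \<open>At a basis the six families of forms are independent linear coordinates on the ambient
  space; this is the vector with the given coordinates.\<close>

definition of_forms :: "('v::euclidean_space, 'r::finite) frame \<Rightarrow> (4 \<Rightarrow> real) \<Rightarrow> ('r \<Rightarrow> real) \<Rightarrow> (4 \<Rightarrow> 4 \<Rightarrow> real)
    \<Rightarrow> ('r \<Rightarrow> 4 \<Rightarrow> real) \<Rightarrow> (4 \<Rightarrow> 'r \<Rightarrow> real) \<Rightarrow> ('r \<Rightarrow> 'r \<Rightarrow> real) \<Rightarrow> ('v, 'r) frame" where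
  "of_forms x o' t p e z n = (frame_map x (\<chi> j. o' j, \<chi> k. t k),
     \<chi> i. frame_map x (\<chi> j. p j i, \<chi> k. e k i), \<chi> k. frame_map x (\<chi> j. z j k, \<chi> l. n l k))"

lemma forms_of_forms:
  assumes "x \<in> bases"
  shows "omega j x (of_forms x o' t p e z n) = o' j" "theta k x (of_forms x o' t p e z n) = t k"
    "phi j i x (of_forms x o' t p e z n) = p j i" "eta k i x (of_forms x o' t p e z n) = e k i"
    "zeta j k x (of_forms x o' t p e z n) = z j k" "kappa l k x (of_forms x o' t p e z n) = n l k"
  by (simp_all add: omega_def theta_def phi_def eta_def zeta_def kappa_def of_forms_def frame_map_inv[OF assms])

text \<open>A functional with prescribed values on the frame is a combination of the frame
  coordinates, and the inner product represents it by a vector. This takes the place of orthonormal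
  expansion, since the normals form an oblique basis.\<close>

lemma dual_vector:
  assumes "x \<in> bases"
  shows "\<exists>w. (\<forall>i. w \<bullet> ee x $ i = a i) \<and> (\<forall>k. w \<bullet> nu x $ k = b k)"
proof -
  let ?f = "\<lambda>z. (\<chi> i. a i, \<chi> k. b k) \<bullet> inv (frame_map x) z"
  have "linear ?f"
    by (intro linearI) (simp_all add: linear_add[OF frame_map_inv(3)[OF assms]] linear_scale[OF frame_map_inv(3)[OF assms]] inner_add_right)
  then obtain w where w: "\<And>z. ?f z = w \<bullet> z" using inner_representation[of ?f] by blast
  have "w \<bullet> ee x $ i = a i" for i
    using w[of "frame_map x (axis i 1, 0)"] by (simp only: frame_map_inv(2)[OF assms]) (simp add: inner_axis)
  moreover have "w \<bullet> nu x $ k = b k" for k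
    using w[of "frame_map x (0, axis k 1)"] by (simp only: frame_map_inv(2)[OF assms]) (simp add: inner_axis)
  ultimately show ?thesis by blast
qed

locale frame_dim =
  fixes num :: "'r::finite \<Rightarrow> nat" and v_type :: "'v::euclidean_space itself"
  assumes dim: "DIM('v) = 4 + CARD('r)"
    and r6: "6 \<le> CARD('r)"
    and num: "bij_betw num UNIV {1..CARD('r)}"
begin

abbreviation gen where "gen \<equiv> generators num :: _ \<Rightarrow> ('v, 'r) frame \<Rightarrow> _"
abbreviation Loc where "Loc \<equiv> locus num :: ('v, 'r) frame set"
abbreviation FB where "FB \<equiv> frame_bundle num :: ('v, 'r) frame set"
abbreviation tang where "tang \<equiv> tangent_at Loc"
abbreviation annI where "annI \<equiv> ann_I Loc gen"
abbreviation annJ where "annJ \<equiv> ann_J Loc gen omega"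
abbreviation Tab where "Tab \<equiv> tableau Loc gen omega"

lemma bij_frame_map_iff_inj: "bij (frame_map (x :: ('v, 'r) frame)) \<longleftrightarrow> inj (frame_map x)"
proof -
  have "surj (frame_map x)" if "inj (frame_map x)"
  proof -
    have "dim (range (frame_map x)) = DIM('v)"
      using dim_inj_image[OF linear_frame_map that, of UNIV] dim by simp
    then show ?thesis
      using dim_eq_full[of "range (frame_map x)"] linear_subspace_image[OF linear_frame_map subspace_UNIV, of x]
      by (metis span_eq_iff)
  qed
  then show ?thesis by (auto simp: bij_def)
qed

section \<open>Smoothness and exterior derivatives of the forms on the set of bases\<close>

lemma smooth_frame_map: "open S \<Longrightarrow> smooth_on S (\<lambda>x. frame_map x c)"
  by (rule smooth_on_bounded_linear[OF _ _ smooth_on_id])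
    (simp_all add: linear_frame_map_left linear_conv_bounded_linear[symmetric])

lemma open_bases: "open (bases :: ('v, 'r) frame set)"
proof -
  have c: "continuous_on (UNIV :: ('v, 'r) frame set) (\<lambda>x. frame_map x b)" for b
    by (rule smooth_on_continuous[OF smooth_frame_map[OF open_UNIV]])
  have "open {x \<in> UNIV :: ('v, 'r) frame set. inj (frame_map x)}"
    by (rule linear_family_inj_open[OF open_UNIV linear_frame_map c])
  then show ?thesis by (simp add: bases_def bij_frame_map_iff_inj)
qed

lemma inv_frame_map_smooth: "smooth_on (bases :: ('v, 'r) frame set) (\<lambda>x. inv (frame_map x) w)"
  by (rule inv_family_smooth[OF open_bases linear_frame_map])
    (auto simp: bases_def intro: smooth_frame_map[OF open_bases, unfolded bases_def])

lemma inv_frame_map_has_derivative: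
  assumes "x \<in> (bases :: ('v, 'r) frame set)"
  shows "((\<lambda>x. inv (frame_map x) w) has_derivative (\<lambda>u. - kap x u (inv (frame_map x) w))) (at x)"
proof -
  have "((\<lambda>y. frame_map y c) has_derivative (\<lambda>u. frame_map u c)) (at x)" for c
    by (rule bounded_linear_imp_has_derivative) (simp add: linear_frame_map_left linear_conv_bounded_linear[symmetric])
  then have "fderiv (\<lambda>y. frame_map y c) x u = frame_map u c" for c u
    by (rule frechet_derivative_apply)
  then show ?thesis unfolding kap_def
    using inv_family_has_derivative[OF open_bases linear_frame_map _ smooth_frame_map[OF open_bases] assms, of w]
    by (simp add: bases_def)
qed

text \<open>All generators are differences of two forms of this kind.\<close>

lemma moving_form:
  fixes B :: "('v, 'r) frame \<Rightarrow> 'v" and B' :: "('v, 'r) frame \<Rightarrow> 'v"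
  assumes B: "linear B" "linear B'" and l: "linear l" "linear l'"
  defines "\<alpha> \<equiv> \<lambda>x v. l (inv (frame_map x) (B v)) - l' (inv (frame_map x) (B' v)) :: real"
  shows "smooth_form_on bases \<alpha>"
    and "x \<in> bases \<Longrightarrow> ext_d \<alpha> x u v = (l (kap x v (inv (frame_map x) (B u))) - l' (kap x v (inv (frame_map x) (B' u))))
      - (l (kap x u (inv (frame_map x) (B v))) - l' (kap x u (inv (frame_map x) (B' v))))"
proof -
  have bl: "bounded_linear l" "bounded_linear l'" using l by (simp_all add: linear_conv_bounded_linear)
  have "linear (\<alpha> x)" if "x \<in> bases" for x
  proof -
    have "linear (\<lambda>v. l (inv (frame_map x) (B v)))" "linear (\<lambda>v. l' (inv (frame_map x) (B' v)))"
      using linear_compose[OF linear_compose[OF B(1) frame_map_inv(3)[OF that]] l(1)]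
        linear_compose[OF linear_compose[OF B(2) frame_map_inv(3)[OF that]] l(2)] by (simp_all add: o_def)
    then show ?thesis unfolding \<alpha>_def by (rule linear_compose_sub)
  qed
  moreover have "smooth_on bases (\<lambda>x. \<alpha> x v)" for v
    unfolding \<alpha>_def
    by (intro smooth_on_diff open_bases smooth_on_bounded_linear[OF _ bl(1)] smooth_on_bounded_linear[OF _ bl(2)]
        inv_frame_map_smooth)
  ultimately show "smooth_form_on bases \<alpha>" by (simp add: smooth_form_on_def)
  assume x: "x \<in> bases"
  have "((\<lambda>y. \<alpha> y v) has_derivative (\<lambda>u. l (- kap x u (inv (frame_map x) (B v))) - l' (- kap x u (inv (frame_map x) (B' v))))) (at x)" for v
    unfolding \<alpha>_def
    by (intro has_derivative_diff bounded_linear.has_derivative[OF bl(1)] bounded_linear.has_derivative[OF bl(2)]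
        inv_frame_map_has_derivative x)
  then have "fderiv (\<lambda>y. \<alpha> y v) x u = l (- kap x u (inv (frame_map x) (B v))) - l' (- kap x u (inv (frame_map x) (B' v)))" for u v
    by (rule frechet_derivative_apply)
  then show "ext_d \<alpha> x u v = (l (kap x v (inv (frame_map x) (B u))) - l' (kap x v (inv (frame_map x) (B' u))))
      - (l (kap x u (inv (frame_map x) (B v))) - l' (kap x u (inv (frame_map x) (B' v))))"
    by (simp add: ext_d_def linear_neg[OF l(1)] linear_neg[OF l(2)])
qed

lemma linear_components:
  "linear (\<lambda>v :: ('v, 'r) frame. pt v)" "linear (\<lambda>v :: ('v, 'r) frame. ee v $ i)"
  "linear (\<lambda>v :: ('v, 'r) frame. nu v $ k)"
  by (auto intro!: linearI)

lemma linear_coefficients: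
  "linear (\<lambda>c :: (real^4) \<times> (real^'r). fst c $ i)" "linear (\<lambda>c :: (real^4) \<times> (real^'r). snd c $ k)"
  "linear (\<lambda>c :: (real^4) \<times> (real^'r). fst c $ i / 2)"
  "linear (\<lambda>c :: (real^4) \<times> (real^'r). \<Sum>j\<in>UNIV. s j * fst c $ j)"
  "linear (\<lambda>c :: (real^4) \<times> (real^'r). 0 :: real)"
  by (auto intro!: linearI simp: sum.distrib sum_distrib_left algebra_simps add_divide_distrib)

lemma smooth_form_omega: "smooth_form_on (bases :: ('v, 'r) frame set) (omega i)"
proof -
  have "omega i = (\<lambda>x v :: ('v, 'r) frame. fst (inv (frame_map x) (pt v)) $ i - (\<lambda>_. 0) (inv (frame_map x) (pt v)))"
    by (intro ext) (simp add: omega_def)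
  then show ?thesis using moving_form(1)[OF linear_components(1) linear_components(1) linear_coefficients(1) linear_coefficients(5)]
    by simp
qed

abbreviation gth :: "'r \<Rightarrow> ('v, 'r) frame \<Rightarrow> ('v, 'r) frame \<Rightarrow> real" where
  "gth k \<equiv> gen (Inl k)"
abbreviation gps :: "2 \<Rightarrow> ('v, 'r) frame \<Rightarrow> ('v, 'r) frame \<Rightarrow> real" where
  "gps b \<equiv> gen (Inr (Inl b))"
abbreviation get :: "'r \<Rightarrow> 4 \<Rightarrow> ('v, 'r) frame \<Rightarrow> ('v, 'r) frame \<Rightarrow> real" where
  "get k i \<equiv> gen (Inr (Inr (k, i)))"

lemma generators_normal_form:
  "gth k = (\<lambda>x v. snd (inv (frame_map x) (pt v)) $ k - 0)"
  "gps 1 = (\<lambda>x v. fst (inv (frame_map x) (ee v $ 1)) $ 2 / 2 - fst (inv (frame_map x) (ee v $ 3)) $ 4 / 2)"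
  "gps 2 = (\<lambda>x v. fst (inv (frame_map x) (ee v $ 2)) $ 3 / 2 - fst (inv (frame_map x) (ee v $ 1)) $ 4 / 2)"
  "get k i = (\<lambda>x v. snd (inv (frame_map x) (ee v $ i)) $ k -
     (\<Sum>j\<in>UNIV. Shat (num k) $ i $ j * fst (inv (frame_map x) (pt v)) $ j))"
  by (intro ext; simp add: generators_def theta_def phi_def eta_def omega_def diff_divide_distrib)+

text \<open>The structure equations. Differentiating \<open>inv (frame_map x)\<close> composes two
  velocities, and the minus sign in the derivative of an inverse is the reason why \<open>v\<close>
  stands in the connection factor of the positive terms.\<close>

lemma generators_ext_d:
  assumes x: "x \<in> bases"
  shows "ext_d (gth k) x u v =
      ((\<Sum>m\<in>UNIV. eta k m x v * omega m x u) + (\<Sum>l\<in>UNIV. kappa k l x v * theta l x u))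
    - ((\<Sum>m\<in>UNIV. eta k m x u * omega m x v) + (\<Sum>l\<in>UNIV. kappa k l x u * theta l x v))"
    and "ext_d (gps 1) x u v =
      (((\<Sum>m\<in>UNIV. phi 2 m x v * phi m 1 x u) + (\<Sum>l\<in>UNIV. zeta 2 l x v * eta l 1 x u)) / 2
     - ((\<Sum>m\<in>UNIV. phi 4 m x v * phi m 3 x u) + (\<Sum>l\<in>UNIV. zeta 4 l x v * eta l 3 x u)) / 2)
    - (((\<Sum>m\<in>UNIV. phi 2 m x u * phi m 1 x v) + (\<Sum>l\<in>UNIV. zeta 2 l x u * eta l 1 x v)) / 2
     - ((\<Sum>m\<in>UNIV. phi 4 m x u * phi m 3 x v) + (\<Sum>l\<in>UNIV. zeta 4 l x u * eta l 3 x v)) / 2)"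
    and "ext_d (gps 2) x u v =
      (((\<Sum>m\<in>UNIV. phi 3 m x v * phi m 2 x u) + (\<Sum>l\<in>UNIV. zeta 3 l x v * eta l 2 x u)) / 2
     - ((\<Sum>m\<in>UNIV. phi 4 m x v * phi m 1 x u) + (\<Sum>l\<in>UNIV. zeta 4 l x v * eta l 1 x u)) / 2)
    - (((\<Sum>m\<in>UNIV. phi 3 m x u * phi m 2 x v) + (\<Sum>l\<in>UNIV. zeta 3 l x u * eta l 2 x v)) / 2
     - ((\<Sum>m\<in>UNIV. phi 4 m x u * phi m 1 x v) + (\<Sum>l\<in>UNIV. zeta 4 l x u * eta l 1 x v)) / 2)"
    and "ext_d (get k i) x u v =
      ((\<Sum>m\<in>UNIV. eta k m x v * phi m i x u) + (\<Sum>l\<in>UNIV. kappa k l x v * eta l i x u)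
       - (\<Sum>j\<in>UNIV. Shat (num k) $ i $ j * ((\<Sum>m\<in>UNIV. phi j m x v * omega m x u) + (\<Sum>l\<in>UNIV. zeta j l x v * theta l x u))))
    - ((\<Sum>m\<in>UNIV. eta k m x u * phi m i x v) + (\<Sum>l\<in>UNIV. kappa k l x u * eta l i x v)
       - (\<Sum>j\<in>UNIV. Shat (num k) $ i $ j * ((\<Sum>m\<in>UNIV. phi j m x u * omega m x v) + (\<Sum>l\<in>UNIV. zeta j l x u * theta l x v))))"
  unfolding generators_normal_form
     moving_form(2)[OF linear_components(1) linear_components(1) linear_coefficients(2) linear_coefficients(5) x]
     moving_form(2)[OF linear_components(2) linear_components(2) linear_coefficients(3) linear_coefficients(3) x]
     moving_form(2)[OF linear_components(2) linear_components(1) linear_coefficients(2) linear_coefficients(4) x]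
     kap_expand[OF x]
  by (simp_all add: omega_def theta_def phi_def eta_def zeta_def kappa_def)

lemma two_cases: "(b :: 2) = 1 \<or> b = 2"
  using exhaust_2 by blast

lemma smooth_form_generators: "smooth_form_on bases (gen g :: ('v, 'r) frame \<Rightarrow> _)"
proof (cases g)
  case (Inl k)
  show ?thesis unfolding Inl generators_normal_form
    by (rule moving_form(1)[OF linear_components(1) linear_components(1) linear_coefficients(2) linear_coefficients(5)])
next
  case (Inr g')
  show ?thesis
  proof (cases g')
    case (Inl b)
    then show ?thesis using two_cases[of b] \<open>g = Inr g'\<close>
      moving_form(1)[OF linear_components(2) linear_components(2) linear_coefficients(3) linear_coefficients(3)]
      by (auto simp: generators_normal_form)
  next
    case (Inr p)
    obtain k i where p: "p = (k, i)" by (cases p)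
    show ?thesis unfolding \<open>g = Inr g'\<close> Inr p generators_normal_form
      by (rule moving_form(1)[OF linear_components(2) linear_components(1) linear_coefficients(2) linear_coefficients(4)])
  qed
qed

end

declare One_nat_def [simp del]

section \<open>The locus as a submanifold\<close>

text \<open>The element of \<open>QA\<close> with coefficients \<open>m 1\<close> to
  \<open>m 6\<close> in the basis \<open>Shat\<close>. Coefficients in an arbitrary vector space
  cover both real forms and the vector-valued second fundamental form.\<close>

definition Qm :: "(nat \<Rightarrow> 'a::real_vector) \<Rightarrow> 4 \<Rightarrow> 4 \<Rightarrow> 'a" where
  "Qm m i j = (\<Sum>a=1..6. Shat a $ i $ j *\<^sub>R m a)"

lemma atLeast1AtMost6: "{1..6::nat} = {1, 2, 3, 4, 5, 6}" by auto

lemma Shat_eqs: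
  "Shat 1 = EE 1 1 - EE 3 3" "Shat 2 = EE 1 2 + EE 2 1 - EE 3 4 - EE 4 3" "Shat 3 = EE 2 2 - EE 4 4"
  "Shat 4 = EE 1 3 + EE 3 1" "Shat 5 = EE 1 4 + EE 4 1 + EE 2 3 + EE 3 2" "Shat 6 = EE 2 4 + EE 4 2"
  by (simp_all add: Shat_def)

lemma EE_nth: "EE i j $ a $ b = (if a = i \<and> b = j then 1 else 0)"
  by (simp add: EE_def)

lemma Qm_expand: "Qm m i j = Shat 1 $ i $ j *\<^sub>R m 1 + Shat 2 $ i $ j *\<^sub>R m 2 + Shat 3 $ i $ j *\<^sub>R m 3
    + Shat 4 $ i $ j *\<^sub>R m 4 + Shat 5 $ i $ j *\<^sub>R m 5 + Shat 6 $ i $ j *\<^sub>R m 6"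
  unfolding Qm_def atLeast1AtMost6 by simp

lemma Qm_simps [simp]:
  "Qm m 1 1 = m 1" "Qm m 1 2 = m 2" "Qm m 1 3 = m 4" "Qm m 1 4 = m 5"
  "Qm m 2 1 = m 2" "Qm m 2 2 = m 3" "Qm m 2 3 = m 5" "Qm m 2 4 = m 6"
  "Qm m 3 1 = m 4" "Qm m 3 2 = m 5" "Qm m 3 3 = - m 1" "Qm m 3 4 = - m 2"
  "Qm m 4 1 = m 5" "Qm m 4 2 = m 6" "Qm m 4 3 = - m 2" "Qm m 4 4 = - m 3"
  unfolding Qm_expand by (simp_all add: Shat_eqs EE_nth)

lemma Shat_sym: "Shat a $ i $ j = Shat a $ j $ i"
  by (simp add: Shat_def EE_nth conj_commute)

lemma Qm_sym: "Qm m i j = Qm m j i"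
  unfolding Qm_def by (subst Shat_sym) simp

text \<open>Real and imaginary parts of the polarization of the determinant of
  \<open>[[m\<^sub>1 - \<i> m\<^sub>4, m\<^sub>2 - \<i> m\<^sub>5], [m\<^sub>2 - \<i> m\<^sub>5, m\<^sub>3 - \<i> m\<^sub>6]]\<close>, products being inner products.\<close>

definition pol1 :: "(nat \<Rightarrow> 'a::real_inner) \<Rightarrow> (nat \<Rightarrow> 'a) \<Rightarrow> real" where
  "pol1 a b = a 1 \<bullet> b 3 + a 3 \<bullet> b 1 - 2 * (a 2 \<bullet> b 2) - a 4 \<bullet> b 6 - a 6 \<bullet> b 4 + 2 * (a 5 \<bullet> b 5)"

definition pol2 :: "(nat \<Rightarrow> 'a::real_inner) \<Rightarrow> (nat \<Rightarrow> 'a) \<Rightarrow> real" where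
  "pol2 a b = a 1 \<bullet> b 6 + a 6 \<bullet> b 1 - 2 * (a 2 \<bullet> b 5) - 2 * (a 5 \<bullet> b 2) + a 3 \<bullet> b 4 + a 4 \<bullet> b 3"

text \<open>Names for the defining equations of the locus: orthonormality of the \<open>e\<close>,
  orthogonality of the \<open>e\<close> to the normals, orthogonality of low to high normals, and
  the two Gram relations.\<close>

datatype 'r constr = CE 4 4 | CN 4 'r | CR 'r 'r | CP | CQ

context frame_dim
begin

lemma num_inv: "a \<in> {1..CARD('r)} \<Longrightarrow> num (inv num a) = a" "inv num (num k) = k"
  using num f_inv_into_f[of a num UNIV] by (auto simp: bij_betw_def inv_f_f)

lemma num6: "a \<in> {1..6} \<Longrightarrow> num (inv num a) = a"
  using num_inv(1) r6 by auto

lemma num_range: "1 \<le> num k" "num k \<le> CARD('r)"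
  using num by (auto simp: bij_betw_def)

lemma sum_Shat: "(\<Sum>l\<in>UNIV. Shat (num l) $ i $ j *\<^sub>R f l) = Qm (\<lambda>a. f (inv num a)) i j"
proof -
  have "(\<Sum>l\<in>UNIV. Shat (num l) $ i $ j *\<^sub>R f l) = (\<Sum>a\<in>{1..CARD('r)}. Shat a $ i $ j *\<^sub>R f (inv num a))"
    by (rule sum.reindex_bij_betw[OF num, symmetric, of "\<lambda>a. Shat a $ i $ j *\<^sub>R f (inv num a)", unfolded num_inv(2), symmetric])
  also have "\<dots> = (\<Sum>a=1..6. Shat a $ i $ j *\<^sub>R f (inv num a))"
    by (rule sum.mono_neutral_right) (use r6 in \<open>auto simp: Shat_def\<close>)
  finally show ?thesis by (simp add: Qm_def)
qed

lemma sum_Shat_real: "(\<Sum>l\<in>UNIV. f l * Shat (num l) $ i $ j) = Qm (\<lambda>a. f (inv num a)) i j"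
  using sum_Shat[of i j f] by (simp add: mult.commute)

abbreviation nus :: "('v, 'r) frame \<Rightarrow> nat \<Rightarrow> 'v" where "nus x \<equiv> nu_at num x"

lemma nus_def: "nus x = (\<lambda>a. nu x $ inv num a)"
  by (rule ext) (simp add: nu_at_def)

lemma frame_bundle_bases: "x \<in> FB \<Longrightarrow> x \<in> bases"
  by (simp add: frame_bundle_def bases_def)

lemma gram_pol:
  "gram num x 1 3 - gram num x 2 2 - gram num x 4 6 + gram num x 5 5 = pol1 (nus x) (nus x) / 2"
  "gram num x 1 6 - 2 * gram num x 2 5 + gram num x 3 4 = pol2 (nus x) (nus x) / 2"
  for x :: "('v, 'r) frame"
  by (simp_all add: gram_def pol1_def pol2_def inner_commute)

lemma locus_iff: "x \<in> Loc \<longleftrightarrow> x \<in> FB \<and> pol1 (nus x) (nus x) = 0 \<and> pol2 (nus x) (nus x) = 0"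
  by (simp add: locus_def gram_pol)

lemma locus_bases: "x \<in> Loc \<Longrightarrow> x \<in> bases"
  by (simp add: locus_iff frame_bundle_bases)

lemma frame_bundleD:
  assumes "x \<in> FB"
  shows "ee x $ i \<bullet> ee x $ j = (if i = j then 1 else 0)" "ee x $ i \<bullet> nu x $ k = 0" "nu x $ k \<bullet> ee x $ i = 0"
    "num k \<le> 6 \<Longrightarrow> 6 < num l \<Longrightarrow> nu x $ k \<bullet> nu x $ l = 0"
  using assms by (auto simp: frame_bundle_def orthonormal4_def inner_commute)

fun constr_fun :: "'r constr \<Rightarrow> ('v, 'r) frame \<Rightarrow> real" where
  "constr_fun (CE i j) x = ee x $ i \<bullet> ee x $ j - (if i = j then 1 else 0)"
| "constr_fun (CN i k) x = ee x $ i \<bullet> nu x $ k"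
| "constr_fun (CR k l) x = nu x $ k \<bullet> nu x $ l"
| "constr_fun CP x = pol1 (nus x) (nus x) / 2"
| "constr_fun CQ x = pol2 (nus x) (nus x) / 2"

fun constr_deriv :: "'r constr \<Rightarrow> ('v, 'r) frame \<Rightarrow> ('v, 'r) frame \<Rightarrow> real" where
  "constr_deriv (CE i j) x v = ee v $ i \<bullet> ee x $ j + ee x $ i \<bullet> ee v $ j"
| "constr_deriv (CN i k) x v = ee v $ i \<bullet> nu x $ k + ee x $ i \<bullet> nu v $ k"
| "constr_deriv (CR k l) x v = nu v $ k \<bullet> nu x $ l + nu x $ k \<bullet> nu v $ l"
| "constr_deriv CP x v = pol1 (nus x) (nus v)"
| "constr_deriv CQ x v = pol2 (nus x) (nus v)"

text \<open>Of each symmetric pair of equations only the one with \<open>i \<le> j\<close> is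
  listed, so that the differentials can be prescribed independently.\<close>

definition constrs :: "'r constr set" where
  "constrs = {CE i j | i j. i \<le> j} \<union> {CN i k | i k. True} \<union> {CR k l | k l. num k \<le> 6 \<and> 6 < num l} \<union> {CP, CQ}"

lemma ball_constrs:
  "(\<forall>c\<in>constrs. P c) \<longleftrightarrow> (\<forall>i j. i \<le> j \<longrightarrow> P (CE i j)) \<and> (\<forall>i k. P (CN i k)) \<and>
    (\<forall>k l. num k \<le> 6 \<longrightarrow> 6 < num l \<longrightarrow> P (CR k l)) \<and> P CP \<and> P CQ"
  unfolding constrs_def by blast

lemma finite_constrs: "finite constrs"
proof -
  have "constrs \<subseteq> (\<lambda>(i, j). CE i j) ` UNIV \<union> (\<lambda>(i, j). CN i j) ` UNIV \<union> (\<lambda>(i, j). CR i j) ` UNIV \<union> {CP, CQ}"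
    unfolding constrs_def by auto
  then show ?thesis by (rule finite_subset) simp
qed

lemma constr_fun_eq:
  "constr_fun (CE i j) = (\<lambda>x. ee x $ i \<bullet> ee x $ j - (if i = j then 1 else 0))"
  "constr_fun (CN i k) = (\<lambda>x. ee x $ i \<bullet> nu x $ k)"
  "constr_fun (CR k l) = (\<lambda>x. nu x $ k \<bullet> nu x $ l)"
  "constr_fun CP = (\<lambda>x. (1 / 2) * pol1 (nus x) (nus x))"
  "constr_fun CQ = (\<lambda>x. (1 / 2) * pol2 (nus x) (nus x))"
  by auto

lemma constr_deriv_eq:
  "constr_deriv (CE i j) x = (\<lambda>v. (ee x $ i \<bullet> ee v $ j + ee v $ i \<bullet> ee x $ j) - 0)"
  "constr_deriv (CN i k) x = (\<lambda>v. ee x $ i \<bullet> nu v $ k + ee v $ i \<bullet> nu x $ k)"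
  "constr_deriv (CR k l) x = (\<lambda>v. nu x $ k \<bullet> nu v $ l + nu v $ k \<bullet> nu x $ l)"
  "constr_deriv CP x = (\<lambda>v. pol1 (nus x) (nus v))"
  "constr_deriv CQ x = (\<lambda>v. pol2 (nus x) (nus v))"
  by auto

lemma constr_fun_smooth: "smooth_on (bases :: ('v, 'r) frame set) (constr_fun c)"
proof -
  have e: "smooth_on (bases :: ('v, 'r) frame set) (\<lambda>x. ee x $ i)"
    and n: "smooth_on (bases :: ('v, 'r) frame set) (\<lambda>x. nu x $ k)" for i k
    by (intro smooth_on_nth smooth_on_fst smooth_on_snd open_bases smooth_on_id)+
  show ?thesis
    by (cases c; simp only: constr_fun_eq pol1_def pol2_def nus_def;
        intro smooth_on_mult smooth_on_add smooth_on_diff smooth_on_inner open_bases smooth_on_const e n)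
qed

lemma constr_fun_derivative: "fderiv (constr_fun c) x v = constr_deriv c x v"
proof (rule frechet_derivative_apply)
  have e: "((\<lambda>x :: ('v, 'r) frame. ee x $ i) has_derivative (\<lambda>v. ee v $ i)) (at x)"
    and n: "((\<lambda>x :: ('v, 'r) frame. nu x $ k) has_derivative (\<lambda>v. nu v $ k)) (at x)" for i k
    by (auto intro!: bounded_linear_imp_has_derivative simp: linear_components linear_conv_bounded_linear[symmetric])
  show "(constr_fun c has_derivative constr_deriv c x) (at x)"
  proof (cases c)
    case CP
    show ?thesis unfolding CP constr_fun_eq constr_deriv_eq pol1_def nus_def
      by (auto intro!: derivative_eq_intros n simp: inner_commute field_simps)
  next
    case CQ
    show ?thesis unfolding CQ constr_fun_eq constr_deriv_eq pol2_def nus_def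
      by (auto intro!: derivative_eq_intros n simp: inner_commute field_simps)
  qed (simp_all only: constr_fun_eq constr_deriv_eq,
      (intro has_derivative_diff has_derivative_inner e n has_derivative_const)+)
qed

lemma locus_level_set: "Loc \<inter> bases = {y \<in> bases. \<forall>c\<in>constrs. constr_fun c y = 0}"
proof -
  have o: "(\<forall>i j. i \<le> j \<longrightarrow> ee y $ i \<bullet> ee y $ j = (if i = j then 1 else 0)) \<longleftrightarrow> orthonormal4 (ee y)" for y :: "('v, 'r) frame"
    unfolding orthonormal4_def by (metis inner_commute linear)
  have "(\<forall>c\<in>constrs. constr_fun c y = 0) \<and> y \<in> bases \<longleftrightarrow> y \<in> Loc" for y
    by (simp add: ball_constrs locus_iff frame_bundle_def bases_def o)
      (auto simp: if_distrib)
  then show ?thesis by blast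
qed

lemma constr_deriv_surj:
  assumes "x \<in> bases"
  shows "\<exists>v. \<forall>c\<in>constrs. constr_deriv c x v = f c"
proof -
  \<comment> \<open>These are the desired inner products of the velocity with the frame, up to the
    factor one half that splits each value between the two factors of a product. The pair
    \<open>{1, 3}\<close> carries the first Gram relation and \<open>{1, 6}\<close> the second: each
    of these products occurs in exactly one of \<open>pol1\<close> and \<open>pol2\<close>, with
    coefficient one.\<close>
  let ?he = "\<lambda>i j. if i \<le> j then f (CE i j) else f (CE j i)"
  let ?hn = "\<lambda>i k. f (CN i k)"
  let ?hr = "\<lambda>k l. if num k \<le> 6 \<and> 6 < num l then f (CR k l) else if num l \<le> 6 \<and> 6 < num k then f (CR l k)
    else if {num k, num l} = {1, 3} then f CP else if {num k, num l} = {1, 6} then f CQ else 0"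
  have he: "?he i j = ?he j i" for i j by (metis linear order_antisym)
  have hr: "?hr k l = ?hr l k" for k l by (auto simp: insert_commute)
  have "\<exists>w. (\<forall>j. w \<bullet> ee x $ j = ?he i j / 2) \<and> (\<forall>k. w \<bullet> nu x $ k = ?hn i k / 2)" for i
    by (rule dual_vector[OF assms])
  then obtain we where we: "\<And>i j. we i \<bullet> ee x $ j = ?he i j / 2" "\<And>i k. we i \<bullet> nu x $ k = ?hn i k / 2" by metis
  have "\<exists>w. (\<forall>j. w \<bullet> ee x $ j = ?hn j k / 2) \<and> (\<forall>l. w \<bullet> nu x $ l = ?hr k l / 2)" for k
    by (rule dual_vector[OF assms])
  then obtain wn where wn: "\<And>k j. wn k \<bullet> ee x $ j = ?hn j k / 2" "\<And>k l. wn k \<bullet> nu x $ l = ?hr k l / 2" by metis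
  define v :: "('v, 'r) frame" where "v = (0, \<chi> i. we i, \<chi> k. wn k)"
  have ev: "ee v $ i = we i" and nv: "nu v $ k = wn k" for i k by (simp_all add: v_def)
  have e1: "constr_deriv (CE i j) x v = f (CE i j)" if "i \<le> j" for i j
    using we(1)[of i j] we(1)[of j i] he[of i j] that by (simp add: ev inner_commute)
  have e2: "constr_deriv (CN i k) x v = f (CN i k)" for i k
    using we(2)[of i k] wn(1)[of k i] by (simp add: ev nv inner_commute)
  have e3: "constr_deriv (CR k l) x v = f (CR k l)" if "num k \<le> 6" "6 < num l" for k l
    using wn(2)[of k l] wn(2)[of l k] hr[of k l] that by (simp add: nv inner_commute)
  have h: "nus x a \<bullet> nus v b = (if {a, b} = {1, 3} then f CP else if {a, b} = {1, 6} then f CQ else 0) / 2"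
    if "a \<in> {1..6}" "b \<in> {1..6}" for a b
    using wn(2)[of "inv num b" "inv num a"] that
    by (simp add: nus_def nv inner_commute num6 insert_commute)
  have e4: "constr_deriv CP x v = f CP" "constr_deriv CQ x v = f CQ"
    by (simp_all add: pol1_def pol2_def h doubleton_eq_iff)
  show ?thesis by (rule exI[of _ v]) (use e1 e2 e3 e4 in \<open>unfold ball_constrs, blast\<close>)
qed

lemma submanifold_locus: "submanifold Loc"
  unfolding submanifold_def
proof
  fix x :: "('v, 'r) frame" assume "x \<in> Loc"
  then have "x \<in> bases" by (simp add: locus_iff frame_bundle_bases)
  moreover have "\<exists>v. \<forall>g\<in>constr_fun ` constrs. fderiv g y v = c g"
    if "y \<in> Loc \<inter> bases" for y and c :: "(('v, 'r) frame \<Rightarrow> real) \<Rightarrow> real"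
    using constr_deriv_surj[of y "\<lambda>k. c (constr_fun k)"] that by (auto simp: constr_fun_derivative)
  ultimately show "\<exists>U (G :: (('v, 'r) frame \<Rightarrow> real) set). open U \<and> x \<in> U \<and> finite G \<and> (\<forall>g\<in>G. smooth_on U g) \<and>
     Loc \<inter> U = {y\<in>U. \<forall>g\<in>G. g y = 0} \<and>
     (\<forall>y\<in>Loc \<inter> U. \<forall>c. \<exists>v. \<forall>g\<in>G. fderiv g y v = c g)"
    by (intro exI[of _ bases] exI[of _ "constr_fun ` constrs"])
      (auto simp: open_bases finite_constrs constr_fun_smooth locus_level_set)
qed

lemma tangent_at_locus:
  assumes "x \<in> Loc"
  shows "tang x = {v. \<forall>c\<in>constrs. constr_deriv c x v = 0}"
proof -
  have x: "x \<in> bases" using assms by (simp add: locus_iff frame_bundle_bases)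
  have "tang x = {v. \<forall>c\<in>constrs. fderiv (constr_fun c) x v = 0}"
    by (rule tangent_at_level_set[OF finite_constrs open_bases x assms locus_level_set])
      (use constr_deriv_surj[OF x] in \<open>simp_all only: constr_fun_smooth constr_fun_derivative\<close>)
  then show ?thesis by (simp add: constr_fun_derivative)
qed

section \<open>The tangent space of the locus in terms of the forms\<close>

definition nuk :: "('v, 'r) frame \<Rightarrow> ('v, 'r) frame \<Rightarrow> 'r \<Rightarrow> 'v" where
  "nuk x v k = (\<Sum>l\<in>UNIV. kappa l k x v *\<^sub>R nu x $ l)"

lemma frame_inner:
  assumes "x \<in> FB"
  shows "ee v $ i \<bullet> ee x $ j = phi j i x v" "pt v \<bullet> ee x $ j = omega j x v" "ee x $ j \<bullet> nu v $ k = zeta j k x v"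
    "ee v $ i \<bullet> nu x $ k = (\<Sum>l\<in>UNIV. eta l i x v *\<^sub>R nu x $ l) \<bullet> nu x $ k"
proof -
  note fbD = frame_bundleD[OF assms]
  note ex = frame_expand[OF frame_bundle_bases[OF assms], of v]
  show "ee v $ i \<bullet> ee x $ j = phi j i x v"
    by (subst ex) (simp add: inner_add_left inner_sum_left fbD if_distrib cong: if_cong)
  show "pt v \<bullet> ee x $ j = omega j x v"
    by (subst ex) (simp add: inner_add_left inner_sum_left fbD if_distrib cong: if_cong)
  show "ee x $ j \<bullet> nu v $ k = zeta j k x v"
    by (subst ex) (simp add: inner_add_right inner_sum_right fbD if_distrib cong: if_cong)
  show "ee v $ i \<bullet> nu x $ k = (\<Sum>l\<in>UNIV. eta l i x v *\<^sub>R nu x $ l) \<bullet> nu x $ k"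
    by (subst ex) (simp add: inner_add_left inner_sum_left fbD)
qed

text \<open>Orthogonality of \<open>e\<close> and the normals determines \<open>zeta\<close> from
  \<open>eta\<close> (the Weingarten relation). It also removes \<open>zeta\<close> from the
  linearized relations among the normals, which thus restrict \<open>kappa\<close> alone.\<close>

lemma tangent_at_locus_iff:
  assumes x: "x \<in> Loc"
  shows "v \<in> tang x \<longleftrightarrow>
    (\<forall>i j. phi j i x v = - phi i j x v) \<and>
    (\<forall>i k. zeta i k x v = - (\<Sum>l\<in>UNIV. eta l i x v *\<^sub>R nu x $ l) \<bullet> nu x $ k) \<and>
    (\<forall>k l. num k \<le> 6 \<longrightarrow> 6 < num l \<longrightarrow> nuk x v k \<bullet> nu x $ l + nu x $ k \<bullet> nuk x v l = 0) \<and>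
    pol1 (nus x) (\<lambda>a. nuk x v (inv num a)) = 0 \<and> pol2 (nus x) (\<lambda>a. nuk x v (inv num a)) = 0"
proof -
  have fb: "x \<in> FB" using x by (simp add: locus_iff)
  note fbD = frame_bundleD[OF fb]
  note ex = frame_expand[OF frame_bundle_bases[OF fb], of v]
  have nn: "nu v $ k \<bullet> nu x $ l = nuk x v k \<bullet> nu x $ l" for k l
    by (subst ex) (simp add: inner_add_left inner_sum_left fbD nuk_def)
  have nn': "nu x $ l \<bullet> nu v $ k = nu x $ l \<bullet> nuk x v k" for k l
    using nn[of k l] by (simp add: inner_commute)
  have p: "pol1 (nus x) (nus v) = pol1 (nus x) (\<lambda>a. nuk x v (inv num a))"
    "pol2 (nus x) (nus v) = pol2 (nus x) (\<lambda>a. nuk x v (inv num a))"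
    by (simp_all add: pol1_def pol2_def nus_def nn')
  have sym: "(\<forall>i j. i \<le> j \<longrightarrow> phi j i x v + phi i j x v = 0) \<longleftrightarrow> (\<forall>i j. phi j i x v = - phi i j x v)"
    by (metis add.commute add_eq_0_iff2 linear)
  have "v \<in> tang x \<longleftrightarrow>
    (\<forall>i j. i \<le> j \<longrightarrow> constr_deriv (CE i j) x v = 0) \<and> (\<forall>i k. constr_deriv (CN i k) x v = 0) \<and>
    (\<forall>k l. num k \<le> 6 \<longrightarrow> 6 < num l \<longrightarrow> constr_deriv (CR k l) x v = 0) \<and>
    constr_deriv CP x v = 0 \<and> constr_deriv CQ x v = 0"
    unfolding tangent_at_locus[OF x] ball_constrs by blast
  moreover have "(ee v $ i \<bullet> nu x $ k + ee x $ i \<bullet> nu v $ k = 0) \<longleftrightarrow>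
     zeta i k x v = - (\<Sum>l\<in>UNIV. eta l i x v *\<^sub>R nu x $ l) \<bullet> nu x $ k" for i k
    unfolding frame_inner[OF fb] by auto
  ultimately show ?thesis
    by (simp add: frame_inner(1)[OF fb] inner_commute[of "ee x $ _" "ee v $ _"] nn nn' p sym)
qed

end

section \<open>The Pfaffian system\<close>

lemma all_generators:
  "(\<forall>g :: 'r + 2 + 'r \<times> 4. P g) \<longleftrightarrow> (\<forall>k. P (Inl k)) \<and> P (Inr (Inl 1)) \<and> P (Inr (Inl 2)) \<and> (\<forall>k i. P (Inr (Inr (k, i))))"
proof -
  have "(\<forall>b :: 2. Q b) \<longleftrightarrow> Q 1 \<and> Q 2" for Q by (rule forall_2)
  then show ?thesis by (simp add: split_sum_all)
qed

text \<open>The infinitesimal action of \<open>u(2)\<close> on quadratic forms in \<open>Q\<^sub>A\<close>.\<close>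

definition rot :: "real \<Rightarrow> real \<Rightarrow> real \<Rightarrow> real \<Rightarrow> (nat \<Rightarrow> 'a::real_vector) \<Rightarrow> nat \<Rightarrow> 'a" where
  "rot p q c d s b = (if b = 1 then 2 *\<^sub>R (p *\<^sub>R s 2 + c *\<^sub>R s 4 + q *\<^sub>R s 5)
    else if b = 2 then p *\<^sub>R s 3 + c *\<^sub>R s 5 + q *\<^sub>R s 6 - p *\<^sub>R s 1 + q *\<^sub>R s 4 + d *\<^sub>R s 5
    else if b = 3 then 2 *\<^sub>R (q *\<^sub>R s 5 + d *\<^sub>R s 6 - p *\<^sub>R s 2)
    else if b = 4 then 2 *\<^sub>R (p *\<^sub>R s 5 - c *\<^sub>R s 1 - q *\<^sub>R s 2)
    else if b = 5 then p *\<^sub>R s 6 - c *\<^sub>R s 2 - q *\<^sub>R s 3 - q *\<^sub>R s 1 - d *\<^sub>R s 2 - p *\<^sub>R s 4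
    else - 2 *\<^sub>R (p *\<^sub>R s 5 + q *\<^sub>R s 2 + d *\<^sub>R s 3))"

lemma rot_simps:
  "rot p q c d s 1 = 2 *\<^sub>R (p *\<^sub>R s 2 + c *\<^sub>R s 4 + q *\<^sub>R s 5)"
  "rot p q c d s 2 = p *\<^sub>R s 3 + c *\<^sub>R s 5 + q *\<^sub>R s 6 - p *\<^sub>R s 1 + q *\<^sub>R s 4 + d *\<^sub>R s 5"
  "rot p q c d s 3 = 2 *\<^sub>R (q *\<^sub>R s 5 + d *\<^sub>R s 6 - p *\<^sub>R s 2)"
  "rot p q c d s 4 = 2 *\<^sub>R (p *\<^sub>R s 5 - c *\<^sub>R s 1 - q *\<^sub>R s 2)"
  "rot p q c d s 5 = p *\<^sub>R s 6 - c *\<^sub>R s 2 - q *\<^sub>R s 3 - q *\<^sub>R s 1 - d *\<^sub>R s 2 - p *\<^sub>R s 4"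
  "rot p q c d s 6 = - 2 *\<^sub>R (p *\<^sub>R s 5 + q *\<^sub>R s 2 + d *\<^sub>R s 3)"
  by (simp_all add: rot_def)

text \<open>The two relations say that the skew matrix \<open>f\<close> commutes with the complex
  structure taking \<open>e\<^sub>1\<close> to \<open>e\<^sub>3\<close> and \<open>e\<^sub>2\<close>
  to \<open>e\<^sub>4\<close>. So \<open>f\<close> lies in \<open>u(2)\<close> and its action
  preserves \<open>QA\<close>; \<open>rot\<close> is this action on the six coefficients.\<close>

lemma Qm_rot:
  fixes s :: "nat \<Rightarrow> real" and f :: "4 \<Rightarrow> 4 \<Rightarrow> real"
  assumes sk: "\<And>i j. f j i = - f i j" and "f 2 1 = f 4 3" "f 3 2 = f 4 1"
  shows "(\<Sum>m\<in>UNIV. Qm s m j * f m i) + (\<Sum>m\<in>UNIV. Qm s i m * f m j) =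
    Qm (rot (f 2 1) (f 3 2) (f 3 1) (f 4 2) s) i j"
proof -
  have 0: "f 1 1 = 0" "f 2 2 = 0" "f 3 3 = 0" "f 4 4 = 0" using sk[of 1 1] sk[of 2 2] sk[of 3 3] sk[of 4 4] by auto
  have e: "f 4 3 = f 2 1" "f 4 1 = f 3 2" "f 1 2 = - f 2 1" "f 3 4 = - f 2 1" "f 2 3 = - f 3 2" "f 1 4 = - f 3 2"
    "f 1 3 = - f 3 1" "f 2 4 = - f 4 2"
    using assms(2,3) sk[of 1 2] sk[of 3 4] sk[of 2 3] sk[of 1 4] sk[of 1 3] sk[of 2 4] by auto
  have "\<forall>i j. (\<Sum>m\<in>UNIV. Qm s m j * f m i) + (\<Sum>m\<in>UNIV. Qm s i m * f m j) =
    Qm (rot (f 2 1) (f 3 2) (f 3 1) (f 4 2) s) i j"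
    unfolding forall_4 sum_4 Qm_simps 0 e rot_simps by (simp add: algebra_simps)
  then show ?thesis by blast
qed

lemma inner_sort:
  fixes a :: "nat \<Rightarrow> 'a::real_inner"
  shows "a 2 \<bullet> a 1 = a 1 \<bullet> a 2" "a 3 \<bullet> a 1 = a 1 \<bullet> a 3" "a 4 \<bullet> a 1 = a 1 \<bullet> a 4"
    "a 5 \<bullet> a 1 = a 1 \<bullet> a 5" "a 6 \<bullet> a 1 = a 1 \<bullet> a 6" "a 3 \<bullet> a 2 = a 2 \<bullet> a 3"
    "a 4 \<bullet> a 2 = a 2 \<bullet> a 4" "a 5 \<bullet> a 2 = a 2 \<bullet> a 5" "a 6 \<bullet> a 2 = a 2 \<bullet> a 6"
    "a 4 \<bullet> a 3 = a 3 \<bullet> a 4" "a 5 \<bullet> a 3 = a 3 \<bullet> a 5" "a 6 \<bullet> a 3 = a 3 \<bullet> a 6"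
    "a 5 \<bullet> a 4 = a 4 \<bullet> a 5" "a 6 \<bullet> a 4 = a 4 \<bullet> a 6" "a 6 \<bullet> a 5 = a 5 \<bullet> a 6"
  by (rule inner_commute)+

text \<open>An infinitesimal unitary change of basis alters the complex determinant by a multiple of
  itself, so it is tangent to the zero set of the determinant.\<close>

lemma pol_rot:
  assumes "pol1 a a = 0" "pol2 a a = 0"
  shows "pol1 a (rot p q c d a) = 0" "pol2 a (rot p q c d a) = 0"
proof -
  have e: "a 1 \<bullet> a 3 = a 2 \<bullet> a 2 + a 4 \<bullet> a 6 - a 5 \<bullet> a 5" "a 1 \<bullet> a 6 = 2 * (a 2 \<bullet> a 5) - a 3 \<bullet> a 4"
    using assms by (simp_all add: pol1_def pol2_def inner_commute)
  show "pol1 a (rot p q c d a) = 0" "pol2 a (rot p q c d a) = 0"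
    unfolding pol1_def pol2_def rot_simps inner_add_right inner_diff_right inner_scaleR_right inner_sort[of a] e
    by (simp_all add: algebra_simps)
qed

context frame_dim
begin

definition nrm :: "('v, 'r) frame \<Rightarrow> (real^'r) \<Rightarrow> 'v" where
  "nrm x w = (\<Sum>k\<in>UNIV. w $ k *\<^sub>R nu x $ k)"

text \<open>\<open>hh x v i\<close> is the second fundamental form on \<open>v\<close> and \<open>e\<^sub>i\<close>.\<close>

definition hh :: "('v, 'r) frame \<Rightarrow> ('v, 'r) frame \<Rightarrow> 4 \<Rightarrow> 'v" where
  "hh x v i = (\<Sum>j\<in>UNIV. omega j x v *\<^sub>R Qm (nus x) i j)"

text \<open>The conditions on the velocity of a family of adapted frames that involve only
  first derivatives of the immersion and of its tangent frame.\<close>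

definition adapt :: "('v, 'r) frame \<Rightarrow> ('v, 'r) frame \<Rightarrow> bool" where
  "adapt x v \<longleftrightarrow> (\<forall>i j. phi j i x v = - phi i j x v) \<and>
    (\<forall>i k. zeta i k x v = - (\<Sum>l\<in>UNIV. eta l i x v *\<^sub>R nu x $ l) \<bullet> nu x $ k) \<and>
    (\<forall>k. theta k x v = 0) \<and>
    (\<forall>k i. eta k i x v = (\<Sum>j\<in>UNIV. Shat (num k) $ i $ j * omega j x v))"

lemma adaptD:
  assumes "adapt x v"
  shows "phi j i x v = - phi i j x v" "theta k x v = 0"
    "eta k i x v = (\<Sum>j\<in>UNIV. Shat (num k) $ i $ j * omega j x v)"
    "zeta i k x v = - (\<Sum>l\<in>UNIV. eta l i x v *\<^sub>R nu x $ l) \<bullet> nu x $ k"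
  using assms unfolding adapt_def by blast+

definition psi0 :: "('v, 'r) frame \<Rightarrow> ('v, 'r) frame \<Rightarrow> bool" where
  "psi0 x v \<longleftrightarrow> phi 2 1 x v = phi 4 3 x v \<and> phi 3 2 x v = phi 4 1 x v"

lemma generators_zero_iff:
  "(\<forall>g. gen g x v = 0) \<longleftrightarrow> (\<forall>k. theta k x v = 0) \<and> psi0 x v \<and>
    (\<forall>k i. eta k i x v = (\<Sum>j\<in>UNIV. Shat (num k) $ i $ j * omega j x v))"
  unfolding all_generators psi0_def by (auto simp: generators_def)

lemma hh_alt:
  "hh x v i = (\<Sum>l\<in>UNIV. (\<Sum>j\<in>UNIV. Shat (num l) $ i $ j * omega j x v) *\<^sub>R nu x $ l)"
proof -
  have "(\<Sum>l\<in>UNIV. (\<Sum>j\<in>UNIV. Shat (num l) $ i $ j * omega j x v) *\<^sub>R nu x $ l) =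
      (\<Sum>l\<in>UNIV. \<Sum>j\<in>UNIV. omega j x v *\<^sub>R (Shat (num l) $ i $ j *\<^sub>R nu x $ l))"
    by (simp add: scaleR_sum_left mult.commute)
  also have "\<dots> = (\<Sum>j\<in>UNIV. omega j x v *\<^sub>R (\<Sum>l\<in>UNIV. Shat (num l) $ i $ j *\<^sub>R nu x $ l))"
    by (subst sum.swap) (simp add: scaleR_sum_right)
  finally show ?thesis unfolding hh_def nus_def sum_Shat by simp
qed

section \<open>Gauss and Codazzi terms in the exterior derivatives of the generators\<close>

lemma eta_hh:
  assumes "\<And>k i. eta k i x v = (\<Sum>j\<in>UNIV. Shat (num k) $ i $ j * omega j x v)"
  shows "(\<Sum>l\<in>UNIV. eta l i x v *\<^sub>R nu x $ l) = hh x v i"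
  by (simp add: assms hh_alt)

lemma adapt_zeta:
  assumes "adapt x v"
  shows "zeta i k x v = - hh x v i \<bullet> nu x $ k"
  using adaptD(4)[OF assms, of i k] eta_hh[OF adaptD(3)[OF assms], of i] by simp

text \<open>Contracting \<open>zeta\<close> with \<open>eta\<close> gives inner products of values
  of the second fundamental form: the curvature terms of the Gauss equation.\<close>

lemma adapt_zeta_eta:
  assumes "adapt x u" "adapt x v"
  shows "(\<Sum>l\<in>UNIV. zeta i l x v * eta l j x u) = - (hh x v i \<bullet> hh x u j)"
proof -
  have "hh x v i \<bullet> hh x u j = hh x v i \<bullet> (\<Sum>l\<in>UNIV. eta l j x u *\<^sub>R nu x $ l)"
    by (simp only: eta_hh[OF adaptD(3)[OF assms(1)]])
  then show ?thesis by (simp add: adapt_zeta[OF assms(2)] inner_sum_right sum_negf mult.commute)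
qed

text \<open>The Gauss equation of the connection components transverse to \<open>u(2)\<close>. Since
  \<open>u(2)\<close> is a subalgebra, the terms quadratic in \<open>phi\<close> cancel once
  \<open>psi0\<close> holds, and only curvature remains.\<close>

lemma ext_d_psi:
  assumes x: "x \<in> bases" and u: "adapt x u" "psi0 x u" and v: "adapt x v" "psi0 x v"
  shows "ext_d (gps 1) x u v = (hh x u 2 \<bullet> hh x v 1 - hh x u 1 \<bullet> hh x v 2 + hh x u 3 \<bullet> hh x v 4 - hh x u 4 \<bullet> hh x v 3) / 2"
    "ext_d (gps 2) x u v = (hh x u 3 \<bullet> hh x v 2 - hh x u 2 \<bullet> hh x v 3 + hh x u 1 \<bullet> hh x v 4 - hh x u 4 \<bullet> hh x v 1) / 2"
proof -
  have *: "phi 1 1 x w = 0 \<and> phi 2 2 x w = 0 \<and> phi 3 3 x w = 0 \<and> phi 4 4 x w = 0 \<and>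
    phi 4 3 x w = phi 2 1 x w \<and> phi 4 1 x w = phi 3 2 x w \<and> phi 1 2 x w = - phi 2 1 x w \<and> phi 3 4 x w = - phi 2 1 x w \<and>
    phi 2 3 x w = - phi 3 2 x w \<and> phi 1 4 x w = - phi 3 2 x w \<and> phi 1 3 x w = - phi 3 1 x w \<and> phi 2 4 x w = - phi 4 2 x w"
    if "adapt x w" "psi0 x w" for w
  proof -
    have sk: "phi j i x w = - phi i j x w" for i j by (rule adaptD(1)[OF that(1)])
    show ?thesis using that(2) sk[of 1 1] sk[of 2 2] sk[of 3 3] sk[of 4 4] sk[of 1 2] sk[of 3 4] sk[of 2 3] sk[of 1 4] sk[of 1 3] sk[of 2 4]
      unfolding psi0_def by (intro conjI; linarith)
  qed
  show "ext_d (gps 1) x u v = (hh x u 2 \<bullet> hh x v 1 - hh x u 1 \<bullet> hh x v 2 + hh x u 3 \<bullet> hh x v 4 - hh x u 4 \<bullet> hh x v 3) / 2"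
    "ext_d (gps 2) x u v = (hh x u 3 \<bullet> hh x v 2 - hh x u 2 \<bullet> hh x v 3 + hh x u 1 \<bullet> hh x v 4 - hh x u 4 \<bullet> hh x v 1) / 2"
    unfolding generators_ext_d[OF x] adapt_zeta_eta[OF u(1) v(1)] adapt_zeta_eta[OF v(1) u(1)] sum_4
    by (simp_all only: *[OF u] *[OF v] inner_commute[of "hh x v _" "hh x u _"])
      (simp_all add: field_simps)
qed

text \<open>Substituting the two Gram relations cancels the Gauss expression for all values of
  \<open>omega\<close>. Hence these two generators contribute neither torsion nor nonzero rows of
  the tableau.\<close>

lemma ext_d_psi_locus:
  assumes x: "x \<in> Loc" and u: "adapt x u" "psi0 x u" and v: "adapt x v" "psi0 x v"
  shows "ext_d (gps 1) x u v = 0" "ext_d (gps 2) x u v = 0"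
proof -
  let ?a = "nus x"
  have e: "?a 1 \<bullet> ?a 3 = ?a 2 \<bullet> ?a 2 + ?a 4 \<bullet> ?a 6 - ?a 5 \<bullet> ?a 5" "?a 1 \<bullet> ?a 6 = 2 * (?a 2 \<bullet> ?a 5) - ?a 3 \<bullet> ?a 4"
    using x by (simp_all add: locus_iff pol1_def pol2_def inner_commute)
  have xb: "x \<in> bases" using x by (rule locus_bases)
  show "ext_d (gps 1) x u v = 0" "ext_d (gps 2) x u v = 0"
    unfolding ext_d_psi[OF xb u v] hh_def sum_4 Qm_simps inner_add_right inner_add_left inner_diff_right inner_diff_left
      inner_scaleR_right inner_scaleR_left inner_minus_left inner_minus_right inner_sort[of "nus x"] e
    by (simp_all add: algebra_simps)
qed

text \<open>What remains is the antisymmetrization of \<open>Shat (num k)\<close> in two arguments,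
  zero because this matrix is symmetric.\<close>

lemma ext_d_theta:
  assumes x: "x \<in> bases" and u: "adapt x u" and v: "adapt x v"
  shows "ext_d (gth k) x u v = 0"
proof -
  have "(\<Sum>m\<in>UNIV. \<Sum>j\<in>UNIV. Shat (num k) $ m $ j * omega j x v * omega m x u) =
    (\<Sum>m\<in>UNIV. \<Sum>j\<in>UNIV. Shat (num k) $ m $ j * omega j x u * omega m x v)"
    by (subst sum.swap, subst Shat_sym) (simp add: mult_ac)
  then show ?thesis unfolding generators_ext_d[OF x]
    by (simp add: adaptD(2,3)[OF u] adaptD(2,3)[OF v] sum_distrib_right)
qed

text \<open>The exterior derivative of an \<open>eta\<close> generator before antisymmetrization in
  \<open>u\<close> and \<open>v\<close>; the Codazzi equation is the symmetry of this expression.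
  The contraction of \<open>kappa\<close> with \<open>eta\<close> is rewritten as a
  \<open>Qm\<close>, which exhibits the normal connection as an element of
  \<open>QA\<close>.\<close>

definition codazzi :: "('v, 'r) frame \<Rightarrow> 'r \<Rightarrow> 4 \<Rightarrow> ('v, 'r) frame \<Rightarrow> ('v, 'r) frame \<Rightarrow> real" where
  "codazzi x k i u v = (\<Sum>m\<in>UNIV. (\<Sum>j\<in>UNIV. Shat (num k) $ m $ j * omega j x v) * phi m i x u)
    + (\<Sum>j\<in>UNIV. omega j x u * Qm (\<lambda>a. kappa k (inv num a) x v) i j)
    - (\<Sum>j\<in>UNIV. Shat (num k) $ i $ j * (\<Sum>m\<in>UNIV. phi j m x v * omega m x u))"

lemma ext_d_eta:
  assumes x: "x \<in> bases" and u: "adapt x u" and v: "adapt x v"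
  shows "ext_d (get k i) x u v = codazzi x k i u v - codazzi x k i v u"
proof -
  have *: "(\<Sum>l\<in>UNIV. kappa k l x v * eta l i x u) = (\<Sum>j\<in>UNIV. omega j x u * Qm (\<lambda>a. kappa k (inv num a) x v) i j)"
    if "adapt x u" for u v
  proof -
    have "(\<Sum>l\<in>UNIV. kappa k l x v * eta l i x u) = (\<Sum>l\<in>UNIV. \<Sum>j\<in>UNIV. omega j x u * (kappa k l x v * Shat (num l) $ i $ j))"
      by (simp add: adaptD(3)[OF that] sum_distrib_left mult_ac)
    also have "\<dots> = (\<Sum>j\<in>UNIV. omega j x u * (\<Sum>l\<in>UNIV. kappa k l x v * Shat (num l) $ i $ j))"
      by (subst sum.swap) (simp add: sum_distrib_left)
    finally show ?thesis by (simp add: sum_Shat_real)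
  qed
  show ?thesis unfolding generators_ext_d[OF x] *[OF u] *[OF v] codazzi_def
    by (simp add: adaptD(2,3)[OF u] adaptD(2,3)[OF v])
qed

text \<open>The source of all explicit tangent vectors: only \<open>zeta\<close> is forced, while
  \<open>omega\<close>, \<open>theta\<close>, \<open>eta\<close> are free, \<open>phi\<close> has to
  be skew, and \<open>n\<close> has to satisfy the linearized relations among the normals.\<close>

lemma of_forms_tangent:
  assumes x: "x \<in> Loc" and p: "\<And>i j. p j i = - p i j"
    and n: "\<And>k l. num k \<le> 6 \<Longrightarrow> 6 < num l \<Longrightarrow> nrm x (\<chi> m. n m k) \<bullet> nu x $ l + nu x $ k \<bullet> nrm x (\<chi> m. n m l) = 0"
      "pol1 (nus x) (\<lambda>a. nrm x (\<chi> m. n m (inv num a))) = 0" "pol2 (nus x) (\<lambda>a. nrm x (\<chi> m. n m (inv num a))) = 0"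
  shows "of_forms x o' t p e (\<lambda>i k. - (\<Sum>l\<in>UNIV. e l i *\<^sub>R nu x $ l) \<bullet> nu x $ k) n \<in> tang x"
proof -
  have xb: "x \<in> bases" using x by (rule locus_bases)
  have *: "nuk x (of_forms x o' t p e z n) k = nrm x (\<chi> m. n m k)" for z k
    by (simp add: nuk_def nrm_def forms_of_forms[OF xb])
  then show ?thesis unfolding tangent_at_locus_iff[OF x] forms_of_forms[OF xb] *
    by (intro conjI allI impI) (rule p refl n; assumption?)+
qed

lemma of_forms_tangent_simple:
  assumes x: "x \<in> Loc" and p: "\<And>i j. p j i = - p i j"
  shows "of_forms x o' t p e (\<lambda>i k. - (\<Sum>l\<in>UNIV. e l i *\<^sub>R nu x $ l) \<bullet> nu x $ k) (\<lambda>_ _. 0) \<in> tang x"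
  by (rule of_forms_tangent[OF x p]) (auto simp: nrm_def pol1_def pol2_def)

section \<open>Independence of the generators and linearity of the system\<close>

lemma ann_I_iff:
  assumes x: "x \<in> Loc"
  shows "v \<in> annI x \<longleftrightarrow> v \<in> tang x \<and> adapt x v \<and> psi0 x v"
  unfolding ann_I_def generators_zero_iff adapt_def tangent_at_locus_iff[OF x] by blast

lemma generators_arbitrary:
  assumes x: "x \<in> Loc"
  obtains v where "v \<in> tang x" "\<And>g. gen g x v = A g" "\<And>i. omega i x v = B i"
proof -
  have xb: "x \<in> bases" using x by (rule locus_bases)
  \<comment> \<open>Only \<open>phi 2 1\<close>, \<open>phi 3 2\<close> and their skew partners are
    nonzero; the subtracted entries \<open>phi 4 3\<close> and \<open>phi 4 1\<close> stay zero, and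
    the factor 2 undoes the halves in the generators.\<close>
  define p :: "4 \<Rightarrow> 4 \<Rightarrow> real" where "p j i = (if j = 2 \<and> i = 1 then 2 * A (Inr (Inl 1)) else if j = 1 \<and> i = 2 then - 2 * A (Inr (Inl 1))
    else if j = 3 \<and> i = 2 then 2 * A (Inr (Inl 2)) else if j = 2 \<and> i = 3 then - 2 * A (Inr (Inl 2)) else 0)" for j i
  have p: "p j i = - p i j" for i j by (auto simp: p_def)
  define e where "e k i = A (Inr (Inr (k, i))) + (\<Sum>j\<in>UNIV. Shat (num k) $ i $ j * B j)" for k i
  let ?v = "of_forms x B (\<lambda>k. A (Inl k)) p e (\<lambda>i k. - (\<Sum>l\<in>UNIV. e l i *\<^sub>R nu x $ l) \<bullet> nu x $ k) (\<lambda>_ _. 0)"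
  have "\<forall>g. gen g x ?v = A g"
    unfolding all_generators by (simp add: generators_def forms_of_forms[OF xb] e_def) (simp add: p_def)
  then show thesis using that[of ?v] of_forms_tangent_simple[OF x p] by (simp add: forms_of_forms[OF xb])
qed

lemma linear_pfaffian_locus: "linear_pfaffian Loc gen omega"
  unfolding linear_pfaffian_def
proof (intro conjI)
  show "submanifold Loc" by (rule submanifold_locus)
  show "\<exists>U. open U \<and> Loc \<subseteq> U \<and> (\<forall>k. smooth_form_on U (gen k :: ('v, 'r) frame \<Rightarrow> _)) \<and> (\<forall>i. smooth_form_on U (omega i))"
    by (rule exI[of _ bases]) (auto simp: open_bases locus_iff frame_bundle_bases smooth_form_generators smooth_form_omega)
  show "\<forall>x\<in>Loc. \<forall>a b. (\<forall>v\<in>tang x. (\<Sum>k\<in>UNIV. a k * gen k x v) + (\<Sum>i\<in>UNIV. b i * omega i x v) = 0)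
        \<longrightarrow> (\<forall>k. a k = 0) \<and> (\<forall>i. b i = 0)"
  proof (intro ballI allI impI)
    fix x :: "('v, 'r) frame" and a b
    assume x: "x \<in> Loc" and *: "\<forall>v\<in>tang x. (\<Sum>k\<in>UNIV. a k * gen k x v) + (\<Sum>i\<in>UNIV. b i * omega i x v) = 0"
    \<comment> \<open>Taking the coefficients themselves as values of the forms turns the linear
      relation into a vanishing sum of squares.\<close>
    obtain v where v: "v \<in> tang x" "\<And>g. gen g x v = a g" "\<And>i. omega i x v = b i"
      using generators_arbitrary[OF x, of a b] by blast
    have "(\<Sum>k\<in>UNIV. a k * a k) + (\<Sum>i\<in>UNIV. b i * b i) = 0" using * v by auto
    moreover have "(\<Sum>k\<in>UNIV. a k * a k) \<ge> 0" "(\<Sum>i\<in>UNIV. b i * b i) \<ge> 0" by (simp_all add: sum_nonneg)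
    ultimately have "(\<Sum>k\<in>UNIV. a k * a k) = 0" "(\<Sum>i\<in>UNIV. b i * b i) = 0" by linarith+
    then show "(\<forall>k. a k = 0) \<and> (\<forall>i. b i = 0)" by (simp add: sum_nonneg_eq_0_iff)
  qed
  show "\<forall>x\<in>Loc. \<forall>u\<in>annJ x. \<forall>v\<in>annJ x.
    \<forall>k. ext_d (gen k) x u v = 0"
  proof (intro ballI)
    fix x u v :: "('v, 'r) frame" assume x: "x \<in> Loc" and uv: "u \<in> annJ x" "v \<in> annJ x"
    have xb: "x \<in> bases" using x by (rule locus_bases)
    have a: "adapt x u" "psi0 x u" "adapt x v" "psi0 x v" "\<And>i. omega i x u = 0" "\<And>i. omega i x v = 0"
      using uv by (auto simp: ann_J_def ann_I_iff[OF x])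
    show "\<forall>k. ext_d (gen k) x u v = 0"
      unfolding all_generators
      by (simp add: ext_d_theta[OF xb a(1,3)] ext_d_psi_locus[OF x a(1-4)] ext_d_eta[OF xb a(1,3)] codazzi_def a)
  qed
qed

subsection \<open>Integral elements\<close>

definition flat_lift :: "('v, 'r) frame \<Rightarrow> (4 \<Rightarrow> real) \<Rightarrow> ('v, 'r) frame" where
  "flat_lift x B = of_forms x B (\<lambda>_. 0) (\<lambda>_ _. 0) (\<lambda>k i. \<Sum>j\<in>UNIV. Shat (num k) $ i $ j * B j)
     (\<lambda>i k. - (\<Sum>l\<in>UNIV. (\<Sum>j\<in>UNIV. Shat (num l) $ i $ j * B j) *\<^sub>R nu x $ l) \<bullet> nu x $ k) (\<lambda>_ _. 0)"

lemma flat_lift: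
  assumes x: "x \<in> Loc"
  shows "flat_lift x B \<in> annI x" "omega i x (flat_lift x B) = B i"
    "phi j i x (flat_lift x B) = 0" "kappa k l x (flat_lift x B) = 0"
proof -
  have xb: "x \<in> bases" using x by (rule locus_bases)
  show "flat_lift x B \<in> annI x"
    unfolding ann_I_iff[OF x] flat_lift_def
    by (intro conjI of_forms_tangent_simple[OF x]) (simp_all add: adapt_def psi0_def forms_of_forms[OF xb])
  show "omega i x (flat_lift x B) = B i"
    "phi j i x (flat_lift x B) = 0" "kappa k l x (flat_lift x B) = 0"
    by (simp_all add: flat_lift_def forms_of_forms[OF xb])
qed

lemma frame_eqI:
  fixes x :: "('v, 'r) frame"
  assumes "x \<in> bases" "\<And>i. omega i x v = omega i x w" "\<And>k. theta k x v = theta k x w" "\<And>j i. phi j i x v = phi j i x w"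
    "\<And>k i. eta k i x v = eta k i x w" "\<And>j k. zeta j k x v = zeta j k x w" "\<And>l k. kappa l k x v = kappa l k x w"
  shows "v = w"
proof -
  have "pt v = pt w" "ee v $ i = ee w $ i" "nu v $ k = nu w $ k" for i k
    using frame_expand[OF assms(1), of v] frame_expand[OF assms(1), of w] assms(2-) by simp_all
  then show ?thesis by (simp add: prod_eq_iff vec_eq_iff)
qed

lemma linear_flat_lift:
  assumes "x \<in> bases"
  shows "linear (\<lambda>B :: real^4. flat_lift x (\<lambda>i. B $ i))"
  unfolding flat_lift_def
  by (rule linearI; rule frame_eqI[OF assms];
    simp add: forms_of_forms[OF assms] linear_forms_simps[OF assms]
      algebra_simps sum.distrib inner_add_left sum_distrib_left inner_sum_left)

lemma integral_element_exists:
  assumes x: "x \<in> Loc"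
  shows "\<exists>E. integral_element Loc gen omega x E"
proof
  let ?L = "\<lambda>B :: real^4. flat_lift x (\<lambda>i. B $ i)"
  have xb: "x \<in> bases" using x by (rule locus_bases)
  show "integral_element Loc gen omega x (range ?L)"
    unfolding integral_element_def
  proof (intro conjI)
    show "subspace (range ?L)" by (rule linear_subspace_image[OF linear_flat_lift[OF xb] subspace_UNIV])
    show "range ?L \<subseteq> annI x" using flat_lift(1)[OF x] by blast
    show "bij_betw (\<lambda>v. \<chi> i. omega i x v) (range ?L) UNIV"
      by (rule bij_betw_byWitness[where f' = ?L]) (auto simp: flat_lift[OF x])
    have "\<forall>g. ext_d (gen g) x (flat_lift x B) (flat_lift x B') = 0" for B B'
    proof -
      have a: "adapt x (flat_lift x B)" "psi0 x (flat_lift x B)" "adapt x (flat_lift x B')" "psi0 x (flat_lift x B')"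
        using flat_lift(1)[OF x] by (simp_all add: ann_I_iff[OF x])
      \<comment> \<open>Every term of \<open>codazzi\<close> contains a factor \<open>phi\<close> or
        \<open>kappa\<close>, and both vanish on flat lifts.\<close>
      have [simp]: "Qm (\<lambda>a. 0 :: real) i j = 0" for i j by (simp add: Qm_def)
      show ?thesis unfolding all_generators
        by (simp add: ext_d_theta[OF xb a(1,3)] ext_d_psi_locus[OF x a] ext_d_eta[OF xb a(1,3)] codazzi_def flat_lift[OF x])
    qed
    then show "\<forall>u\<in>range ?L. \<forall>v\<in>range ?L. \<forall>k. ext_d (gen k) x u v = 0" by blast
  qed
qed

end

section \<open>The tableau\<close>

text \<open>Coefficient systems are tuples rather than functions on indices, so that they form a
  Euclidean space whose dimension can be counted.\<close>

definition sel6 :: "'a \<times> 'a \<times> 'a \<times> 'a \<times> 'a \<times> 'a \<Rightarrow> nat \<Rightarrow> 'a" where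
  "sel6 t a = (case t of (m1, m2, m3, m4, m5, m6) \<Rightarrow>
     if a = 1 then m1 else if a = 2 then m2 else if a = 3 then m3 else if a = 4 then m4 else if a = 5 then m5 else m6)"

lemma sel6_simps [simp]:
  "sel6 (m1, m2, m3, m4, m5, m6) 1 = m1" "sel6 (m1, m2, m3, m4, m5, m6) 2 = m2" "sel6 (m1, m2, m3, m4, m5, m6) 3 = m3"
  "sel6 (m1, m2, m3, m4, m5, m6) 4 = m4" "sel6 (m1, m2, m3, m4, m5, m6) 5 = m5" "sel6 (m1, m2, m3, m4, m5, m6) 6 = m6"
  by (simp_all add: sel6_def)

type_synonym 'r tab = "(real^'r) \<times> (real^'r) \<times> (real^'r) \<times> (real^'r) \<times> (real^'r) \<times> (real^'r)"

text \<open>Parametrization of the tableau: for each normal index a form in \<open>QA\<close> fills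
  the rows of the \<open>eta\<close> generators, and all other rows are zero.\<close>

definition Pm :: "'r::finite tab \<Rightarrow> real^4^('r + 2 + 'r \<times> 4)" where
  "Pm t = (\<chi> g j. case g of Inl _ \<Rightarrow> 0 | Inr h \<Rightarrow> (case h of Inl _ \<Rightarrow> 0 | Inr p \<Rightarrow>
     Qm (\<lambda>a. sel6 t a $ fst p) (snd p) j))"

lemma Pm_nth [simp]:
  "Pm t $ Inl k $ j = 0" "Pm t $ Inr (Inl b) $ j = 0" "Pm t $ Inr (Inr (k, i)) $ j = Qm (\<lambda>a. sel6 t a $ k) i j"
  by (simp_all add: Pm_def)

lemma atLeast1AtMost6_iff: "a \<in> {1..6::nat} \<longleftrightarrow> a = 1 \<or> a = 2 \<or> a = 3 \<or> a = 4 \<or> a = 5 \<or> a = 6"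
  by auto

lemma pol_cong:
  assumes "\<And>a. a \<in> {1..6} \<Longrightarrow> b a = b' a"
  shows "pol1 m b = pol1 m b'" "pol2 m b = pol2 m b'"
proof -
  have "b 1 = b' 1" "b 2 = b' 2" "b 3 = b' 3" "b 4 = b' 4" "b 5 = b' 5" "b 6 = b' 6"
    by (auto intro: assms)
  then show "pol1 m b = pol1 m b'" "pol2 m b = pol2 m b'" by (simp_all add: pol1_def pol2_def)
qed

lemma pol_diff:
  "pol1 m (\<lambda>a. b a - c a) = pol1 m b - pol1 m c" "pol2 m (\<lambda>a. b a - c a) = pol2 m b - pol2 m c"
  by (simp_all add: pol1_def pol2_def inner_diff_right algebra_simps)

lemma pol_uminus:
  "pol1 m (\<lambda>a. - b a) = - pol1 m b" "pol2 m (\<lambda>a. - b a) = - pol2 m b"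
  by (simp_all add: pol1_def pol2_def algebra_simps)

lemma Qm_cong:
  assumes "\<And>a. a \<in> {1..6} \<Longrightarrow> b a = b' a"
  shows "Qm b i j = Qm b' i j"
  unfolding Qm_def by (rule sum.cong) (simp_all add: assms)

lemma Qm_diff: "Qm (\<lambda>a. b a - c a) i j = Qm b i j - Qm c i j"
  by (simp add: Qm_def scaleR_diff_right sum_subtractf)

lemma Qm_uminus: "Qm (\<lambda>a. - b a) i j = - Qm b i j"
  by (simp add: Qm_def sum_negf)

lemma Shat_eq_Qm: "Shat a $ i $ j = Qm (\<lambda>b. if b = a then 1 else 0) i j"
proof (cases "a \<in> {1..6}")
  case True
  then show ?thesis by (simp add: Qm_def if_distrib cong: if_cong)
next
  case False
  then have "Shat a = 0" unfolding Shat_def atLeast1AtMost6_iff by simp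
  then show ?thesis using False by (simp add: Qm_def if_distrib cong: if_cong)
qed

lemma rot_sum:
  fixes s :: "'k \<Rightarrow> nat \<Rightarrow> real"
  shows "(\<Sum>k\<in>K. rot p q c d (s k) b *\<^sub>R w k) = rot p q c d (\<lambda>a. \<Sum>k\<in>K. s k a *\<^sub>R w k) b"
  by (simp add: rot_def algebra_simps sum.distrib scaleR_sum_right sum_subtractf sum_negf)

lemma rot_cong:
  assumes "\<And>a. a \<in> {1..6} \<Longrightarrow> s a = s' a"
  shows "rot p q c d s b = rot p q c d s' b"
proof -
  have "s 1 = s' 1" "s 2 = s' 2" "s 3 = s' 3" "s 4 = s' 4" "s 5 = s' 5" "s 6 = s' 6"
    by (auto intro: assms)
  then show ?thesis by (simp add: rot_def)
qed

context frame_dim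
begin

definition tabpar :: "('v, 'r) frame \<Rightarrow> 'r tab set" where
  "tabpar x = {t. pol1 (nus x) (\<lambda>a. nrm x (sel6 t a)) = 0 \<and> pol2 (nus x) (\<lambda>a. nrm x (sel6 t a)) = 0}"

lemma nrm_eq_nuk: "nuk x v l = nrm x (\<chi> k. kappa k l x v)"
  by (simp add: nuk_def nrm_def)

lemma nrm_diff: "nrm x (a - b) = nrm x a - nrm x b"
  by (simp add: nrm_def scaleR_diff_left sum_subtractf)

lemma nrm_uminus: "nrm x (- a) = - nrm x a"
  by (simp add: nrm_def sum_negf)

lemma ann_JD:
  assumes "x \<in> Loc" "u \<in> annJ x"
  shows "u \<in> tang x" "adapt x u" "psi0 x u" "omega i x u = 0"
  using assms(2) by (auto simp: ann_J_def ann_I_iff[OF assms(1)])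

text \<open>Since \<open>omega\<close> vanishes on \<open>u\<close>, only \<open>phi\<close> and
  \<open>kappa\<close> of \<open>u\<close> survive. The two sums containing \<open>phi\<close> are
  the action of a matrix in \<open>u(2)\<close> on \<open>Shat (num k)\<close>, which stays in
  \<open>QA\<close> by \<open>Qm_rot\<close>.\<close>

lemma ext_d_tableau:
  assumes x: "x \<in> Loc" and u: "u \<in> annJ x"
    and v: "v \<in> annI x"
  shows "ext_d (gth k) x u v = 0" "ext_d (gps b) x u v = 0"
    "ext_d (get k i) x u v = (\<Sum>j\<in>UNIV. (Qm (rot (phi 2 1 x u) (phi 3 2 x u) (phi 3 1 x u) (phi 4 2 x u) (\<lambda>b. if b = num k then 1 else 0)) i j
       - Qm (\<lambda>a. kappa k (inv num a) x u) i j) * omega j x v)"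
proof -
  have xb: "x \<in> bases" using x by (rule locus_bases)
  note u' = ann_JD[OF x u]
  have v': "adapt x v" "psi0 x v" using v by (simp_all add: ann_I_iff[OF x])
  show "ext_d (gth k) x u v = 0" by (rule ext_d_theta[OF xb u'(2) v'(1)])
  show "ext_d (gps b) x u v = 0" using ext_d_psi_locus[OF x u'(2,3) v'] two_cases[of b] by auto
  let ?S = "\<lambda>i j. Shat (num k) $ i $ j"
  have "ext_d (get k i) x u v = (\<Sum>m\<in>UNIV. \<Sum>j\<in>UNIV. ?S m j * phi m i x u * omega j x v)
     - (\<Sum>j\<in>UNIV. Qm (\<lambda>a. kappa k (inv num a) x u) i j * omega j x v) + (\<Sum>j\<in>UNIV. \<Sum>m\<in>UNIV. ?S i j * phi j m x u * omega m x v)"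
    by (simp add: ext_d_eta[OF xb u'(2) v'(1)] codazzi_def u'(4) sum_distrib_left sum_distrib_right mult_ac)
  also have "(\<Sum>m\<in>UNIV. \<Sum>j\<in>UNIV. ?S m j * phi m i x u * omega j x v) = (\<Sum>j\<in>UNIV. (\<Sum>m\<in>UNIV. ?S m j * phi m i x u) * omega j x v)"
    by (subst sum.swap) (simp add: sum_distrib_right)
  also have "(\<Sum>j\<in>UNIV. \<Sum>m\<in>UNIV. ?S i j * phi j m x u * omega m x v) = (\<Sum>j\<in>UNIV. (\<Sum>m\<in>UNIV. ?S i m * phi m j x u) * omega j x v)"
    by (subst sum.swap) (simp add: sum_distrib_right)
  finally have e: "ext_d (get k i) x u v = (\<Sum>j\<in>UNIV. ((\<Sum>m\<in>UNIV. ?S m j * phi m i x u) + (\<Sum>m\<in>UNIV. ?S i m * phi m j x u)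
     - Qm (\<lambda>a. kappa k (inv num a) x u) i j) * omega j x v)"
    by (simp add: algebra_simps sum.distrib sum_subtractf)
  have "(\<Sum>m\<in>UNIV. ?S m j * phi m i x u) + (\<Sum>m\<in>UNIV. ?S i m * phi m j x u) =
    Qm (rot (phi 2 1 x u) (phi 3 2 x u) (phi 3 1 x u) (phi 4 2 x u) (\<lambda>b. if b = num k then 1 else 0)) i j" for j
    unfolding Shat_eq_Qm
    by (rule Qm_rot[where f = "\<lambda>m i. phi m i x u"]) (use adaptD(1)[OF u'(2)] u'(3) in \<open>unfold psi0_def, blast+\<close>)
  then show "ext_d (get k i) x u v = (\<Sum>j\<in>UNIV. (Qm (rot (phi 2 1 x u) (phi 3 2 x u) (phi 3 1 x u) (phi 4 2 x u) (\<lambda>b. if b = num k then 1 else 0)) i j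
       - Qm (\<lambda>a. kappa k (inv num a) x u) i j) * omega j x v)"
    unfolding e by simp
qed

lemma nrm_rot:
  fixes x :: "('v, 'r) frame"
  shows "nrm x (\<chi> k. rot p q c d (\<lambda>b. if b = num k then 1 else 0) b) = rot p q c d (nus x) b"
proof -
  have "(\<Sum>k\<in>UNIV. (if a = num k then 1 else 0) *\<^sub>R nu x $ k) = nus x a" if "a \<in> {1..6}" for a
  proof -
    have "(a = num k) = (k = inv num a)" for k using num6[OF that] num_inv(2) by metis
    then show ?thesis by (simp add: nus_def if_distrib[of "\<lambda>c. c *\<^sub>R _"] cong: if_cong)
  qed
  then have "rot p q c d (\<lambda>a. \<Sum>k\<in>UNIV. (if a = num k then 1 else 0) *\<^sub>R nu x $ k) b = rot p q c d (nus x) b"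
    by (rule rot_cong)
  then show ?thesis by (simp add: nrm_def rot_sum)
qed

lemma normal_coefficients:
  assumes x: "x \<in> FB" and z: "\<And>i. z \<bullet> ee x $ i = 0"
  obtains w where "z = nrm x w"
proof -
  let ?c = "inv (frame_map x) z"
  have e: "z = (\<Sum>i\<in>UNIV. fst ?c $ i *\<^sub>R ee x $ i) + nrm x (snd ?c)"
    using frame_map_inv(1)[OF frame_bundle_bases[OF x], of z] by (simp add: frame_map_def nrm_def)
  have "z \<bullet> ee x $ i = fst ?c $ i" for i
    by (subst e) (simp add: nrm_def inner_add_left inner_sum_left frame_bundleD[OF x] if_distrib cong: if_cong)
  then have "z = nrm x (snd ?c)" using e z by simp
  then show thesis by (rule that)
qed

text \<open>A tableau element is a \<open>u(2)\<close> rotation of the \<open>Shat\<close> minus a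
  \<open>kappa\<close> term. The rotation satisfies the determinant conditions by
  \<open>pol_rot\<close>, the \<open>kappa\<close> term because \<open>u\<close> is tangent.
  Conversely, every parameter is already realized with \<open>phi\<close> zero, so the rotations do
  not enlarge the tableau.\<close>

lemma tableau_locus:
  assumes x: "x \<in> Loc"
  shows "Tab x = Pm ` tabpar x"
proof (intro equalityI subsetI)
  fix P assume "P \<in> Tab x"
  then obtain u where u: "u \<in> annJ x"
    and P: "\<And>v g. v \<in> annI x \<Longrightarrow> ext_d (gen g) x u v = (P *v (\<chi> i. omega i x v)) $ g"
    unfolding tableau_def by blast
  have P': "P $ g $ j = ext_d (gen g) x u (flat_lift x (\<lambda>i. if i = j then 1 else 0))" for g j
    by (simp add: P[OF flat_lift(1)[OF x]] matrix_vector_mult_def flat_lift[OF x] if_distrib cong: if_cong)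
  let ?R = "\<lambda>s. rot (phi 2 1 x u) (phi 3 2 x u) (phi 3 1 x u) (phi 4 2 x u) s"
  define m :: "nat \<Rightarrow> real^'r" where "m b = (\<chi> k. ?R (\<lambda>b. if b = num k then 1 else 0) b - kappa k (inv num b) x u)" for b
  define t where "t = (m 1, m 2, m 3, m 4, m 5, m 6)"
  have t: "sel6 t b = m b" if "b \<in> {1..6}" for b using that unfolding atLeast1AtMost6_iff t_def by auto
  have "\<forall>g. \<forall>j. P $ g $ j = Pm t $ g $ j"
    unfolding all_generators P' Pm_nth ext_d_tableau[OF x u flat_lift(1)[OF x]] flat_lift(2)[OF x]
  proof (intro conjI allI)
    fix k i j
    have "Qm (\<lambda>a. sel6 t a $ k) i j = Qm (\<lambda>a. ?R (\<lambda>b. if b = num k then 1 else 0) a - kappa k (inv num a) x u) i j"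
      by (rule Qm_cong) (simp add: t m_def)
    then show "(\<Sum>j'\<in>UNIV. (Qm (?R (\<lambda>b. if b = num k then 1 else 0)) i j' - Qm (\<lambda>a. kappa k (inv num a) x u) i j') * (if j' = j then 1 else 0))
      = Qm (\<lambda>a. sel6 t a $ k) i j"
      by (simp add: Qm_diff if_distrib cong: if_cong)
  qed auto
  then have "P = Pm t" by (simp add: vec_eq_iff)
  moreover have "t \<in> tabpar x"
  proof -
    have n: "nrm x (m b) = ?R (nus x) b - nuk x u (inv num b)" for b
    proof -
      have "m b = (\<chi> k. ?R (\<lambda>b. if b = num k then 1 else 0) b) - (\<chi> k. kappa k (inv num b) x u)"
        by (simp add: m_def vec_eq_iff)
      then show ?thesis by (simp add: nrm_diff nrm_rot nrm_eq_nuk)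
    qed
    have "pol1 (nus x) (?R (nus x)) = 0" "pol2 (nus x) (?R (nus x)) = 0"
      using pol_rot x by (auto simp: locus_iff)
    moreover have "pol1 (nus x) (\<lambda>a. nuk x u (inv num a)) = 0" "pol2 (nus x) (\<lambda>a. nuk x u (inv num a)) = 0"
      using ann_JD(1)[OF x u] unfolding tangent_at_locus_iff[OF x] by blast+
    ultimately have "pol1 (nus x) (\<lambda>b. nrm x (m b)) = 0" "pol2 (nus x) (\<lambda>b. nrm x (m b)) = 0"
      by (simp_all add: n pol_diff)
    moreover have "pol1 (nus x) (\<lambda>a. nrm x (sel6 t a)) = pol1 (nus x) (\<lambda>b. nrm x (m b))" "pol2 (nus x) (\<lambda>a. nrm x (sel6 t a)) = pol2 (nus x) (\<lambda>b. nrm x (m b))"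
      by (rule pol_cong; simp add: t)+
    ultimately show ?thesis by (simp add: tabpar_def)
  qed
  ultimately show "P \<in> Pm ` tabpar x" by blast
next
  fix P assume "P \<in> Pm ` tabpar x"
  then obtain t where P: "P = Pm t" and t: "t \<in> tabpar x" by blast
  have fb: "x \<in> FB" using x by (simp add: locus_iff)
  have xb: "x \<in> bases" using fb by (rule frame_bundle_bases)
  \<comment> \<open>Moving the low normals changes their inner products with the high normals;
    \<open>w l\<close> is a velocity of the high normal with index \<open>l\<close> that compensates
    for this.\<close>
  have "\<exists>w. \<forall>k. num k \<le> 6 \<longrightarrow> nrm x w \<bullet> nu x $ k = nrm x (sel6 t (num k)) \<bullet> nu x $ l" for l
  proof -
    obtain z where z: "\<And>i. z \<bullet> ee x $ i = 0" "\<And>k. z \<bullet> nu x $ k = nrm x (sel6 t (num k)) \<bullet> nu x $ l"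
      using dual_vector[OF xb, of "\<lambda>_. 0" "\<lambda>k. nrm x (sel6 t (num k)) \<bullet> nu x $ l"] by blast
    obtain w where "z = nrm x w" by (rule normal_coefficients[OF fb z(1)])
    then show ?thesis using z(2) by auto
  qed
  then obtain w where w: "\<And>l k. num k \<le> 6 \<Longrightarrow> nrm x (w l) \<bullet> nu x $ k = nrm x (sel6 t (num k)) \<bullet> nu x $ l" by metis
  \<comment> \<open>The sign offsets the minus with which \<open>kappa\<close> enters the
    tableau.\<close>
  define n where "n l k = (if num k \<le> 6 then - sel6 t (num k) $ l else w k $ l)" for l k
  have n1: "(\<chi> m. n m k) = (if num k \<le> 6 then - sel6 t (num k) else w k)" for k
    by (simp add: vec_eq_iff n_def)
  have n6: "(\<chi> m. n m (inv num a)) = - sel6 t a" if "a \<in> {1..6}" for a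
    using that by (simp add: n1 num6)
  let ?z = "\<lambda>i k. - (\<Sum>l\<in>UNIV. 0 *\<^sub>R nu x $ l) \<bullet> nu x $ k"
  let ?u = "of_forms x (\<lambda>_. 0) (\<lambda>_. 0) (\<lambda>_ _. 0) (\<lambda>_ _. 0) ?z n"
  have "?u \<in> tang x"
  proof (rule of_forms_tangent[OF x])
    fix k l assume "num k \<le> 6" "6 < num l"
    then show "nrm x (\<chi> m. n m k) \<bullet> nu x $ l + nu x $ k \<bullet> nrm x (\<chi> m. n m l) = 0"
      using w[of k l] by (simp add: n1 nrm_uminus inner_commute)
  next
    have "pol1 (nus x) (\<lambda>a. nrm x (\<chi> m. n m (inv num a))) = pol1 (nus x) (\<lambda>a. - nrm x (sel6 t a))"
      "pol2 (nus x) (\<lambda>a. nrm x (\<chi> m. n m (inv num a))) = pol2 (nus x) (\<lambda>a. - nrm x (sel6 t a))"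
      by (rule pol_cong; simp add: n6 nrm_uminus)+
    then show "pol1 (nus x) (\<lambda>a. nrm x (\<chi> m. n m (inv num a))) = 0" "pol2 (nus x) (\<lambda>a. nrm x (\<chi> m. n m (inv num a))) = 0"
      using t by (simp_all add: tabpar_def pol_uminus)
  qed simp
  then have u: "?u \<in> annJ x"
    by (simp add: ann_J_def ann_I_iff[OF x] adapt_def psi0_def forms_of_forms[OF xb])
  have "\<forall>g. ext_d (gen g) x ?u v = (Pm t *v (\<chi> i. omega i x v)) $ g"
    if v: "v \<in> annI x" for v
    unfolding all_generators ext_d_tableau[OF x u v] forms_of_forms[OF xb]
  proof (intro conjI allI)
    fix k i
    have "Qm (\<lambda>a. n k (inv num a)) i j = Qm (\<lambda>a. - sel6 t a $ k) i j" for j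
      by (rule Qm_cong) (simp add: n_def num6)
    moreover have "rot 0 0 0 0 s = (\<lambda>_. 0)" for s :: "nat \<Rightarrow> real"
      by (rule ext) (simp add: rot_def)
    moreover have "Qm (\<lambda>_. 0 :: real) i j = 0" for j by (simp add: Qm_def)
    ultimately show "(\<Sum>j\<in>UNIV. (Qm (rot 0 0 0 0 (\<lambda>b. if b = num k then 1 else 0)) i j - Qm (\<lambda>a. n k (inv num a)) i j) * omega j x v) =
      (Pm t *v (\<chi> i. omega i x v)) $ Inr (Inr (k, i))"
      by (simp add: matrix_vector_mult_def Qm_uminus)
  qed (simp_all add: matrix_vector_mult_def)
  then show "P \<in> Tab x"
    unfolding tableau_def P using u by blast
qed

end

section \<open>Cartan characters and involutivity\<close>

lemma sel6_eta: "t = (sel6 t 1, sel6 t 2, sel6 t 3, sel6 t 4, sel6 t 5, sel6 t 6)"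
  by (cases t) simp

lemma sel6_linear [simp]: "sel6 (s + t) a = sel6 s a + sel6 t a" "sel6 (c *\<^sub>R t) a = c *\<^sub>R sel6 t a" "sel6 0 a = 0"
  by (cases s; cases t; simp add: sel6_def; fail | cases t; simp add: sel6_def; fail | simp add: sel6_def zero_prod_def)+

lemma Qm_add: "Qm (\<lambda>a. b a + c a) i j = Qm b i j + Qm c i j"
  by (simp add: Qm_def algebra_simps sum.distrib)

lemma Qm_scale: "Qm (\<lambda>a. s * b a) i j = s * Qm b i j" for s :: real
  by (simp add: Qm_def sum_distrib_left mult_ac)

lemma linear_Pm: "linear (Pm :: 'r::finite tab \<Rightarrow> _)"
proof (rule linearI)
  have g: "P = Q" if "\<And>k j. P $ Inl k $ j = Q $ Inl k $ j" "\<And>b j. P $ Inr (Inl b) $ j = Q $ Inr (Inl b) $ j"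
    "\<And>k i j. P $ Inr (Inr (k, i)) $ j = Q $ Inr (Inr (k, i)) $ j" for P Q :: "real^4^('r + 2 + 'r \<times> 4)"
  proof -
    have "\<forall>g. \<forall>j. P $ g $ j = Q $ g $ j" unfolding all_generators using that by blast
    then show ?thesis by (simp add: vec_eq_iff)
  qed
  show "Pm (s + t) = Pm s + Pm t" for s t :: "'r tab" by (rule g) (simp_all add: Qm_add)
  show "Pm (c *\<^sub>R t) = c *\<^sub>R Pm t" for c and t :: "'r tab" by (rule g) (simp_all add: Qm_scale)
qed

lemma inj_Pm: "inj (Pm :: 'r::finite tab \<Rightarrow> _)"
proof (rule injI)
  fix s t :: "'r tab" assume "Pm s = Pm t"
  then have "Qm (\<lambda>a. sel6 s a $ k) i j = Qm (\<lambda>a. sel6 t a $ k) i j" for k i j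
    by (metis Pm_nth(3))
  from this[of _ 1 1] this[of _ 1 2] this[of _ 2 2] this[of _ 1 3] this[of _ 1 4] this[of _ 2 4]
  have "sel6 s 1 = sel6 t 1" "sel6 s 2 = sel6 t 2" "sel6 s 3 = sel6 t 3" "sel6 s 4 = sel6 t 4" "sel6 s 5 = sel6 t 5" "sel6 s 6 = sel6 t 6"
    by (simp_all add: vec_eq_iff)
  then show "s = t" using sel6_eta[of s] sel6_eta[of t] by simp
qed

lemma pol_add:
  "pol1 m (\<lambda>a. b a + c a) = pol1 m b + pol1 m c" "pol2 m (\<lambda>a. b a + c a) = pol2 m b + pol2 m c"
  by (simp_all add: pol1_def pol2_def inner_add_right algebra_simps)

lemma pol_scale:
  "pol1 m (\<lambda>a. s *\<^sub>R b a) = s * pol1 m b" "pol2 m (\<lambda>a. s *\<^sub>R b a) = s * pol2 m b"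
  by (simp_all add: pol1_def pol2_def algebra_simps)

text \<open>A real-linear description of complex cubic forms: the complex coefficients are
  \<open>c\<^sub>1\<^sub>1\<^sub>1 = a\<^sub>1 - \<i> b\<^sub>1\<close>, \<open>c\<^sub>1\<^sub>1\<^sub>2 = a\<^sub>2 - \<i> b\<^sub>2\<close>, \<open>c\<^sub>1\<^sub>2\<^sub>2 = a\<^sub>3 - \<i> b\<^sub>3\<close>, \<open>c\<^sub>2\<^sub>2\<^sub>2 = a\<^sub>4 - \<i> b\<^sub>4\<close>, and
  \<open>slice\<close> gives the derivative in the four real directions.\<close>

type_synonym 'r cub = "((real^'r) \<times> (real^'r) \<times> (real^'r) \<times> (real^'r)) \<times> ((real^'r) \<times> (real^'r) \<times> (real^'r) \<times> (real^'r))"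

definition slice :: "'r::finite cub \<Rightarrow> 4 \<Rightarrow> 'r tab" where
  "slice c j = (case c of ((a1, a2, a3, a4), (b1, b2, b3, b4)) \<Rightarrow>
     if j = 1 then (a1, a2, a3, b1, b2, b3) else if j = 2 then (a2, a3, a4, b2, b3, b4)
     else if j = 3 then (b1, b2, b3, - a1, - a2, - a3) else (b2, b3, b4, - a2, - a3, - a4))"

lemma slice_simps [simp]:
  "slice ((a1, a2, a3, a4), (b1, b2, b3, b4)) 1 = (a1, a2, a3, b1, b2, b3)"
  "slice ((a1, a2, a3, a4), (b1, b2, b3, b4)) 2 = (a2, a3, a4, b2, b3, b4)"
  "slice ((a1, a2, a3, a4), (b1, b2, b3, b4)) 3 = (b1, b2, b3, - a1, - a2, - a3)"
  "slice ((a1, a2, a3, a4), (b1, b2, b3, b4)) 4 = (b2, b3, b4, - a2, - a3, - a4)"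
  by (simp_all add: slice_def)

lemma linear_slice: "linear (\<lambda>c. slice c j)"
  by (rule linearI) (auto simp: slice_def split: prod.split)

definition Rm :: "'r::finite cub \<Rightarrow> real^4^4^('r + 2 + 'r \<times> 4)" where
  "Rm c = (\<chi> g i j. Pm (slice c j) $ g $ i)"

lemma linear_Rm: "linear (Rm :: 'r::finite cub \<Rightarrow> _)"
  by (rule linearI) (simp_all add: Rm_def vec_eq_iff linear_add[OF linear_slice] linear_scale[OF linear_slice]
      linear_add[OF linear_Pm] linear_scale[OF linear_Pm])

lemma inj_Rm: "inj (Rm :: 'r::finite cub \<Rightarrow> _)"
proof (rule injI)
  fix c d :: "'r cub" assume "Rm c = Rm d"
  then have "Pm (slice c j) $ g $ i = Pm (slice d j) $ g $ i" for g i j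
    by (simp add: Rm_def vec_eq_iff)
  then have "slice c j = slice d j" for j
    using injD[OF inj_Pm] by (metis vec_eq_iff)
  from this[of 1] this[of 2] show "c = d" by (cases c; cases d) auto
qed

context frame_dim
begin

section \<open>Dimensions of the tableau, its kernels and its prolongation\<close>

lemma nrm_linear: "nrm x (a + b) = nrm x a + nrm x b" "nrm x (s *\<^sub>R a) = s *\<^sub>R nrm x a" "nrm x 0 = 0"
  by (simp_all add: nrm_def scaleR_left_distrib sum.distrib scaleR_sum_right)

definition Lc :: "('v, 'r) frame \<Rightarrow> 'r tab \<Rightarrow> real \<times> real" where
  "Lc x t = (pol1 (nus x) (\<lambda>a. nrm x (sel6 t a)), pol2 (nus x) (\<lambda>a. nrm x (sel6 t a)))"

lemma linear_Lc: "linear (Lc x)"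
  by (rule linearI) (simp_all add: Lc_def nrm_linear pol_add pol_scale)

lemma tabpar_Lc: "tabpar x = {t. Lc x t = 0}"
  by (simp add: tabpar_def Lc_def zero_prod_def)

lemma Lc_tuple:
  "Lc x (m1, m2, m3, m4, m5, m6) =
    (nus x 1 \<bullet> nrm x m3 + nus x 3 \<bullet> nrm x m1 - 2 * (nus x 2 \<bullet> nrm x m2) - nus x 4 \<bullet> nrm x m6 - nus x 6 \<bullet> nrm x m4 + 2 * (nus x 5 \<bullet> nrm x m5),
     nus x 1 \<bullet> nrm x m6 + nus x 6 \<bullet> nrm x m1 - 2 * (nus x 2 \<bullet> nrm x m5) - 2 * (nus x 5 \<bullet> nrm x m2) + nus x 3 \<bullet> nrm x m4 + nus x 4 \<bullet> nrm x m3)"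
  by (simp add: Lc_def pol1_def pol2_def)

lemma dual_normal:
  assumes x: "x \<in> Loc" and b: "b \<in> {1..6}"
  obtains d where "\<And>a. a \<in> {1..6} \<Longrightarrow> nus x a \<bullet> nrm x d = (if a = b then 1 else 0)"
proof -
  have fb: "x \<in> FB" using x by (simp add: locus_iff)
  obtain z where z: "\<And>i. z \<bullet> ee x $ i = 0" "\<And>k. z \<bullet> nu x $ k = (if num k = b then 1 else 0)"
    using dual_vector[OF frame_bundle_bases[OF fb], of "\<lambda>_. 0" "\<lambda>k. if num k = b then 1 else 0"] by blast
  obtain w where w: "z = nrm x w" by (rule normal_coefficients[OF fb z(1)])
  have "nus x a \<bullet> nrm x w = (if a = b then 1 else 0)" if "a \<in> {1..6}" for a
    using z(2)[of "inv num a"] num6[OF that] w by (simp add: nus_def inner_commute)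
  then show thesis by (rule that)
qed

context
  fixes x :: "('v, 'r) frame"
  assumes x: "x \<in> Loc"
begin

text \<open>The vector \<open>d\<close> dual to \<open>\<nu>\<^sub>1\<close> lets \<open>m3\<close>
  correct the first equation and \<open>m6\<close> the second without mutual interference. So the
  complex determinant condition can be solved for the coefficient with parts \<open>m3\<close> and
  \<open>m6\<close>, whatever the others are.\<close>

lemma Lc_adjust:
  obtains f where "\<And>m1 m2 m4 m5. Lc x (m1, m2, fst (f (m1, m2, m4, m5) s), m4, m5, snd (f (m1, m2, m4, m5) s)) = s"
proof -
  obtain d where "\<And>a. a \<in> {1..6} \<Longrightarrow> nus x a \<bullet> nrm x d = (if a = 1 then 1 else 0)"
    using dual_normal[OF x, of 1] by auto
  then have d: "nus x 1 \<bullet> nrm x d = 1" "nus x 3 \<bullet> nrm x d = 0" "nus x 4 \<bullet> nrm x d = 0" "nus x 6 \<bullet> nrm x d = 0"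
    by auto
  define f where "f = (\<lambda>(m1, m2, m4, m5). \<lambda>s. ((fst s - fst (Lc x (m1, m2, 0, m4, m5, 0))) *\<^sub>R d, (snd s - snd (Lc x (m1, m2, 0, m4, m5, 0))) *\<^sub>R d))"
  have "Lc x (m1, m2, fst (f (m1, m2, m4, m5) s), m4, m5, snd (f (m1, m2, m4, m5) s)) = s" for m1 m2 m4 m5
    by (simp add: f_def Lc_tuple nrm_linear d prod_eq_iff)
  then show thesis by (rule that)
qed

lemma dim_tabpar: "dim (tabpar x) + 2 = 6 * CARD('r)"
proof -
  have "\<exists>t. Lc x t = s" for s
    using Lc_adjust[of s] by metis
  then have "dim (tabpar x) + DIM(real \<times> real) = DIM('r tab)"
    unfolding tabpar_Lc by (intro dim_kernel_surj linear_Lc)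
  then show ?thesis by simp
qed

definition "T = Tab x"

lemma T_eq: "T = Pm ` tabpar x"
  unfolding T_def by (rule tableau_locus[OF x])

lemma dim_T: "dim T + 2 = 6 * CARD('r)"
  using dim_tabpar by (simp add: T_eq dim_inj_image[OF linear_Pm inj_Pm])

text \<open>The product of \<open>Pm t\<close> with \<open>w\<close> without its zero rows, so that
  the target has dimension \<open>4 * CARD('r)\<close> and surjectivity can be hoped for.\<close>

definition Mw :: "real^4 \<Rightarrow> 'r tab \<Rightarrow> real^4^'r" where
  "Mw w t = (\<chi> k i. \<Sum>j\<in>UNIV. Qm (\<lambda>a. sel6 t a $ k) i j * w $ j)"

lemma linear_Mw: "linear (Mw w)"
  by (rule linearI) (simp_all add: Mw_def vec_eq_iff Qm_add Qm_scale algebra_simps sum.distrib sum_distrib_left)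

lemma Pm_mult_zero_iff: "Pm t *v w = 0 \<longleftrightarrow> Mw w t = 0"
proof -
  have "Pm t *v w = 0 \<longleftrightarrow> (\<forall>g. (Pm t *v w) $ g = 0)" by (simp add: vec_eq_iff)
  then show ?thesis unfolding all_generators by (simp add: matrix_vector_mult_def Mw_def vec_eq_iff)
qed

lemma linear_LM: "linear (\<lambda>t. (Lc x t, Mw w t))"
  by (rule linearI) (simp_all add: linear_add[OF linear_Lc] linear_add[OF linear_Mw] linear_scale[OF linear_Lc] linear_scale[OF linear_Mw])

lemma T_kernel: "{P \<in> T. P *v w = 0} = Pm ` {t. (Lc x t, Mw w t) = 0}"
  by (auto simp: T_eq tabpar_Lc Pm_mult_zero_iff zero_prod_def)

text \<open>The kernel is cut out by \<open>2 + 4 * CARD('r)\<close> linear equations in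
  \<open>6 * CARD('r)\<close> unknowns, so no direction lowers the dimension of the tableau by more
  than \<open>4 * CARD('r)\<close>.\<close>

lemma dim_T_kernel_ge: "6 * CARD('r) \<le> dim {P \<in> T. P *v w = 0} + (2 + 4 * CARD('r))"
  using dim_kernel_ge[OF linear_LM[of w]] unfolding T_kernel dim_inj_image[OF linear_Pm inj_Pm] by simp

text \<open>On the first axis \<open>Mw\<close> reads off \<open>m1\<close>, \<open>m2\<close>,
  \<open>m4\<close>, \<open>m5\<close>, and \<open>Lc_adjust\<close> solves the determinant
  condition for \<open>m3\<close>, \<open>m6\<close>. The equations are thus independent, and this
  direction attains the general bound.\<close>

lemma dim_T_kernel_axis: "dim {P \<in> T. P *v axis 1 1 = 0} + (2 + 4 * CARD('r)) = 6 * CARD('r)"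
proof -
  have "\<exists>t. (Lc x t, Mw (axis 1 1) t) = y" for y
  proof -
    obtain s Y where y: "y = (s, Y)" by (cases y)
    obtain f where f: "\<And>m1 m2 m4 m5. Lc x (m1, m2, fst (f (m1, m2, m4, m5) s), m4, m5, snd (f (m1, m2, m4, m5) s)) = s"
      using Lc_adjust[of s] by blast
    let ?m = "\<lambda>i. \<chi> k. Y $ k $ i"
    let ?p = "f (?m 1, ?m 2, ?m 3, ?m 4) s"
    have "Mw (axis 1 1) (?m 1, ?m 2, fst ?p, ?m 3, ?m 4, snd ?p) = Y"
      unfolding vec_eq_iff forall_4 by (simp add: Mw_def sum_4 axis_def)
    then show ?thesis unfolding y using f[of "?m 1" "?m 2" "?m 3" "?m 4"] by blast
  qed
  from dim_kernel_surj[OF linear_LM this] show ?thesis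
    unfolding T_kernel dim_inj_image[OF linear_Pm inj_Pm] by simp
qed

lemma cartan_sum_eqI:
  assumes "\<And>v. dim T - dim {P\<in>T. \<forall>q<p. P *v v q = 0} \<le> n" "dim T - dim {P\<in>T. \<forall>q<p. P *v v0 q = 0} = n"
  shows "cartan_sum T p = n"
  unfolding cartan_sum_def
proof (rule Max_eqI)
  show "finite (range (\<lambda>v. dim T - dim {P \<in> T. \<forall>q<p. P *v v q = 0}))"
    by (rule finite_subset[of _ "{..dim T}"]) auto
qed (use assms in auto)

lemma cartan_sum_0: "cartan_sum T 0 = 0"
  by (rule cartan_sum_eqI) auto

lemma cartan_sum_1: "cartan_sum T 1 = 4 * CARD('r)"
proof (rule cartan_sum_eqI)
  have e: "{P\<in>T. \<forall>q<1::nat. P *v v q = 0} = {P\<in>T. P *v v 0 = 0}" for v :: "nat \<Rightarrow> real^4"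
    by auto
  show "dim T - dim {P\<in>T. \<forall>q<1::nat. P *v v q = 0} \<le> 4 * CARD('r)" for v :: "nat \<Rightarrow> real^4"
    unfolding e using dim_T_kernel_ge[of "v 0"] dim_T by linarith
  show "dim T - dim {P\<in>T. \<forall>q<1::nat. P *v (\<lambda>_. axis 1 1) q = 0} = 4 * CARD('r)"
    unfolding e using dim_T_kernel_axis dim_T by linarith
qed

text \<open>The first two axes form a complex basis, so a complex form annihilated by both is zero.
  Repeating the second axis serves every larger \<open>p\<close>, which is why the third and fourth
  characters vanish.\<close>

lemma cartan_sum_ge_2:
  assumes "2 \<le> p"
  shows "cartan_sum T p = dim T"
proof (rule cartan_sum_eqI)
  let ?v = "\<lambda>q :: nat. if q = 0 then axis 1 1 else axis 2 1 :: real^4"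
  have "P = 0" if P: "P \<in> T" "\<forall>q<p. P *v ?v q = 0" for P
  proof -
    obtain t where t: "P = Pm t" using P(1) unfolding T_eq by blast
    have "Mw (axis 1 1) t = 0" "Mw (axis 2 1) t = 0"
      using P(2)[rule_format, of 0] P(2)[rule_format, of 1] assms by (auto simp: t Pm_mult_zero_iff)
    then have "sel6 t 1 = 0" "sel6 t 2 = 0" "sel6 t 3 = 0" "sel6 t 4 = 0" "sel6 t 5 = 0" "sel6 t 6 = 0"
      unfolding Mw_def vec_eq_iff forall_4 by (auto simp: sum_4 axis_def)
    then have "t = 0" using sel6_eta[of t] by (simp add: zero_prod_def)
    then show ?thesis by (simp add: t linear_0[OF linear_Pm])
  qed
  then have "{P\<in>T. \<forall>q<p. P *v ?v q = 0} \<subseteq> {0}" by blast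
  then have "dim {P\<in>T. \<forall>q<p. P *v ?v q = 0} = 0" by (simp only: dim_eq_0)
  then show "dim T - dim {P\<in>T. \<forall>q<p. P *v ?v q = 0} = dim T" by (simp only: diff_zero)
qed simp

lemma cartan_chars:
  "cartan_char T 1 = 4 * CARD('r)" "cartan_char T 2 = 2 * (CARD('r) - 1)" "cartan_char T 3 = 0" "cartan_char T 4 = 0"
  using dim_T r6 by (simp_all add: cartan_char_def cartan_sum_0 cartan_sum_1 cartan_sum_1[unfolded One_nat_def] cartan_sum_ge_2)

lemma prolongation_T: "prolongation T = Rm ` {c. (Lc x (slice c 1), Lc x (slice c 2)) = 0}"
proof (intro equalityI subsetI)
  fix P assume "P \<in> prolongation T"
  then have sym: "\<And>g i j. P $ g $ i $ j = P $ g $ j $ i" and "\<And>j. (\<chi> g i. P $ g $ i $ j) \<in> T"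
    by (auto simp: prolongation_def)
  then have "\<exists>t. Lc x t = 0 \<and> (\<chi> g i. P $ g $ i $ j) = Pm t" for j unfolding T_eq tabpar_Lc by blast
  then obtain t where t: "\<And>j. Lc x (t j) = 0" "\<And>j. (\<chi> g i. P $ g $ i $ j) = Pm (t j)" by metis
  have P: "P $ g $ i $ j = Pm (t j) $ g $ i" for g i j
    by (simp flip: t(2))
  have s: "Qm (\<lambda>a. sel6 (t j) a $ k) h i = Qm (\<lambda>a. sel6 (t i) a $ k) h j" for h i j k
    using sym[of "Inr (Inr (k, h))" i j] by (simp add: P)
  \<comment> \<open>Symmetry leaves as independent coefficients the whole slice in direction 1 and
    the last complex coefficient of the slice in direction 2; the equations below recover all other
    entries from these.\<close>
  define c :: "'r cub" where "c = ((sel6 (t 1) 1, sel6 (t 1) 2, sel6 (t 1) 3, sel6 (t 2) 3), (sel6 (t 1) 4, sel6 (t 1) 5, sel6 (t 1) 6, sel6 (t 2) 6))"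
  have 2: "sel6 (t 2) 1 = sel6 (t 1) 2" "sel6 (t 2) 2 = sel6 (t 1) 3" "sel6 (t 2) 4 = sel6 (t 1) 5" "sel6 (t 2) 5 = sel6 (t 1) 6"
    using s[of 2 _ 1 1] s[of 2 _ 2 1] s[of 2 _ 3 1] s[of 2 _ 4 1] by (simp_all add: vec_eq_iff)
  have 3: "sel6 (t 3) 1 = sel6 (t 1) 4" "sel6 (t 3) 2 = sel6 (t 1) 5" "sel6 (t 3) 4 = - sel6 (t 1) 1" "sel6 (t 3) 5 = - sel6 (t 1) 2"
    "sel6 (t 3) 3 = sel6 (t 1) 6" "sel6 (t 3) 6 = - sel6 (t 1) 3"
    using s[of 3 _ 1 1] s[of 3 _ 2 1] s[of 3 _ 3 1] s[of 3 _ 4 1] s[of 3 _ 2 2] s[of 3 _ 4 2] 2 by (simp_all add: vec_eq_iff)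
  have 4: "sel6 (t 4) 1 = sel6 (t 1) 5" "sel6 (t 4) 2 = sel6 (t 1) 6" "sel6 (t 4) 4 = - sel6 (t 1) 2" "sel6 (t 4) 5 = - sel6 (t 1) 3"
    "sel6 (t 4) 3 = sel6 (t 2) 6" "sel6 (t 4) 6 = - sel6 (t 2) 3"
    using s[of 4 _ 1 1] s[of 4 _ 2 1] s[of 4 _ 3 1] s[of 4 _ 4 1] s[of 4 _ 2 2] s[of 4 _ 4 2] 2 by (simp_all add: vec_eq_iff)
  have "\<forall>j. t j = slice c j"
    unfolding forall_4 c_def slice_simps
    using sel6_eta[of "t 1"] sel6_eta[of "t 2"] sel6_eta[of "t 3"] sel6_eta[of "t 4"] 2 3 4 by simp
  then have "P = Rm c" "(Lc x (slice c 1), Lc x (slice c 2)) = 0"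
    using t(1) by (simp_all add: vec_eq_iff Rm_def P zero_prod_def) 
  then show "P \<in> Rm ` {c. (Lc x (slice c 1), Lc x (slice c 2)) = 0}" by blast
next
  fix P assume "P \<in> Rm ` {c. (Lc x (slice c 1), Lc x (slice c 2)) = 0}"
  then obtain c where P: "P = Rm c" and c: "Lc x (slice c 1) = 0" "Lc x (slice c 2) = 0" by (auto simp: zero_prod_def)
  obtain a1 a2 a3 a4 b1 b2 b3 b4 where cc: "c = ((a1, a2, a3, a4), (b1, b2, b3, b4))"
    by (metis prod.exhaust)
  \<comment> \<open>Slices 3 and 4 are slices 1 and 2 multiplied by a complex unit. The determinant
    condition is complex linear, so its vanishing on the first two slices implies the rest.\<close>
  have Lc34: "Lc x (slice c 3) = (snd (Lc x (slice c 1)), - fst (Lc x (slice c 1)))"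
    "Lc x (slice c 4) = (snd (Lc x (slice c 2)), - fst (Lc x (slice c 2)))"
    by (simp_all add: cc Lc_tuple nrm_uminus)
  have "\<forall>j. Lc x (slice c j) = 0"
    unfolding forall_4 using c Lc34 by (simp add: zero_prod_def)
  then have "\<forall>j. (\<chi> g i. P $ g $ i $ j) \<in> T"
    by (auto simp: T_eq tabpar_Lc P Rm_def)
  moreover have "\<forall>h i j. Qm (\<lambda>a. sel6 (slice c j) a $ k) h i = Qm (\<lambda>a. sel6 (slice c i) a $ k) h j" for k
    unfolding forall_4 cc by simp
  then have "\<forall>g. \<forall>i j. P $ g $ i $ j = P $ g $ j $ i"
    unfolding all_generators P Rm_def by simp
  ultimately show "P \<in> prolongation T" by (simp add: prolongation_def)
qed

lemma dim_prolongation_T: "dim (prolongation T) + 4 = 8 * CARD('r)"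
proof -
  let ?N = "\<lambda>c. (Lc x (slice c 1), Lc x (slice c 2))"
  have lin: "linear ?N"
    by (rule linearI) (simp_all add: linear_add[OF linear_slice] linear_scale[OF linear_slice]
        linear_add[OF linear_Lc] linear_scale[OF linear_Lc])
  obtain d where "\<And>a. a \<in> {1..6} \<Longrightarrow> nus x a \<bullet> nrm x d = (if a = 1 then 1 else 0)"
    using dual_normal[OF x, of 1] by auto
  then have d: "nus x 1 \<bullet> nrm x d = 1" "nus x 4 \<bullet> nrm x d = 0" by auto
  obtain e where "\<And>a. a \<in> {1..6} \<Longrightarrow> nus x a \<bullet> nrm x e = (if a = 3 then 1 else 0)"
    using dual_normal[OF x, of 3] by auto
  then have e: "nus x 3 \<bullet> nrm x e = 1" "nus x 6 \<bullet> nrm x e = 0" by auto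
  have "\<exists>c. ?N c = y" for y :: "(real \<times> real) \<times> (real \<times> real)"
  proof -
    obtain s1 s2 s3 s4 where y: "y = ((s1, s2), (s3, s4))" by (metis prod.exhaust)
    \<comment> \<open>Among slices 1 and 2, the first cubic coefficient occurs only in slice 1 and
      the last only in slice 2. Pairing them with \<open>\<nu>\<^sub>3\<close> and
      \<open>\<nu>\<^sub>1\<close> through the dual vectors \<open>e\<close> and \<open>d\<close>
      adjusts the two conditions separately.\<close>
    have "?N ((s1 *\<^sub>R e, 0, 0, s3 *\<^sub>R d), (s2 *\<^sub>R e, 0, 0, s4 *\<^sub>R d)) = y"
      by (simp add: y Lc_tuple nrm_linear d e)
    then show ?thesis by blast
  qed
  from dim_kernel_surj[OF lin this] show ?thesis
    unfolding prolongation_T dim_inj_image[OF linear_Rm inj_Rm] by simp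
qed

lemma involutive_T: "involutive_tableau T"
proof -
  have "{1..CARD(4)} = {1, 2, 3, 4}" by auto
  then have "(\<Sum>p=1..CARD(4). p * cartan_char T p) = 8 * CARD('r) - 4"
    using r6 by (simp add: cartan_chars)
  then show ?thesis using dim_prolongation_T by (simp add: involutive_tableau_def)
qed

end

lemma involutive_pfaffian_locus: "involutive_pfaffian Loc gen omega"
  unfolding involutive_pfaffian_def
proof (intro conjI ballI)
  show "linear_pfaffian Loc gen omega" by (rule linear_pfaffian_locus)
  fix x :: "('v, 'r) frame" assume x: "x \<in> Loc"
  show "\<exists>E. integral_element Loc gen omega x E" by (rule integral_element_exists[OF x])
  show "involutive_tableau (Tab x)"
    using involutive_T[OF x] by (simp only: T_def[OF x])
qed

lemma last_character_locus: "last_character Loc gen omega 2 (2 * (CARD('r) - 1))"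
  unfolding last_character_def
proof (intro conjI ballI allI impI)
  show "2 * (CARD('r) - 1) \<noteq> 0" using r6 by simp
  show "2 \<in> {1..CARD(4)}" by simp
  fix x :: "('v, 'r) frame" assume x: "x \<in> Loc"
  show "cartan_char (Tab x) 2 = 2 * (CARD('r) - 1)"
    using cartan_chars(2)[OF x] by (simp add: T_def[OF x])
  fix p :: nat assume "2 < p \<and> p \<le> CARD(4)"
  then have "p = 3 \<or> p = 4" by auto
  then show "cartan_char (Tab x) p = 0"
    using cartan_chars(3,4)[OF x] by (auto simp: T_def[OF x])
qed

end

section \<open>Second fundamental form in a moving frame\<close>

lemma vector_4:
  "(vector [a, b, c, d] :: 'a::zero^4) $ 1 = a" "(vector [a, b, c, d] :: 'a^4) $ 2 = b"
  "(vector [a, b, c, d] :: 'a^4) $ 3 = c" "(vector [a, b, c, d] :: 'a^4) $ 4 = d"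
  unfolding vector_def by simp_all

lemma QA_iff: "M \<in> QA \<longleftrightarrow> (\<exists>s. \<forall>i j. M $ i $ j = Qm s i j)"
proof
  assume "M \<in> QA"
  then obtain A B :: "real^2^2" where AB: "transpose A = A" "transpose B = B"
    and M: "M = vector [vector [A$1$1, A$1$2,   B$1$1,   B$1$2],
                 vector [A$2$1, A$2$2,   B$2$1,   B$2$2],
                 vector [B$1$1, B$1$2, - A$1$1, - A$1$2],
                 vector [B$2$1, B$2$2, - A$2$1, - A$2$2]]"
    unfolding QA_def by blast
  have "A $ 2 $ 1 = A $ 1 $ 2" "B $ 2 $ 1 = B $ 1 $ 2"
    using arg_cong[OF AB(1), of "\<lambda>X. X $ 1 $ 2"] arg_cong[OF AB(2), of "\<lambda>X. X $ 1 $ 2"] by (simp_all add: transpose_def)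
  then have "\<forall>i j. M $ i $ j = Qm (\<lambda>a. sel6 (A$1$1, A$1$2, A$2$2, B$1$1, B$1$2, B$2$2) a) i j"
    unfolding forall_4 M by (simp add: vector_4)
  then show "\<exists>s. \<forall>i j. M $ i $ j = Qm s i j" by blast
next
  assume "\<exists>s. \<forall>i j. M $ i $ j = Qm s i j"
  then obtain s where s: "\<forall>i j. M $ i $ j = Qm s i j" by blast
  let ?A = "vector [vector [s 1, s 2], vector [s 2, s 3]] :: real^2^2"
  let ?B = "vector [vector [s 4, s 5], vector [s 5, s 6]] :: real^2^2"
  have "M = vector [vector [?A$1$1, ?A$1$2,   ?B$1$1,   ?B$1$2],
                 vector [?A$2$1, ?A$2$2,   ?B$2$1,   ?B$2$2],
                 vector [?B$1$1, ?B$1$2, - ?A$1$1, - ?A$1$2],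
                 vector [?B$2$1, ?B$2$2, - ?A$2$1, - ?A$2$2]]"
    unfolding vec_eq_iff forall_4 by (simp add: s vector_4)
  moreover have "transpose ?A = ?A" "transpose ?B = ?B"
    unfolding vec_eq_iff forall_2 by (simp_all add: transpose_def)
  ultimately show "M \<in> QA" unfolding QA_def by blast
qed

lemma inner_Qm: "n \<bullet> Qm m i j = Qm (\<lambda>a. n \<bullet> m a) i j"
  by (simp add: Qm_def inner_sum_right)

lemma orthonormal4D: "orthonormal4 e \<Longrightarrow> e $ i \<bullet> e $ j = (if i = j then 1 else 0)"
  by (simp add: orthonormal4_def)

definition tproj :: "'v::euclidean_space^4 \<Rightarrow> 'v \<Rightarrow> 'v" where
  "tproj e w = (\<Sum>i\<in>UNIV. (w \<bullet> e $ i) *\<^sub>R e $ i)"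

lemma tproj_inner: "orthonormal4 e \<Longrightarrow> tproj e w \<bullet> e $ i = w \<bullet> e $ i"
  by (simp add: tproj_def inner_sum_left orthonormal4D if_distrib cong: if_cong)

lemma linear_tproj: "linear (tproj e)"
  by (rule linearI) (simp_all add: tproj_def inner_add_left scaleR_left_distrib sum.distrib scaleR_sum_right)

lemma tproj_sum: "orthonormal4 e \<Longrightarrow> tproj e (\<Sum>i\<in>UNIV. a i *\<^sub>R e $ i) = (\<Sum>i\<in>UNIV. a i *\<^sub>R e $ i)"
  by (simp add: tproj_def inner_sum_left orthonormal4D if_distrib cong: if_cong)

context
  fixes U :: "(real^4) set" and f :: "real^4 \<Rightarrow> 'v::euclidean_space"
  assumes imm: "immersion_on U f"
begin

abbreviation "D y \<equiv> fderiv f y"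
abbreviation "DD y u w \<equiv> fderiv (\<lambda>z. fderiv f z w) y u"

lemma immD: "open U" "smooth_on U f" "y \<in> U \<Longrightarrow> inj (D y)" "y \<in> U \<Longrightarrow> linear (D y)"
  using imm smooth_on_has_derivative has_derivative_linear unfolding immersion_on_def by blast+

lemma TM_subspace: "y \<in> U \<Longrightarrow> subspace (TM f y)"
  unfolding TM_def by (rule linear_subspace_image[OF immD(4) subspace_UNIV])

lemma tproj_TM:
  assumes "y \<in> U" "\<And>i. e $ i \<in> TM f y"
  shows "tproj e w \<in> TM f y" "(\<Sum>i\<in>UNIV. a i *\<^sub>R e $ i) \<in> TM f y"
  unfolding tproj_def using TM_subspace[OF assms(1)] assms(2)
  by (auto intro!: subspace_sum subspace_scale)

text \<open>The differential is injective, so the tangent space has dimension 4 and four orthonormal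
  vectors in it span it.\<close>

lemma TM_expand:
  assumes y: "y \<in> U" and e: "orthonormal4 e" "\<And>i. e $ i \<in> TM f y" and X: "X \<in> TM f y"
  shows "X = (\<Sum>i\<in>UNIV. (X \<bullet> e $ i) *\<^sub>R e $ i)"
proof -
  let ?g = "\<lambda>a :: real^4. \<Sum>i\<in>UNIV. a $ i *\<^sub>R e $ i"
  have lin: "linear ?g" by (rule linearI) (simp_all add: scaleR_left_distrib sum.distrib scaleR_sum_right)
  have "?g a \<bullet> e $ j = a $ j" for a j
    using e(1) by (simp add: inner_sum_left orthonormal4D if_distrib cong: if_cong)
  then have "inj ?g" by (metis (no_types, lifting) injI vec_eq_iff)
  then have "dim (range ?g) = 4" using dim_inj_image[OF lin, of UNIV] by simp
  moreover have "dim (TM f y) = 4"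
    unfolding TM_def using dim_inj_image[OF immD(4)[OF y] immD(3)[OF y], of UNIV] by simp
  moreover have "range ?g \<subseteq> TM f y" using tproj_TM(2)[OF y, of e] e(2) by auto
  ultimately have "range ?g = TM f y"
    using subspace_dim_equal[OF linear_subspace_image[OF lin subspace_UNIV] TM_subspace[OF y]] by simp
  then obtain a where "X = ?g a" using X by blast
  then show ?thesis using tproj_sum[OF e(1), of "\<lambda>i. a $ i"] by (simp add: tproj_def)
qed

lemma NM_iff:
  assumes "y \<in> U" "orthonormal4 e" "\<And>i. e $ i \<in> TM f y"
  shows "n \<in> NM f y \<longleftrightarrow> (\<forall>i. n \<bullet> e $ i = 0)"
proof -
  have "n \<bullet> X = 0" if "\<forall>i. n \<bullet> e $ i = 0" "X \<in> TM f y" for X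
    by (subst TM_expand[OF assms that(2)]) (simp add: inner_sum_right that(1))
  then show ?thesis using assms(3) by (auto simp: NM_def)
qed

lemma normal_proj_eq:
  assumes y: "y \<in> U" and e: "orthonormal4 e" "\<And>i. e $ i \<in> TM f y"
  shows "normal_proj f y w = w - tproj e w"
  unfolding normal_proj_def
proof (rule the_equality)
  show "w - tproj e w \<in> NM f y \<and> w - (w - tproj e w) \<in> TM f y"
    using tproj_TM(1)[OF y e(2)] by (simp add: NM_iff[OF y e] inner_diff_left tproj_inner[OF e(1)])
  fix n assume n: "n \<in> NM f y \<and> w - n \<in> TM f y"
  have "w - n = tproj e (w - n)"
    using TM_expand[OF y e, of "w - n"] n by (simp add: tproj_def)
  also have "\<dots> = tproj e w"
    using n by (simp add: tproj_def inner_diff_left NM_iff[OF y e])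
  finally show "n = w - tproj e w" by (simp add: algebra_simps)
qed

lemma DD_linear:
  assumes "y \<in> U"
  shows "linear (\<lambda>u. DD y u w)" "linear (\<lambda>w. DD y u w)" "DD y u w = DD y w u"
proof -
  show l: "linear (\<lambda>u. DD y u w)" for w
    by (rule has_derivative_linear[OF smooth_on_has_derivative[OF smooth_on_derivative[OF immD(2)] assms]])
  show s: "DD y u w = DD y w u" for u w
    by (rule second_derivative_symmetric[OF immD(1) assms immD(2)])
  have "(\<lambda>w. DD y u w) = (\<lambda>w. DD y w u)" by (rule ext) (rule s)
  then show "linear (\<lambda>w. DD y u w)" using l[of u] by (simp only:)
qed

lemma II_D:
  assumes "y \<in> U"
  shows "II f y (D y u) (D y w) = normal_proj f y (DD y u w)"
  using immD(3)[OF assms] by (simp add: II_def inv_f_f)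

text \<open>\<open>II\<close> is defined through preimages under the differential. Writing the frame
  vectors as images \<open>D y (u i)\<close> reduces its bilinearity to that of the second
  derivative.\<close>

lemma II_expand:
  assumes y: "y \<in> U" and e: "orthonormal4 e" "\<And>i. e $ i \<in> TM f y" and XY: "X \<in> TM f y" "Y \<in> TM f y"
  shows "II f y X Y = (\<Sum>i\<in>UNIV. \<Sum>j\<in>UNIV. ((X \<bullet> e $ i) * (Y \<bullet> e $ j)) *\<^sub>R II f y (e $ i) (e $ j))"
proof -
  have "\<forall>i. \<exists>u. e $ i = D y u" using e(2) by (auto simp: TM_def)
  from choice[OF this] obtain u where u: "\<And>i. e $ i = D y (u i)" by blast
  have D: "(\<Sum>i\<in>UNIV. (Z \<bullet> e $ i) *\<^sub>R e $ i) = D y (\<Sum>i\<in>UNIV. (Z \<bullet> e $ i) *\<^sub>R u i)" for Z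
    by (simp add: linear_sum[OF immD(4)[OF y]] linear_scale[OF immD(4)[OF y]] flip: u)
  have np: "linear (normal_proj f y)"
    unfolding normal_proj_eq[OF y e] by (intro linear_compose_sub linear_ident linear_tproj)
  have "II f y X Y = II f y (D y (\<Sum>i\<in>UNIV. (X \<bullet> e $ i) *\<^sub>R u i)) (D y (\<Sum>i\<in>UNIV. (Y \<bullet> e $ i) *\<^sub>R u i))"
    unfolding D[symmetric] TM_expand[OF y e XY(1), symmetric] TM_expand[OF y e XY(2), symmetric] by (rule refl)
  also have "\<dots> = (\<Sum>i\<in>UNIV. \<Sum>j\<in>UNIV. ((X \<bullet> e $ i) * (Y \<bullet> e $ j)) *\<^sub>R normal_proj f y (DD y (u i) (u j)))"
    unfolding II_D[OF y]
    by (subst sum.swap) (simp add: mult.commute linear_sum[OF DD_linear(1)[OF y]] linear_scale[OF DD_linear(1)[OF y]]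
        linear_sum[OF DD_linear(2)[OF y]] linear_scale[OF DD_linear(2)[OF y]] linear_sum[OF np] linear_scale[OF np] scaleR_sum_right)
  also have "\<dots> = (\<Sum>i\<in>UNIV. \<Sum>j\<in>UNIV. ((X \<bullet> e $ i) * (Y \<bullet> e $ j)) *\<^sub>R II f y (e $ i) (e $ j))"
    by (simp add: u II_D[OF y])
  finally show ?thesis .
qed

lemma first_normal_eq:
  assumes y: "y \<in> U" and e: "orthonormal4 e" "\<And>i. e $ i \<in> TM f y"
    and II: "\<And>i j. II f y (e $ i) (e $ j) = Qm N i j"
  shows "first_normal f y = span (N ` {1..6})"
proof
  have Q: "Qm N i j \<in> span (N ` {1..6})" for i j
    unfolding Qm_def by (intro span_sum span_scale span_base) blast
  have "II f y X Y \<in> span (N ` {1..6})" if "X \<in> TM f y" "Y \<in> TM f y" for X Y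
    unfolding II_expand[OF y e that] II by (intro span_sum span_scale Q)
  then show "first_normal f y \<subseteq> span (N ` {1..6})"
    unfolding first_normal_def by (intro span_minimal) auto
  have "II f y (e $ i) (e $ j) \<in> first_normal f y" for i j
    unfolding first_normal_def by (rule span_base) (use e(2) in blast)
  \<comment> \<open>At these six positions a \<open>Qm\<close> matrix shows each of its coefficients
    once, with a positive sign.\<close>
  from this[of 1 1] this[of 1 2] this[of 2 2] this[of 1 3] this[of 1 4] this[of 2 4]
  have "N ` {1..6} \<subseteq> first_normal f y"
    unfolding image_subset_iff Ball_def atLeast1AtMost6_iff by (auto simp: II)
  then show "span (N ` {1..6}) \<subseteq> first_normal f y"
    by (rule span_minimal) (simp add: first_normal_def)
qed

lemma II_NM:
  assumes y: "y \<in> U" and e: "orthonormal4 e" "\<And>i. e $ i \<in> TM f y"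
  shows "II f y X Y \<in> NM f y"
  unfolding II_def Let_def normal_proj_eq[OF y e] NM_iff[OF y e]
  by (simp add: inner_diff_left tproj_inner[OF e(1)])

text \<open>Tensoriality of the second fundamental form: the difference \<open>?Z\<close> of the
  field with constant \<open>w\<close> and the frame field is tangent and vanishes at
  \<open>y\<close>. Its derivative at \<open>y\<close> is therefore tangent, and the normal parts of
  the two derivatives agree.\<close>

lemma II_moving_frame:
  assumes V: "open V" "y \<in> V" "V \<subseteq> U" and e: "smooth_on V e"
    "\<And>z. z \<in> V \<Longrightarrow> orthonormal4 (e z)" "\<And>z i. z \<in> V \<Longrightarrow> e z $ i \<in> TM f z"
  shows "II f y (D y u) (e y $ i) = fderiv (\<lambda>z. e z $ i) y u - tproj (e y) (fderiv (\<lambda>z. e z $ i) y u)"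
proof -
  have y: "y \<in> U" using V by blast
  obtain w where w: "D y w = e y $ i" using e(3)[OF V(2), of i] by (auto simp: TM_def)
  let ?Z = "\<lambda>z. D z w - e z $ i"
  let ?De = "\<lambda>i. fderiv (\<lambda>z. e z $ i) y"
  have de: "((\<lambda>z. e z $ j) has_derivative ?De j) (at y)" for j
    by (rule smooth_on_has_derivative[OF smooth_on_nth[OF V(1) e(1)] V(2)])
  have dZ: "(?Z has_derivative (\<lambda>u. DD y u w - ?De i u)) (at y)"
    by (intro has_derivative_diff de smooth_on_has_derivative[OF smooth_on_derivative[OF immD(2)] y])
  have "((\<lambda>z. \<Sum>j\<in>UNIV. (?Z z \<bullet> e z $ j) *\<^sub>R e z $ j) has_derivative
    (\<lambda>u. \<Sum>j\<in>UNIV. (?Z y \<bullet> e y $ j) *\<^sub>R ?De j u + (?Z y \<bullet> ?De j u + (DD y u w - ?De i u) \<bullet> e y $ j) *\<^sub>R e y $ j)) (at y)"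
    by (intro has_derivative_sum has_derivative_scaleR has_derivative_inner dZ de)
  moreover have "(\<Sum>j\<in>UNIV. (?Z z \<bullet> e z $ j) *\<^sub>R e z $ j) = ?Z z" if "z \<in> V" for z
  proof (rule TM_expand[symmetric, OF _ e(2)[OF that] e(3)[OF that]])
    show "z \<in> U" using that V by blast
    then show "?Z z \<in> TM f z" using subspace_diff[OF TM_subspace] e(3)[OF that] by (auto simp: TM_def)
  qed
  ultimately have "(?Z has_derivative
    (\<lambda>u. \<Sum>j\<in>UNIV. (?Z y \<bullet> e y $ j) *\<^sub>R ?De j u + (?Z y \<bullet> ?De j u + (DD y u w - ?De i u) \<bullet> e y $ j) *\<^sub>R e y $ j)) (at y)"
    by (rule has_derivative_transform_within_open[OF _ V(1,2)])
  from fun_cong[OF has_derivative_unique[OF dZ this], of u]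
  have "DD y u w - ?De i u = tproj (e y) (DD y u w - ?De i u)"
    by (simp add: w tproj_def)
  then have "DD y u w - tproj (e y) (DD y u w) = ?De i u - tproj (e y) (?De i u)"
    by (simp add: linear_diff[OF linear_tproj] algebra_simps)
  then show ?thesis
    unfolding w[symmetric] II_D[OF y] normal_proj_eq[OF y e(2,3)[OF V(2)]] by simp
qed

end

section \<open>Adapted frames and integral manifolds\<close>

context frame_dim
begin

lemma frame_normal_part:
  assumes "x \<in> FB"
  shows "ee v $ i - tproj (ee x) (ee v $ i) = (\<Sum>l\<in>UNIV. eta l i x v *\<^sub>R nu x $ l)"
  unfolding tproj_def frame_inner[OF assms]
  by (subst frame_expand(2)[OF frame_bundle_bases[OF assms], of v i]) (rule add_diff_cancel_left')

lemma hh_axis: "(\<And>i. omega i x v = (if i = j then 1 else 0)) \<Longrightarrow> hh x v i = Qm (nus x) i j"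
  by (simp add: hh_def if_distrib[of "\<lambda>c. c *\<^sub>R _"] cong: if_cong)

lemma nu_independent:
  fixes x :: "('v, 'r) frame"
  assumes "x \<in> bases" "(\<Sum>l\<in>UNIV. a l *\<^sub>R nu x $ l) = (\<Sum>l\<in>UNIV. b l *\<^sub>R nu x $ l)"
  shows "a l = b l"
proof -
  have "frame_map x (0, \<chi> l. a l) = frame_map x (0, \<chi> l. b l)" using assms(2) by (simp add: frame_map_def)
  then have "(\<chi> l. a l) = (\<chi> l. b l)" using frame_map_inv(2)[OF assms(1)] by (metis snd_conv)
  then show ?thesis by (simp add: vec_eq_iff)
qed

lemma dim_span_nus:
  fixes x :: "('v, 'r) frame"
  assumes "x \<in> bases"
  shows "dim (nus x ` {1..6}) = 6"
proof -
  let ?S = "(\<lambda>a. (0, axis (inv num a) 1) :: (real^4) \<times> (real^'r)) ` {1..6}"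
  have inj: "inj (frame_map x)" using assms by (simp add: bases_def bij_is_inj)
  have "nus x ` {1..6} = frame_map x ` ?S" by (simp add: image_image nus_def)
  then have "dim (nus x ` {1..6}) = dim ?S" by (simp add: dim_inj_image[OF linear_frame_map inj])
  also have "\<dots> = card ?S"
  proof (rule dim_eq_card_independent, rule independent_mono[OF independent_Basis])
    show "?S \<subseteq> Basis" by (auto simp: Basis_prod_def axis_in_Basis_iff)
  qed
  also have "\<dots> = card {1..6::nat}"
  proof (rule card_image, rule inj_onI)
    fix a b :: nat assume ab: "a \<in> {1..6}" "b \<in> {1..6}"
      "((0, axis (inv num a) 1) :: (real^4) \<times> (real^'r)) = (0, axis (inv num b) 1)"
    then have "inv num a = inv num b" by (simp add: axis_eq_axis)
    then show "a = b" using num6[OF ab(1)] num6[OF ab(2)] by metis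
  qed
  finally show ?thesis by simp
qed

text \<open>The complex structure \<open>Jm\<close> anticommutes with the form and so embeds each
  eigenspace into that of the opposite eigenvalue. The reverse inequality is the same statement for
  \<open>- lam\<close>.\<close>

lemma austere_of_QA:
  fixes f :: "real^4 \<Rightarrow> 'v"
  assumes imm: "immersion_on U f" and y: "y \<in> U" and e: "orthonormal4 e" "\<And>i. e $ i \<in> TM f y"
    and s: "\<And>i j. n \<bullet> II f y (e $ i) (e $ j) = Qm s i j"
  shows "eig_mult f y n lam \<le> eig_mult f y n (- lam)"
proof -
  define Jm :: "'v \<Rightarrow> 'v" where "Jm X = (X \<bullet> e $ 1) *\<^sub>R e $ 3 + (X \<bullet> e $ 2) *\<^sub>R e $ 4 - (X \<bullet> e $ 3) *\<^sub>R e $ 1 - (X \<bullet> e $ 4) *\<^sub>R e $ 2" for X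
  have lin: "linear Jm" by (rule linearI) (simp_all add: Jm_def algebra_simps)
  have Je: "Jm X \<bullet> e $ 1 = - (X \<bullet> e $ 3)" "Jm X \<bullet> e $ 2 = - (X \<bullet> e $ 4)" "Jm X \<bullet> e $ 3 = X \<bullet> e $ 1" "Jm X \<bullet> e $ 4 = X \<bullet> e $ 2" for X
    by (simp_all add: Jm_def inner_add_left inner_diff_left orthonormal4D[OF e(1)])
  have JT: "Jm X \<in> TM f y" for X
    unfolding Jm_def using TM_subspace[OF imm y] e(2) by (intro subspace_diff subspace_add subspace_scale)
  let ?E = "\<lambda>l. {X\<in>TM f y. \<forall>Y\<in>TM f y. n \<bullet> II f y X Y = l * (X \<bullet> Y)}"
  \<comment> \<open>Testing the eigenvalue condition on the frame alone turns it into coordinate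
    equations, in which the effect of \<open>Jm\<close> is visible entry by entry.\<close>
  have E: "X \<in> ?E l \<longleftrightarrow> (\<forall>j. (\<Sum>i\<in>UNIV. (X \<bullet> e $ i) * Qm s i j) = l * (X \<bullet> e $ j))" if "X \<in> TM f y" for X l
  proof -
    have r: "n \<bullet> II f y X Y = (\<Sum>j\<in>UNIV. (Y \<bullet> e $ j) * (\<Sum>i\<in>UNIV. (X \<bullet> e $ i) * Qm s i j))" if "Y \<in> TM f y" for Y
      unfolding II_expand[OF imm y e \<open>X \<in> TM f y\<close> that] inner_sum_right inner_scaleR_right s
      by (subst sum.swap) (simp add: sum_distrib_left mult_ac)
    have r2: "X \<bullet> Y = (\<Sum>j\<in>UNIV. (Y \<bullet> e $ j) * (X \<bullet> e $ j))" if "Y \<in> TM f y" for Y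
      by (subst TM_expand[OF imm y e that]) (simp add: inner_sum_right)
    show ?thesis
    proof
      assume "X \<in> ?E l"
      then have "n \<bullet> II f y X (e $ j) = l * (X \<bullet> e $ j)" for j using e(2) by blast
      then show "\<forall>j. (\<Sum>i\<in>UNIV. (X \<bullet> e $ i) * Qm s i j) = l * (X \<bullet> e $ j)"
        by (simp add: r[OF e(2)] orthonormal4D[OF e(1)] if_distrib[of "\<lambda>c. c * _"] cong: if_cong)
    next
      assume a: "\<forall>j. (\<Sum>i\<in>UNIV. (X \<bullet> e $ i) * Qm s i j) = l * (X \<bullet> e $ j)"
      have "n \<bullet> II f y X Y = l * (X \<bullet> Y)" if "Y \<in> TM f y" for Y
        unfolding r[OF that] r2[OF that] a[rule_format] by (simp add: sum_distrib_left mult_ac)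
      then show "X \<in> ?E l" using \<open>X \<in> TM f y\<close> by blast
    qed
  qed
  have "Jm ` ?E lam \<subseteq> ?E (- lam)"
  proof
    fix Z assume "Z \<in> Jm ` ?E lam"
    then obtain X where X: "X \<in> TM f y" "X \<in> ?E lam" "Z = Jm X" by blast
    have a: "\<forall>j. (\<Sum>i\<in>UNIV. (X \<bullet> e $ i) * Qm s i j) = lam * (X \<bullet> e $ j)" using X E by blast
    have "\<forall>j. (\<Sum>i\<in>UNIV. (Jm X \<bullet> e $ i) * Qm s i j) = - lam * (Jm X \<bullet> e $ j)"
      using a unfolding forall_4 sum_4 Je Qm_simps by (auto simp: algebra_simps)
    then show "Z \<in> ?E (- lam)" using E[OF JT] X(3) by blast
  qed
  moreover have "subspace (?E lam)"
  proof -
    have "?E lam = TM f y \<inter> {X. \<forall>j. (\<Sum>i\<in>UNIV. (X \<bullet> e $ i) * Qm s i j) = lam * (X \<bullet> e $ j)}" using E by blast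
    moreover have "subspace {X. \<forall>j. (\<Sum>i\<in>UNIV. (X \<bullet> e $ i) * Qm s i j) = lam * (X \<bullet> e $ j)}"
      by (rule subspaceI) (simp_all add: inner_add_left algebra_simps sum.distrib flip: sum_distrib_left)
    ultimately show ?thesis using TM_subspace[OF imm y] by (simp add: subspace_inter)
  qed
  moreover have "inj_on Jm (?E lam)"
  proof (rule inj_onI)
    fix X Y assume XY: "X \<in> ?E lam" "Y \<in> ?E lam" "Jm X = Jm Y"
    have "\<forall>i. X \<bullet> e $ i = Y \<bullet> e $ i" unfolding forall_4 using Je[of X] Je[of Y] XY(3) by simp
    then show "X = Y" using TM_expand[OF imm y e, of X] TM_expand[OF imm y e, of Y] XY by simp
  qed
  ultimately have "dim (Jm ` ?E lam) = dim (?E lam)"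
    by (intro dim_image_eq[OF lin]) (simp only: span_eq_iff[THEN iffD2])
  then show ?thesis using dim_subset[OF \<open>Jm ` ?E lam \<subseteq> ?E (- lam)\<close>] by (simp add: eig_mult_def)
qed

text \<open>The components \<open>k = 2\<close> and \<open>k = 5\<close> already suffice; each conclusion is a combination of three equations.\<close>

lemma codazzi_imp_psi0:
  fixes x :: "('v, 'r) frame" and w :: "4 \<Rightarrow> ('v, 'r) frame"
  assumes ad: "\<And>a. adapt x (w a)" and om: "\<And>a j. omega j x (w a) = (if j = a then 1 else 0)"
    and cod: "\<And>k i a b. codazzi x k i (w a) (w b) = codazzi x k i (w b) (w a)"
  shows "psi0 x (w a)"
proof -
  define p where "p j i a = phi j i x (w a)" for j i a
  define n where "n k a c = kappa k (inv num c) x (w a)" for k a c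
  have sk: "p j i a = - p i j a" for i j a unfolding p_def by (rule adaptD(1)[OF ad])
  have sk': "p 1 1 a = 0" "p 2 2 a = 0" "p 3 3 a = 0" "p 4 4 a = 0" "p 1 2 a = - p 2 1 a" "p 1 3 a = - p 3 1 a"
    "p 1 4 a = - p 4 1 a" "p 2 3 a = - p 3 2 a" "p 2 4 a = - p 4 2 a" "p 3 4 a = - p 4 3 a" for a
    using sk[of 1 1 a] sk[of 2 2 a] sk[of 3 3 a] sk[of 4 4 a] sk[of 1 2 a] sk[of 1 3 a] sk[of 1 4 a] sk[of 2 3 a] sk[of 2 4 a] sk[of 3 4 a]
    by linarith+
  have c: "codazzi x k i (w a) (w b) = (\<Sum>m\<in>UNIV. Shat (num k) $ m $ b * p m i a) + Qm (n k b) i a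
    - (\<Sum>j\<in>UNIV. Shat (num k) $ i $ j * p j a b)" for k i a b
    by (simp add: codazzi_def om p_def n_def[abs_def] if_distrib[of "\<lambda>c. _ * c"] if_distrib[of "\<lambda>c. c * _"] cong: if_cong)
  have E: "(\<Sum>m\<in>UNIV. Shat c $ m $ b * p m i a) + Qm (n (inv num c) b) i a - (\<Sum>j\<in>UNIV. Shat c $ i $ j * p j a b)
    = (\<Sum>m\<in>UNIV. Shat c $ m $ a * p m i b) + Qm (n (inv num c) a) i b - (\<Sum>j\<in>UNIV. Shat c $ i $ j * p j b a)"
    if "c \<in> {1..6}" for c i a b
    using cod[of "inv num c" i a b] unfolding c num6[OF that] .
  have E2: "(\<Sum>m\<in>UNIV. Shat 2 $ m $ b * p m i a) + Qm (n (inv num 2) b) i a - (\<Sum>j\<in>UNIV. Shat 2 $ i $ j * p j a b)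
    = (\<Sum>m\<in>UNIV. Shat 2 $ m $ a * p m i b) + Qm (n (inv num 2) a) i b - (\<Sum>j\<in>UNIV. Shat 2 $ i $ j * p j b a)" for i a b
    by (rule E) simp
  have E5: "(\<Sum>m\<in>UNIV. Shat 5 $ m $ b * p m i a) + Qm (n (inv num 5) b) i a - (\<Sum>j\<in>UNIV. Shat 5 $ i $ j * p j a b)
    = (\<Sum>m\<in>UNIV. Shat 5 $ m $ a * p m i b) + Qm (n (inv num 5) a) i b - (\<Sum>j\<in>UNIV. Shat 5 $ i $ j * p j b a)" for i a b
    by (rule E) simp
  note [simp] = sum_4 Shat_eqs EE_nth sk'
  \<comment> \<open>In each triple below the normal connection \<open>n\<close> is eliminated: three
    of its entries occur, each twice, because entries of a \<open>Qm\<close> matrix repeat up to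
    sign.\<close>
  have t11: "p 2 1 1 = p 4 3 1"
    using E2[of 4 3 2, simplified] E2[of 2 2 1, simplified] E2[of 4 4 1, simplified] by linarith
  have t12: "p 3 2 1 = p 4 1 1"
    using E5[of 4 3 2, simplified] E5[of 4 4 1, simplified] E5[of 2 2 1, simplified] by linarith
  have t21: "p 2 1 2 = p 4 3 2"
    using E2[of 3 4 1, simplified] E2[of 3 3 2, simplified] E2[of 2 1 1, simplified] by linarith
  have t22: "p 3 2 2 = p 4 1 2"
    using E5[of 2 1 1, simplified] E5[of 3 3 2, simplified] E5[of 3 4 1, simplified] by linarith
  have t31: "p 2 1 3 = p 4 3 3"
    using E2[of 4 1 2, simplified] E2[of 3 2 2, simplified] E2[of 4 4 3, simplified] by linarith
  have t32: "p 3 2 3 = p 4 1 3"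
    using E5[of 3 2 2, simplified] E5[of 4 1 2, simplified] E5[of 4 4 3, simplified] by linarith
  have t41: "p 2 1 4 = p 4 3 4"
    using E2[of 4 1 1, simplified] E2[of 3 2 1, simplified] E2[of 4 3 3, simplified] by linarith
  have t42: "p 3 2 4 = p 4 1 4"
    using E5[of 4 1 1, simplified] E5[of 3 2 1, simplified] E5[of 4 3 3, simplified] by linarith
  have "\<forall>a. psi0 x (w a)"
    unfolding psi0_def forall_4 using t11 t12 t21 t22 t31 t32 t41 t42 unfolding p_def by blast
  then show ?thesis by blast
qed

lemma deriv_const_on_open:
  fixes g :: "'a::euclidean_space \<Rightarrow> real"
  assumes "(g has_derivative g') (at y)" "open U" "y \<in> U" "\<And>z. z \<in> U \<Longrightarrow> g z = c"
  shows "g' u = 0"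
proof -
  have "((\<lambda>_. c) has_derivative g') (at y)"
    by (rule has_derivative_transform_within_open[OF assms(1-4)])
  then show ?thesis using has_derivative_unique[OF _ has_derivative_const] by metis
qed

section \<open>Frame fields along an immersion\<close>

context
  fixes U :: "(real^4) set" and F :: "real^4 \<Rightarrow> ('v, 'r) frame"
  assumes U: "open U" and F: "smooth_on U F"
begin

abbreviation "dF y \<equiv> fderiv F y"

lemma F_derivatives:
  assumes "y \<in> U"
  shows "fderiv (\<lambda>z. pt (F z)) y u = pt (dF y u)"
    "fderiv (\<lambda>z. ee (F z) $ i) y u = ee (dF y u) $ i"
    "((\<lambda>z. ee (F z) $ i) has_derivative (\<lambda>u. ee (dF y u) $ i)) (at y)"
    "((\<lambda>z. nu (F z) $ k) has_derivative (\<lambda>u. nu (dF y u) $ k)) (at y)"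
    "linear (dF y)"
proof -
  note d = smooth_on_has_derivative[OF F assms]
  have bl: "bounded_linear (\<lambda>v :: ('v, 'r) frame. pt v)" "bounded_linear (\<lambda>v :: ('v, 'r) frame. ee v $ i)"
    "bounded_linear (\<lambda>v :: ('v, 'r) frame. nu v $ k)" for i k
    by (simp_all add: linear_components linear_conv_bounded_linear[symmetric])
  show "fderiv (\<lambda>z. pt (F z)) y u = pt (dF y u)"
    by (rule frechet_derivative_apply[OF bounded_linear.has_derivative[OF bl(1) d]])
  show e: "((\<lambda>z. ee (F z) $ i) has_derivative (\<lambda>u. ee (dF y u) $ i)) (at y)" for i
    by (rule bounded_linear.has_derivative[OF bl(2) d])
  show "((\<lambda>z. nu (F z) $ k) has_derivative (\<lambda>u. nu (dF y u) $ k)) (at y)"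
    by (rule bounded_linear.has_derivative[OF bl(3) d])
  show "fderiv (\<lambda>z. ee (F z) $ i) y u = ee (dF y u) $ i"
    by (rule frechet_derivative_apply[OF e])
  show "linear (dF y)" by (rule has_derivative_linear[OF d])
qed

lemma F_components_smooth: "smooth_on U (\<lambda>z. pt (F z))" "smooth_on U (\<lambda>z. ee (F z))"
  by (intro smooth_on_fst smooth_on_snd U F)+

text \<open>For tangent frame fields the second fundamental form is the normal part of the
  derivative, and \<open>eta\<close> gives precisely its components in the normals.\<close>

lemma II_frame:
  assumes imm: "immersion_on U (\<lambda>z. pt (F z))" and y: "y \<in> U"
    and fb: "\<And>z. z \<in> U \<Longrightarrow> F z \<in> FB" and e: "\<And>z i. z \<in> U \<Longrightarrow> ee (F z) $ i \<in> TM (\<lambda>z. pt (F z)) z"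
  shows "II (\<lambda>z. pt (F z)) y (pt (dF y u)) (ee (F y) $ i) = (\<Sum>l\<in>UNIV. eta l i (F y) (dF y u) *\<^sub>R nu (F y) $ l)"
proof -
  have on: "orthonormal4 (ee (F z))" if "z \<in> U" for z using fb[OF that] by (simp add: frame_bundle_def)
  show ?thesis
    using II_moving_frame[OF imm U y order_refl F_components_smooth(2) on e, of u i]
    by (simp add: F_derivatives(1,2)[OF y] frame_normal_part[OF fb[OF y]])
qed

text \<open>Vanishing of \<open>theta\<close> means \<open>dp = e\<^sub>i \<omega>\<^sup>i\<close>;
  with the independence condition the \<open>e\<^sub>i\<close> are tangent and dual to
  \<open>omega\<close>. The \<open>eta\<close> generators then identify the second fundamental form
  as \<open>Qm (nus (F y))\<close>.\<close>

lemma integral_manifold_austere: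
  assumes im: "integral_manifold Loc gen omega U F"
  shows "austere_A_max U (\<lambda>x. pt (F x)) \<and> adapted_frame_on num U F"
proof -
  let ?f = "\<lambda>z. pt (F z)"
  have loc: "F y \<in> Loc" if "y \<in> U" for y using im that by (auto simp: integral_manifold_def)
  have fb: "F y \<in> FB" if "y \<in> U" for y using loc[OF that] by (simp add: locus_iff)
  have xb: "F y \<in> bases" if "y \<in> U" for y using frame_bundle_bases[OF fb[OF that]] .
  have on: "orthonormal4 (ee (F y))" if "y \<in> U" for y using fb[OF that] by (simp add: frame_bundle_def)
  have "\<forall>g. gen g (F y) (dF y u) = 0" if "y \<in> U" for y u
    using im that by (simp add: integral_manifold_def)
  then have th: "theta k (F y) (dF y u) = 0" and et: "eta k i (F y) (dF y u) = (\<Sum>j\<in>UNIV. Shat (num k) $ i $ j * omega j (F y) (dF y u))"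
    if "y \<in> U" for y u k i using that unfolding generators_zero_iff by blast+
  have lw: "linear (\<lambda>u. \<chi> j. omega j (F y) (dF y u))" if "y \<in> U" for y
    by (rule linearI) (simp_all add: vec_eq_iff linear_add[OF F_derivatives(5)[OF that]] linear_scale[OF F_derivatives(5)[OF that]]
        linear_add[OF linear_forms(1)[OF xb[OF that]]] linear_scale[OF linear_forms(1)[OF xb[OF that]]])
  \<comment> \<open>Independence of the four forms is surjectivity of their joint map: a nonzero
    vector orthogonal to the range would be the coefficient vector of a relation.\<close>
  have sj: "surj (\<lambda>u. \<chi> j. omega j (F y) (dF y u))" if y: "y \<in> U" for y
  proof (rule ccontr)
    let ?g = "\<lambda>u. \<chi> j. omega j (F y) (dF y u)"
    assume "\<not> surj ?g"
    then have "dim (range ?g) \<noteq> DIM(real^4)"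
      using dim_eq_full[of "range ?g"] linear_subspace_image[OF lw[OF y] subspace_UNIV] by (simp add: span_eq_iff[THEN iffD2])
    then have "dim (range ?g) < DIM(real^4)" using dim_subset_UNIV[of "range ?g"] by linarith
    then obtain z where z: "z \<noteq> 0" "\<And>v. v \<in> span (range ?g) \<Longrightarrow> orthogonal z v"
      using orthogonal_to_subspace_exists by blast
    have "(\<Sum>i\<in>UNIV. z $ i * omega i (F y) (dF y u)) = 0" for u
      using z(2)[OF span_base[of "?g u"]] by (simp add: orthogonal_def inner_vec_def)
    then have "\<forall>i. z $ i = 0" using im y unfolding integral_manifold_def by blast
    then show False using z(1) by (simp add: vec_eq_iff)
  qed
  have inj: "inj (\<lambda>u. \<chi> j. omega j (F y) (dF y u))" if "y \<in> U" for y
    by (rule linear_surjective_imp_injective[OF lw[OF that] sj[OF that]]) simp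
  have D: "fderiv ?f y u = (\<Sum>j\<in>UNIV. omega j (F y) (dF y u) *\<^sub>R ee (F y) $ j)" if "y \<in> U" for y u
    using frame_expand(1)[OF xb[OF that], of "dF y u"] by (simp add: F_derivatives(1)[OF that] th[OF that])
  have imm: "immersion_on U ?f"
    unfolding immersion_on_def
  proof (intro conjI ballI U F_components_smooth(1) injI)
    fix y u w assume y: "y \<in> U" and eq: "fderiv ?f y u = fderiv ?f y w"
    have "omega i (F y) (dF y v) = fderiv ?f y v \<bullet> ee (F y) $ i" for v i
      by (simp add: F_derivatives(1)[OF y] frame_inner(2)[OF fb[OF y]])
    then have "omega i (F y) (dF y u) = omega i (F y) (dF y w)" for i by (simp add: eq)
    then show "u = w" using injD[OF inj[OF y]] by (simp add: vec_eq_iff)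
  qed
  have uj: "\<exists>u. \<forall>i. omega i (F y) (dF y u) = (if i = j then 1 else 0)" if y: "y \<in> U" for y j
  proof -
    obtain u where "(\<chi> i. omega i (F y) (dF y u)) = (\<chi> i. if i = j then 1 else 0)"
      using surjD[OF sj[OF y]] by metis
    then have "\<forall>i. omega i (F y) (dF y u) = (if i = j then 1 else 0)" by (simp add: vec_eq_iff)
    then show ?thesis by blast
  qed
  have De: "fderiv ?f y u = ee (F y) $ j" if "y \<in> U" "\<forall>i. omega i (F y) (dF y u) = (if i = j then 1 else 0)" for y u j
    unfolding D[OF that(1)] by (simp add: that(2) if_distrib[of "\<lambda>c. c *\<^sub>R _"] cong: if_cong)
  have eT: "ee (F y) $ j \<in> TM ?f y" if y: "y \<in> U" for y j
  proof -
    obtain u where u: "\<forall>i. omega i (F y) (dF y u) = (if i = j then 1 else 0)" using uj[OF y] by blast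
    show ?thesis unfolding TM_def by (rule range_eqI[where x = u]) (rule De[OF y u, symmetric])
  qed
  have II: "II ?f y (ee (F y) $ i) (ee (F y) $ j) = Qm (nus (F y)) i j" if y: "y \<in> U" for y i j
  proof -
    obtain u where u: "\<forall>l. omega l (F y) (dF y u) = (if l = i then 1 else 0)" using uj[OF y] by blast
    have "pt (dF y u) = ee (F y) $ i" using De[OF y u] by (simp add: F_derivatives(1)[OF y])
    then have "II ?f y (ee (F y) $ i) (ee (F y) $ j) = hh (F y) (dF y u) j"
      using II_frame[OF imm y fb eT, of u j] eta_hh[OF et[OF y]] by simp
    also have "\<dots> = Qm (nus (F y)) j i" by (rule hh_axis) (simp add: u)
    finally show ?thesis by (simp add: Qm_sym)
  qed
  have ad: "adapted_frame_on num U F"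
    unfolding adapted_frame_on_def using U F fb eT II by (simp add: Qm_def)
  have nII: "n \<bullet> II ?f y (ee (F y) $ i) (ee (F y) $ j) = Qm (\<lambda>a. n \<bullet> nus (F y) a) i j" if "y \<in> U" for y n i j
    by (simp add: II[OF that] inner_Qm)
  have aus: "austere_on U ?f"
    unfolding austere_on_def
  proof (intro ballI allI)
    fix y n lam assume y: "y \<in> U"
    show "eig_mult ?f y n lam = eig_mult ?f y n (- lam)"
      using austere_of_QA[OF imm y on[OF y] eT[OF y] nII[OF y], where lam = lam] austere_of_QA[OF imm y on[OF y] eT[OF y] nII[OF y], where lam = "- lam"]
      by (simp add: le_antisym)
  qed
  have tA: "type_A_on U ?f"
    unfolding type_A_on_def
  proof
    fix y assume "y \<in> U"
    have "II_space ?f z (ee (F z)) \<subseteq> QA" if "z \<in> U" for z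
      unfolding II_space_def using nII[OF that] by (auto simp: QA_iff)
    then show "\<exists>V (e :: real^4 \<Rightarrow> 'v^4). open V \<and> y \<in> V \<and> V \<subseteq> U \<and> smooth_on V e \<and>
       (\<forall>x\<in>V. orthonormal4 (e x) \<and> (\<forall>i. e x $ i \<in> TM ?f x) \<and> II_space ?f x (e x) \<subseteq> QA)"
      using U \<open>y \<in> U\<close> F_components_smooth(2) on eT by (intro exI[of _ U] exI[of _ "\<lambda>z. ee (F z)"]) auto
  qed
  have fn: "dim (first_normal ?f y) = 6" if y: "y \<in> U" for y
    using first_normal_eq[OF imm y on[OF y] eT[OF y] II[OF y]] dim_span_nus[OF xb[OF y]] by simp
  show ?thesis using imm aus tA fn ad by (simp add: austere_A_max_def)
qed

text \<open>The frame gives the vanishing of \<open>theta\<close> and of the \<open>eta\<close>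
  generators directly. Exterior derivatives of vanishing pullbacks vanish: for \<open>eta\<close>
  this is the Codazzi equation, which forces \<open>psi0\<close>, and for the connection generators
  the Gauss equation, which places \<open>F\<close> in the locus.\<close>

lemma austere_integral_manifold:
  assumes imm: "immersion_on U (\<lambda>x. pt (F x))" and af: "adapted_frame_on num U F"
  shows "integral_manifold Loc gen omega U F"
proof -
  let ?f = "\<lambda>z. pt (F z)"
  have fb: "F y \<in> FB" and eT: "ee (F y) $ i \<in> TM ?f y"
    and II: "II ?f y (ee (F y) $ i) (ee (F y) $ j) = Qm (nus (F y)) i j" if "y \<in> U" for y i j
    using af that by (auto simp: adapted_frame_on_def Qm_def)
  have xb: "F y \<in> bases" if "y \<in> U" for y using frame_bundle_bases[OF fb[OF that]] .
  have on: "orthonormal4 (ee (F y))" if "y \<in> U" for y using fb[OF that] by (simp add: frame_bundle_def)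
  have pT: "pt (dF y u) \<in> TM ?f y" if "y \<in> U" for y u
    unfolding TM_def by (rule range_eqI[where x = u]) (rule F_derivatives(1)[OF that, symmetric])
  have P: "pt (dF y u) = (\<Sum>j\<in>UNIV. omega j (F y) (dF y u) *\<^sub>R ee (F y) $ j)" if y: "y \<in> U" for y u
    using TM_expand[OF imm y on[OF y] eT[OF y] pT[OF y]] by (simp add: frame_inner(2)[OF fb[OF y]])
  have th: "theta k (F y) (dF y u) = 0" if y: "y \<in> U" for y u k
  proof -
    have "(\<Sum>l\<in>UNIV. theta l (F y) (dF y u) *\<^sub>R nu (F y) $ l) = (\<Sum>l\<in>UNIV. 0 *\<^sub>R nu (F y) $ l)"
      using P[OF y, of u] frame_expand(1)[OF xb[OF y], of "dF y u"] by simp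
    then show ?thesis by (rule nu_independent[OF xb[OF y]])
  qed
  have IIu: "II ?f y (pt (dF y u)) (ee (F y) $ i) = hh (F y) (dF y u) i" if y: "y \<in> U" for y u i
    unfolding II_expand[OF imm y on[OF y] eT[OF y] pT[OF y] eT[OF y]] II[OF y] frame_inner(2)[OF fb[OF y]]
    by (simp add: hh_def orthonormal4D[OF on[OF y]] if_distrib[of "\<lambda>c. _ * c"] if_distrib[of "\<lambda>c. c *\<^sub>R _"] Qm_sym[of _ i] cong: if_cong)
  have et: "eta k i (F y) (dF y u) = (\<Sum>j\<in>UNIV. Shat (num k) $ i $ j * omega j (F y) (dF y u))" if y: "y \<in> U" for y u k i
  proof -
    have "(\<Sum>l\<in>UNIV. eta l i (F y) (dF y u) *\<^sub>R nu (F y) $ l) = hh (F y) (dF y u) i"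
      using II_frame[OF imm y fb eT] IIu[OF y] by simp
    also have "\<dots> = (\<Sum>l\<in>UNIV. (\<Sum>j\<in>UNIV. Shat (num l) $ i $ j * omega j (F y) (dF y u)) *\<^sub>R nu (F y) $ l)"
      by (rule hh_alt)
    finally show ?thesis by (rule nu_independent[OF xb[OF y]])
  qed
  have ad: "adapt (F y) (dF y u)" if y: "y \<in> U" for y u
  proof -
    note fbD = frame_bundleD[OF fb]
    have "ee (F y) $ i \<bullet> ee (dF y u) $ j + ee (dF y u) $ i \<bullet> ee (F y) $ j = 0" for i j
      by (rule deriv_const_on_open[OF has_derivative_inner[OF F_derivatives(3)[OF y] F_derivatives(3)[OF y]] U y fbD(1)])
    then have 1: "phi j i (F y) (dF y u) = - phi i j (F y) (dF y u)" for i j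
      using frame_inner(1)[OF fb[OF y], of "dF y u"] by (metis add_eq_0_iff inner_commute)
    have "ee (F y) $ i \<bullet> nu (dF y u) $ k + ee (dF y u) $ i \<bullet> nu (F y) $ k = 0" for i k
      by (rule deriv_const_on_open[OF has_derivative_inner[OF F_derivatives(3)[OF y] F_derivatives(4)[OF y]] U y fbD(2)])
    then have 2: "zeta i k (F y) (dF y u) = - (\<Sum>l\<in>UNIV. eta l i (F y) (dF y u) *\<^sub>R nu (F y) $ l) \<bullet> nu (F y) $ k" for i k
      unfolding frame_inner(3,4)[OF fb[OF y]] inner_minus_left by (simp add: eq_neg_iff_add_eq_0)
    show ?thesis unfolding adapt_def using 1 2 th[OF y] et[OF y] by blast
  qed
  have uj: "\<exists>u. \<forall>i. omega i (F y) (dF y u) = (if i = j then 1 else 0)" if y: "y \<in> U" for y j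
  proof -
    obtain u where "ee (F y) $ j = fderiv ?f y u" using eT[OF y, of j] by (auto simp: TM_def)
    then have "\<forall>i. omega i (F y) (dF y u) = (if i = j then 1 else 0)"
      using frame_inner(2)[OF fb[OF y], of "dF y u"] frame_bundleD(1)[OF fb[OF y], of j]
      by (auto simp: F_derivatives(1)[OF y])
    then show ?thesis by blast
  qed
  have "\<exists>w. \<forall>j i. omega i (F y) (dF y (w j)) = (if i = j then 1 else 0)" if "y \<in> U" for y
    using uj[OF that] by metis
  then obtain w where w: "\<And>y j i. y \<in> U \<Longrightarrow> omega i (F y) (dF y (w y j)) = (if i = j then 1 else 0)" by metis
  have pull: "ext_d (gen g) (F y) (dF y u) (dF y v) = 0"
    if "\<And>z u. z \<in> U \<Longrightarrow> gen g (F z) (dF z u) = 0" "y \<in> U" for g y u v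
    by (rule ext_d_eq_0_of_pullback_eq_0[OF U that(2) F open_bases xb[OF that(2)] smooth_form_generators that(1)])
  have ps0: "psi0 (F y) (dF y (w y a))" if y: "y \<in> U" for y a
  proof (rule codazzi_imp_psi0[where w = "\<lambda>a. dF y (w y a)"])
    fix k i a b
    have "get k i (F z) (dF z u) = 0" if "z \<in> U" for z u by (simp add: generators_def et[OF that])
    from pull[OF this y, of "w y a" "w y b"]
    show "codazzi (F y) k i (dF y (w y a)) (dF y (w y b)) = codazzi (F y) k i (dF y (w y b)) (dF y (w y a))"
      unfolding ext_d_eta[OF xb[OF y] ad[OF y] ad[OF y]] by simp
  qed (use ad[OF y] w[OF y] in auto)
  \<comment> \<open>The Codazzi argument covers the directions dual to \<open>omega\<close>; these
    form a basis, and linearity of \<open>phi\<close> gives the rest.\<close>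
  have ps: "psi0 (F y) (dF y u)" if y: "y \<in> U" for y u
  proof -
    let ?o = "\<lambda>j. omega j (F y) (dF y u)"
    note ld = F_derivatives(5)[OF y] and lf = linear_forms[OF xb[OF y]]
    have e: "fderiv ?f y (\<Sum>j\<in>UNIV. ?o j *\<^sub>R w y j) = fderiv ?f y u"
    proof -
      have "omega i (F y) (dF y (\<Sum>j\<in>UNIV. ?o j *\<^sub>R w y j)) = ?o i" for i
        by (simp add: linear_sum[OF ld] linear_scale[OF ld] linear_sum[OF lf(1)] linear_scale[OF lf(1)] w[OF y] if_distrib[of "\<lambda>c. _ * c"] cong: if_cong)
      then show ?thesis unfolding F_derivatives(1)[OF y] P[OF y] by simp
    qed
    have u: "u = (\<Sum>j\<in>UNIV. ?o j *\<^sub>R w y j)" by (rule injD[OF immD(3)[OF imm y] e[symmetric]])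
    have "phi i j (F y) (dF y u) = (\<Sum>l\<in>UNIV. ?o l * phi i j (F y) (dF y (w y l)))" for i j
      by (subst u) (simp add: linear_sum[OF ld] linear_scale[OF ld] linear_sum[OF lf(3)] linear_scale[OF lf(3)])
    then show ?thesis unfolding psi0_def using ps0[OF y, unfolded psi0_def] by simp
  qed
  have gen0: "\<forall>g. gen g (F y) (dF y u) = 0" if "y \<in> U" for y u
    unfolding generators_zero_iff using th[OF that] ps[OF that] et[OF that] by blast
  have loc: "F y \<in> Loc" if y: "y \<in> U" for y
  proof -
    have g: "ext_d (gps 1) (F y) (dF y u) (dF y v) = 0" for u v using gen0 by (intro pull y) blast
    have h: "hh (F y) (dF y (w y j)) i = Qm (nus (F y)) i j" for i j by (rule hh_axis) (simp add: w[OF y])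
    note g' = g[unfolded ext_d_psi(1)[OF xb[OF y] ad[OF y] ps[OF y] ad[OF y] ps[OF y]]]
    \<comment> \<open>On the directions 1, 2 and on 1, 4 the Gauss expression is, up to a constant
      factor, the first and the second Gram relation.\<close>
    show ?thesis
      using g'[of "w y 1" "w y 2"] g'[of "w y 1" "w y 4"] fb[OF y]
      unfolding h locus_iff by (simp add: pol1_def pol2_def inner_commute)
  qed
  show ?thesis
    unfolding integral_manifold_def
  proof (intro conjI ballI allI impI U F)
    show "F ` U \<subseteq> Loc" using loc by blast
    show "gen g (F y) (dF y u) = 0" if "y \<in> U" for y u g using gen0[OF that] by blast
    show "b i = 0" if "y \<in> U" and b: "\<forall>u. (\<Sum>i\<in>UNIV. b i * omega i (F y) (dF y u)) = 0" for y b i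
      using b[rule_format, of "w y i"] by (simp add: w[OF that(1)] if_distrib[of "\<lambda>c. _ * c"] cong: if_cong)
  qed
qed

end

end

section \<open>Existence of frames\<close>

context frame_dim
begin

text \<open>An orthonormal frame lies in the locus: the squared norms of
  \<open>\<nu>\<^sub>2\<close> and \<open>\<nu>\<^sub>5\<close> cancel in the first relation, and
  all other products are zero.\<close>

lemma locus_nonempty: "Loc \<noteq> {}"
proof -
  have "card (UNIV :: (4 + 'r) set) = card (Basis :: 'v set)"
    using dim by simp
  then obtain h where h: "bij_betw h (UNIV :: (4 + 'r) set) (Basis :: 'v set)"
    by (metis finite_same_card_bij finite finite_Basis)
  have i: "h s \<bullet> h t = (if s = t then 1 else 0)" for s t
  proof -
    have "h s \<in> Basis" "h t \<in> Basis" "h s = h t \<longleftrightarrow> s = t"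
      using h by (auto simp: bij_betw_def inj_on_eq_iff)
    then show ?thesis by (simp add: inner_Basis)
  qed
  define x :: "('v, 'r) frame" where "x = (0, \<chi> i. h (Inl i), \<chi> k. h (Inr k))"
  have x: "ee x $ i = h (Inl i)" "nu x $ k = h (Inr k)" for i k by (simp_all add: x_def)
  have "frame_map x c \<bullet> ee x $ i = fst c $ i" "frame_map x c \<bullet> nu x $ k = snd c $ k" for c i k
    by (simp_all add: frame_map_def inner_add_left inner_sum_left x i if_distrib cong: if_cong)
  then have "inj (frame_map x)" by (metis (no_types, lifting) injI prod_eq_iff vec_eq_iff)
  then have "x \<in> FB"
    by (auto simp: frame_bundle_def bij_frame_map_iff_inj orthonormal4_def x i)
  moreover have "nus x a \<bullet> nus x b = (if a = b then 1 else 0)" if "a \<in> {1..6}" "b \<in> {1..6}" for a b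
  proof -
    have "inv num a = inv num b \<longleftrightarrow> a = b" using num6[OF that(1)] num6[OF that(2)] by metis
    then show ?thesis by (simp add: nus_def x i)
  qed
  then have "pol1 (nus x) (nus x) = 0" "pol2 (nus x) (nus x) = 0" by (simp_all add: pol1_def pol2_def)
  ultimately show ?thesis using locus_iff by blast
qed

lemma smooth_derivative_along:
  fixes g :: "'a::euclidean_space \<Rightarrow> 'b::euclidean_space"
  assumes "open V" "smooth_on V g" "smooth_on V u"
  shows "smooth_on V (\<lambda>z. fderiv g z (u z))"
proof (rule smooth_on_cong[OF assms(1)])
  show "smooth_on V (\<lambda>z. \<Sum>b\<in>Basis. (u z \<bullet> b) *\<^sub>R fderiv g z b)"
    by (intro smooth_on_sum smooth_on_scaleR smooth_on_inner smooth_on_derivative smooth_on_const assms)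
  show "(\<Sum>b\<in>Basis. (u z \<bullet> b) *\<^sub>R fderiv g z b) = fderiv g z (u z)" if "z \<in> V" for z
    by (rule linear_expand_Basis[OF has_derivative_linear[OF smooth_on_has_derivative[OF assms(2) that]], symmetric])
qed

text \<open>The preimages of the frame vectors under the differential have to vary smoothly. In the
  frame the differential becomes a family \<open>T\<close> of isomorphisms of
  \<open>\<real>\<^sup>4\<close>, to which smooth inversion applies, and
  \<open>II_moving_frame\<close> then uses smooth operations only.\<close>

lemma II_smooth:
  fixes f :: "real^4 \<Rightarrow> 'v"
  assumes imm: "immersion_on U f" and V: "open V" "V \<subseteq> U" and e: "smooth_on V e"
    "\<And>z. z \<in> V \<Longrightarrow> orthonormal4 (e z)" "\<And>z i. z \<in> V \<Longrightarrow> e z $ i \<in> TM f z"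
  shows "smooth_on V (\<lambda>z. II f z (e z $ i) (e z $ j))"
proof -
  let ?D = "\<lambda>z. fderiv f z"
  define T where "T z c = (\<chi> i. ?D z c \<bullet> e z $ i)" for z and c :: "real^4"
  have zU: "z \<in> U" if "z \<in> V" for z using V that by blast
  have f: "smooth_on V f" using smooth_on_subset[OF immD(2)[OF imm] V(2)] .
  have ex: "?D z c = (\<Sum>i\<in>UNIV. T z c $ i *\<^sub>R e z $ i)" if "z \<in> V" for z c
    unfolding T_def using TM_expand[OF imm zU[OF that] e(2,3)[OF that], of "?D z c"] by (simp add: TM_def)
  have lin: "linear (T z)" if "z \<in> V" for z
    unfolding T_def by (rule linearI)
      (simp_all add: vec_eq_iff linear_add[OF immD(4)[OF imm zU[OF that]]] linear_scale[OF immD(4)[OF imm zU[OF that]]] inner_add_left)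
  have inj: "inj (T z)" if "z \<in> V" for z
  proof (rule injI)
    fix c c' assume "T z c = T z c'"
    then have "?D z c = ?D z c'" using ex[OF that] by simp
    then show "c = c'" by (rule injD[OF immD(3)[OF imm zU[OF that]]])
  qed
  have bij: "bij (T z)" if "z \<in> V" for z
    using inj[OF that] linear_injective_imp_surjective[OF lin[OF that] inj[OF that]] by (simp add: bij_def)
  have Ts: "smooth_on V (\<lambda>z. T z c)" for c
    unfolding T_def by (intro smooth_on_vec_lambda smooth_on_inner smooth_on_derivative smooth_on_nth f e V)
  have u: "smooth_on V (\<lambda>z. inv (T z) w)" for w
    by (rule inv_family_smooth[OF V(1) lin bij Ts])
  let ?d = "\<lambda>z. fderiv (\<lambda>z. e z $ j) z (inv (T z) (axis i 1))"
  have d: "smooth_on V ?d" by (intro smooth_derivative_along smooth_on_nth u e V)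
  show ?thesis
  proof (rule smooth_on_cong[OF V(1)])
    show "smooth_on V (\<lambda>z. ?d z - tproj (e z) (?d z))"
      unfolding tproj_def
      by (intro smooth_on_diff smooth_on_sum smooth_on_scaleR smooth_on_inner smooth_on_nth d e V)
    fix z assume z: "z \<in> V"
    have "?D z (inv (T z) (axis i 1)) = e z $ i"
      unfolding ex[OF z] linear_bij_inv(1)[OF lin[OF z] bij[OF z]]
      by (simp add: axis_def if_distrib[of "\<lambda>c. c *\<^sub>R _"] cong: if_cong)
    then show "?d z - tproj (e z) (?d z) = II f z (e z $ i) (e z $ j)"
      using II_moving_frame[OF imm V(1) z V(2) e, of "inv (T z) (axis i 1)" j] by simp
  qed
qed

text \<open>\<open>QA\<close> constrains only the real forms \<open>n \<bullet> II\<close> with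
  \<open>n\<close> normal. The defect \<open>d\<close> of the vector identity is itself normal, and
  the form \<open>d \<bullet> II\<close> has the coefficients \<open>d \<bullet> N a\<close>; hence
  \<open>d\<close> has the same inner product with both sides, so
  \<open>d \<bullet> d = 0\<close>.\<close>

lemma QA_normal_vectors:
  fixes f :: "real^4 \<Rightarrow> 'v"
  assumes imm: "immersion_on U f" and z: "z \<in> U" and e: "orthonormal4 e" "\<And>i. e $ i \<in> TM f z" and QA: "II_space f z e \<subseteq> QA"
  defines "N \<equiv> sel6 (II f z (e $ 1) (e $ 1), II f z (e $ 1) (e $ 2), II f z (e $ 2) (e $ 2),
    II f z (e $ 1) (e $ 3), II f z (e $ 1) (e $ 4), II f z (e $ 2) (e $ 4))"
  shows "II f z (e $ i) (e $ j) = Qm N i j" "dim (first_normal f z) = dim (N ` {1..6})" "a \<in> {1..6} \<Longrightarrow> N a \<bullet> e $ i = 0"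
proof -
  have NM: "II f z X Y \<bullet> e $ i = 0" for X Y i using II_NM[OF imm z e] NM_iff[OF imm z e] by blast
  show N0: "N a \<bullet> e $ i = 0" if "a \<in> {1..6}" for a i
    using that NM unfolding atLeast1AtMost6_iff N_def by auto
  show II: "II f z (e $ i) (e $ j) = Qm N i j" for i j
  proof -
    define d where "d = II f z (e $ i) (e $ j) - Qm N i j"
    have "d \<bullet> e $ k = 0" for k
      using NM N0 by (simp add: d_def inner_diff_left Qm_def inner_sum_left)
    then have "d \<in> NM f z" by (simp add: NM_iff[OF imm z e])
    then have "(\<chi> i j. d \<bullet> II f z (e $ i) (e $ j)) \<in> QA" using QA unfolding II_space_def by blast
    then obtain s where s: "d \<bullet> II f z (e $ i) (e $ j) = Qm s i j" for i j unfolding QA_iff by auto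
    have "d \<bullet> N a = s a" if "a \<in> {1..6}" for a
      using that s[of 1 1] s[of 1 2] s[of 2 2] s[of 1 3] s[of 1 4] s[of 2 4] unfolding atLeast1AtMost6_iff N_def by auto
    then have "Qm (\<lambda>a. d \<bullet> N a) i j = Qm s i j" by (rule Qm_cong)
    then have "d \<bullet> d = 0" by (subst (2) d_def) (simp add: inner_diff_right inner_Qm s)
    then show ?thesis by (simp add: d_def)
  qed
  show "dim (first_normal f z) = dim (N ` {1..6})"
    using first_normal_eq[OF imm z e II] by simp
qed

lemma independent_family:
  fixes N :: "nat \<Rightarrow> 'v"
  assumes "dim (N ` {1..6}) = 6" "(\<Sum>a=1..6. c a *\<^sub>R N a) = 0" "a \<in> {1..6}"
  shows "c a = 0"
proof -
  have "card (N ` {1..6}) \<le> 6" using card_image_le[of "{1..6::nat}" N] by simp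
  then have ind: "independent (N ` {1..6})"
    by (intro card_le_dim_spanning[of _ "N ` {1..6}"]) (auto simp: assms(1) span_base)
  then have "card (N ` {1..6}) = card {1..6::nat}" using dim_eq_card_independent[OF ind] assms(1) by simp
  then have inj: "inj_on N {1..6}" by (rule eq_card_imp_inj_on[rotated]) simp
  have "(\<Sum>v\<in>N ` {1..6}. c (inv_into {1..6} N v) *\<^sub>R v) = (\<Sum>a=1..6. c a *\<^sub>R N a)"
    by (subst sum.reindex[OF inj]) (simp add: inv_into_f_f[OF inj])
  then have "c (inv_into {1..6} N (N a)) = 0"
    using independentD[OF ind, of "N ` {1..6}" "\<lambda>v. c (inv_into {1..6} N v)" "N a"] assms(2,3) by simp
  then show ?thesis by (simp add: inv_into_f_f[OF inj assms(3)])
qed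

lemma sum_low:
  fixes g :: "nat \<Rightarrow> 'r \<Rightarrow> 'b::real_vector"
  shows "(\<Sum>k\<in>UNIV. if num k \<le> 6 then g (num k) k else 0) = (\<Sum>a=1..6. g a (inv num a))"
proof -
  have "(\<Sum>k\<in>UNIV. if num k \<le> 6 then g (num k) k else 0) = (\<Sum>a\<in>{1..CARD('r)}. if a \<le> 6 then g a (inv num a) else 0)"
    by (rule sum.reindex_bij_betw[OF num, symmetric, of "\<lambda>a. if a \<le> 6 then g a (inv num a) else 0", unfolded num_inv(2), symmetric])
  also have "\<dots> = (\<Sum>a=1..6. if a \<le> 6 then g a (inv num a) else 0)"
    by (rule sum.mono_neutral_right) (use r6 in auto)
  finally show ?thesis by simp
qed

text \<open>At most ten vectors leave an orthogonal complement of dimension at least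
  \<open>CARD('r) - 6\<close>. The remaining members are taken orthonormal there, so pairing with
  them isolates their coefficients.\<close>

lemma basis_extension:
  fixes e :: "'v^4" and N :: "nat \<Rightarrow> 'v"
  assumes e: "orthonormal4 e" and N: "\<And>a i. a \<in> {1..6} \<Longrightarrow> N a \<bullet> e $ i = 0" "dim (N ` {1..6}) = 6"
  shows "\<exists>w. (0, e, \<chi> k. if num k \<le> 6 then N (num k) else w k) \<in> (bases :: ('v, 'r) frame set)"
proof -
  let ?S = "range (\<lambda>i. e $ i) \<union> N ` {1..6}"
  have dS: "dim ?S \<le> 10"
  proof -
    have "card ?S \<le> card (range (\<lambda>i. e $ i)) + card (N ` {1..6})" by (rule card_Un_le)
    also have "\<dots> \<le> 4 + 6"
      using card_image_le[of "UNIV :: 4 set" "\<lambda>i. e $ i"] card_image_le[of "{1..6::nat}" N] by simp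
    finally show ?thesis using dim_le_card[of ?S "?S"] span_superset[of ?S] by simp
  qed
  let ?P = "{y. \<forall>x\<in>?S. orthogonal x y}"
  have P: "subspace ?P" by (rule subspace_orthogonal_to_vectors)
  have "dim {y \<in> UNIV. \<forall>x\<in>span ?S. orthogonal x y} + dim (span ?S) = DIM('v)"
    using dim_subspace_orthogonal_to_vectors[OF subspace_span subspace_UNIV, of ?S] by simp
  moreover have "{y \<in> UNIV. \<forall>x\<in>span ?S. orthogonal x y} \<subseteq> ?P"
  proof (intro subsetI CollectI ballI)
    fix y z assume "y \<in> {y \<in> UNIV. \<forall>x\<in>span ?S. orthogonal x y}" "z \<in> ?S"
    then show "orthogonal z y" using span_base[of z ?S] by simp
  qed
  ultimately have dP: "DIM('v) \<le> dim ?P + dim ?S"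
    using dim_subset[of "{y \<in> UNIV. \<forall>x\<in>span ?S. orthogonal x y}" ?P] by simp
  obtain B where B: "B \<subseteq> ?P" "pairwise orthogonal B" "\<forall>x\<in>B. norm x = 1" "independent B" "card B = dim ?P"
    by (rule orthonormal_basis_subspace[OF P]) blast
  have "card {k. 6 < num k} \<le> card B"
  proof -
    have "card {k. 6 < num k} = card (num ` {k. 6 < num k})"
      using num by (intro card_image[symmetric]) (auto simp: bij_betw_def inj_on_def)
    also have "\<dots> \<le> card {7..CARD('r)}" using num_range by (intro card_mono) auto
    finally show ?thesis using B(5) dP dS dim by simp
  qed
  moreover have "finite B" using B(4) independent_imp_finite by blast
  ultimately obtain w where w: "w ` {k. 6 < num k} \<subseteq> B" "inj_on w {k. 6 < num k}"
    using card_le_inj[of "{k. 6 < num k}" B] by auto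
  define x :: "('v, 'r) frame" where "x = (0, e, \<chi> k. if num k \<le> 6 then N (num k) else w k)"
  have we: "w k \<bullet> e $ i = 0" and wN: "a \<in> {1..6} \<Longrightarrow> w k \<bullet> N a = 0" if "6 < num k" for k i a
  proof -
    have "\<forall>x\<in>?S. orthogonal x (w k)" using w(1) B(1) that by blast
    then have "orthogonal (e $ i) (w k)" "a \<in> {1..6} \<Longrightarrow> orthogonal (N a) (w k)" by blast+
    then show "w k \<bullet> e $ i = 0" "a \<in> {1..6} \<Longrightarrow> w k \<bullet> N a = 0"
      by (simp_all add: orthogonal_def inner_commute[of "w k"])
  qed
  have ww: "w k \<bullet> w l = (if k = l then 1 else 0)" if "6 < num k" "6 < num l" for k l
  proof (cases "k = l")
    case True
    then show ?thesis using B(3)[rule_format, of "w k"] w(1) that(1) by (auto simp: norm_eq_1)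
  next
    case False
    then have "w k \<noteq> w l" using w(2) that by (auto simp: inj_on_def)
    then show ?thesis using B(2) w(1) that False by (auto simp: pairwise_def orthogonal_def)
  qed
  have nux: "nu x $ k = (if num k \<le> 6 then N (num k) else w k)" and ex: "ee x $ i = e $ i" for k i
    by (simp_all add: x_def)
  have num6': "num k \<in> {1..6}" if "num k \<le> 6" for k using num_range(1)[of k] that by simp
  have "c = 0" if c: "frame_map x c = 0" for c
  proof -
    have "frame_map x c \<bullet> e $ i = fst c $ i" for i
    proof -
      have "nu x $ k \<bullet> e $ i = 0" for k using N(1)[OF num6'] we by (simp add: nux)
      then show ?thesis by (simp add: frame_map_def inner_add_left inner_sum_left ex orthonormal4D[OF e] if_distrib cong: if_cong)
    qed
    then have 1: "fst c = 0" using c by (simp add: vec_eq_iff)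
    have "frame_map x c \<bullet> w l = snd c $ l" if l: "6 < num l" for l
    proof -
      have h: "nu x $ k \<bullet> w l = (if k = l then 1 else 0)" for k
        using wN[OF l num6'] ww[OF _ l] l by (auto simp: nux inner_commute)
      show ?thesis
        by (simp add: h we[OF l] frame_map_def inner_add_left inner_sum_left ex inner_commute[of "e $ _"] if_distrib cong: if_cong)
    qed
    then have 2: "snd c $ l = 0" if "6 < num l" for l using c that by simp
    have "frame_map x c = (\<Sum>k\<in>UNIV. if num k \<le> 6 then snd c $ k *\<^sub>R N (num k) else 0)"
      unfolding frame_map_def 1 using 2 by (auto simp: nux intro!: sum.cong)
    also have "\<dots> = (\<Sum>a=1..6. snd c $ inv num a *\<^sub>R N a)" by (rule sum_low)
    finally have "(\<Sum>a=1..6. snd c $ inv num a *\<^sub>R N a) = 0" using c by simp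
    from independent_family[OF N(2) this]
    have 3: "snd c $ l = 0" if "num l \<le> 6" for l using num6'[OF that] num_inv(2) by metis
    show ?thesis using 1 2 3 by (simp add: prod_eq_iff vec_eq_iff) (meson not_le)
  qed
  then have "inj (frame_map x)" using linear_injective_0[OF linear_frame_map[of x]] by blast
  then have "x \<in> bases" by (simp add: bases_def bij_frame_map_iff_inj)
  then show ?thesis unfolding x_def by blast
qed

text \<open>The adjoint of \<open>frame_map x\<close>; its preimages of the unit vectors form the
  dual basis of the frame.\<close>

definition coframe :: "('v, 'r) frame \<Rightarrow> 'v \<Rightarrow> (real^4) \<times> (real^'r)" where
  "coframe x w = (\<chi> i. w \<bullet> ee x $ i, \<chi> k. w \<bullet> nu x $ k)"

lemma linear_coframe: "linear (coframe x)"
  by (rule linearI) (simp_all add: coframe_def vec_eq_iff inner_add_left)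

lemma bij_coframe:
  assumes "x \<in> bases"
  shows "bij (coframe x)"
proof -
  have "w = 0" if "coframe x w = 0" for w
  proof -
    have 0: "w \<bullet> ee x $ i = 0" "w \<bullet> nu x $ k = 0" for i k
      using that by (simp_all add: coframe_def zero_prod_def vec_eq_iff)
    have "w \<bullet> frame_map x c = 0" for c by (simp add: frame_map_def inner_add_right inner_sum_right 0)
    from this[of "inv (frame_map x) w"] show ?thesis by (simp add: frame_map_inv(1)[OF assms])
  qed
  then have "inj (coframe x)" using linear_injective_0[OF linear_coframe[of x]] by blast
  moreover have "\<exists>w. coframe x w = c" for c
    using dual_vector[OF assms, of "\<lambda>i. fst c $ i" "\<lambda>k. snd c $ k"] by (auto simp: coframe_def prod_eq_iff vec_eq_iff)
  then have "surj (coframe x)" by (metis surjI surj_def)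
  ultimately show ?thesis by (simp add: bij_def)
qed

text \<open>The normals beyond the first normal space are dual basis vectors of the moving basis consisting of \<open>e\<close>,
  \<open>\<nu>\<^sub>1, \<dots>, \<nu>\<^sub>6\<close> and constant vectors: they are automatically smooth and orthogonal to \<open>e\<close> and \<open>\<nu>\<^sub>1, \<dots>, \<nu>\<^sub>6\<close>.\<close>

lemma adapted_frame_exists:
  fixes f :: "real^4 \<Rightarrow> 'v"
  assumes aus: "austere_A_max U f" and x0: "x0 \<in> U"
  shows "\<exists>V (F :: real^4 \<Rightarrow> ('v, 'r) frame). x0 \<in> V \<and> V \<subseteq> U \<and> adapted_frame_on num V F \<and> (\<forall>y\<in>V. pt (F y) = f y)"
proof -
  have imm: "immersion_on U f" and fn: "\<And>z. z \<in> U \<Longrightarrow> dim (first_normal f z) = 6" and tA: "type_A_on U f"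
    using aus by (auto simp: austere_A_max_def)
  obtain V e where V: "open V" "x0 \<in> V" "V \<subseteq> U" and es: "smooth_on V e"
    and e: "\<And>z. z \<in> V \<Longrightarrow> orthonormal4 (e z)" "\<And>z i. z \<in> V \<Longrightarrow> e z $ i \<in> TM f z" "\<And>z. z \<in> V \<Longrightarrow> II_space f z (e z) \<subseteq> QA"
    using tA x0 unfolding type_A_on_def by metis
  define N where "N z = sel6 (II f z (e z $ 1) (e z $ 1), II f z (e z $ 1) (e z $ 2), II f z (e z $ 2) (e z $ 2),
    II f z (e z $ 1) (e z $ 3), II f z (e z $ 1) (e z $ 4), II f z (e z $ 2) (e z $ 4))" for z
  have zU: "z \<in> U" if "z \<in> V" for z using V that by blast
  have II: "II f z (e z $ i) (e z $ j) = Qm (N z) i j" if "z \<in> V" for z i j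
    unfolding N_def by (rule QA_normal_vectors(1)[OF imm zU[OF that] e[OF that]])
  have dN: "dim (N z ` {1..6}) = 6" if "z \<in> V" for z
    using QA_normal_vectors(2)[OF imm zU[OF that] e[OF that]] fn[OF zU[OF that]] unfolding N_def by simp
  have Ne: "N z a \<bullet> e z $ i = 0" if "z \<in> V" "a \<in> {1..6}" for z a i
    unfolding N_def by (rule QA_normal_vectors(3)[OF imm zU[OF that(1)] e[OF that(1)] that(2)])
  have Ns: "smooth_on V (\<lambda>z. N z a)" for a
  proof -
    note s = II_smooth[OF imm V(1,3) es e(1,2)]
    show ?thesis unfolding N_def sel6_def
      by (cases "a = 1"; cases "a = 2"; cases "a = 3"; cases "a = 4"; cases "a = 5"; simp add: s)
  qed
  obtain w where w: "(0, e x0, \<chi> k. if num k \<le> 6 then N x0 (num k) else w k) \<in> (bases :: ('v, 'r) frame set)"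
    using basis_extension[OF e(1)[OF V(2)] Ne[OF V(2)] dN[OF V(2)]] by blast
  define G :: "real^4 \<Rightarrow> ('v, 'r) frame" where "G z = (0, e z, \<chi> k. if num k \<le> 6 then N z (num k) else w k)" for z
  have Gs: "smooth_on V G"
  proof -
    have "smooth_on V (\<lambda>z. if num k \<le> 6 then N z (num k) else w k)" for k
      by (cases "num k \<le> 6") (simp_all add: Ns smooth_on_const)
    then show ?thesis unfolding G_def by (intro smooth_on_Pair smooth_on_vec_lambda smooth_on_const es V)
  qed
  \<comment> \<open>Being a basis is an open condition, so the constant vectors chosen at
    \<open>x0\<close> still complete the moving vectors on a smaller neighbourhood.\<close>
  define W where "W = V \<inter> G -` bases"
  have W: "open W" "x0 \<in> W" "W \<subseteq> V"
    unfolding W_def using continuous_open_preimage[OF smooth_on_continuous[OF Gs] V(1) open_bases] V w by (auto simp: G_def)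
  have Gb: "G z \<in> bases" if "z \<in> W" for z using that by (simp add: W_def)
  have GsW: "smooth_on W G" by (rule smooth_on_subset[OF Gs W(3)])
  have cs: "smooth_on W (\<lambda>z. coframe (G z) v)" for v
    unfolding coframe_def
    by (intro smooth_on_Pair smooth_on_vec_lambda smooth_on_inner smooth_on_const smooth_on_nth smooth_on_fst smooth_on_snd GsW W)
  define n where "n k z = inv (coframe (G z)) (0, axis k 1)" for k z
  have ns: "smooth_on W (n k)" for k
    unfolding n_def[abs_def] by (rule inv_family_smooth[OF W(1) linear_coframe bij_coframe[OF Gb] cs])
  have n: "n k z \<bullet> e z $ i = 0" "n k z \<bullet> nu (G z) $ l = (if l = k then 1 else 0)" if "z \<in> W" for k z i l
  proof -
    have "coframe (G z) (n k z) = (0, axis k 1)"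
      unfolding n_def by (rule linear_bij_inv(1)[OF linear_coframe bij_coframe[OF Gb[OF that]]])
    then show "n k z \<bullet> e z $ i = 0" "n k z \<bullet> nu (G z) $ l = (if l = k then 1 else 0)"
      by (auto simp: coframe_def vec_eq_iff axis_def G_def)
  qed
  have num6': "num k \<in> {1..6}" if "num k \<le> 6" for k using num_range(1)[of k] that by simp
  define F :: "real^4 \<Rightarrow> ('v, 'r) frame" where "F = (\<lambda>z. (f z, e z, \<chi> k. if num k \<le> 6 then N z (num k) else n k z))"
  have Fs: "smooth_on W F"
  proof -
    have "smooth_on W (\<lambda>z. if num k \<le> 6 then N z (num k) else n k z)" for k
      by (cases "num k \<le> 6") (simp_all add: smooth_on_subset[OF Ns W(3)] ns)
    moreover have "smooth_on W f" using smooth_on_subset[OF immD(2)[OF imm]] W(3) V(3) by blast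
    ultimately show ?thesis unfolding F_def
      by (intro smooth_on_Pair smooth_on_vec_lambda smooth_on_subset[OF es W(3)] W)
  qed
  have ptF: "(\<lambda>z. pt (F z)) = f" and eF: "ee (F z) = e z" and nF: "nu (F z) $ k = (if num k \<le> 6 then N z (num k) else n k z)" for z k
    by (simp_all add: F_def)
  have fb: "F z \<in> FB" if z: "z \<in> W" for z
  proof -
    have zV: "z \<in> V" using z W by blast
    have nN: "n k z \<bullet> N z (num l) = 0" if "6 < num k" "num l \<le> 6" for k l
      using n(2)[OF z, of k l] that by (auto simp: G_def)
    have "c = 0" if c: "frame_map (F z) c = 0" for c
    proof -
      \<comment> \<open>\<open>p\<close> collects the high normals and \<open>q\<close> everything
        else. They are orthogonal, so both vanish with their sum; pairing \<open>p\<close> with the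
        constant vectors isolates its coefficients, and \<open>q\<close> is then a combination of
        the basis \<open>G z\<close>.\<close>
      define p where "p = (\<Sum>k\<in>UNIV. if num k \<le> 6 then 0 else snd c $ k *\<^sub>R n k z)"
      define q where "q = (\<Sum>i\<in>UNIV. fst c $ i *\<^sub>R e z $ i) + (\<Sum>k\<in>UNIV. if num k \<le> 6 then snd c $ k *\<^sub>R N z (num k) else 0)"
      have pq: "frame_map (F z) c = q + p"
        unfolding frame_map_def p_def q_def eF nF by (simp add: add.assoc flip: sum.distrib) (rule sum.cong, auto)
      have pe: "p \<bullet> e z $ i = 0" for i
        unfolding p_def inner_sum_left by (rule sum.neutral) (simp add: n(1)[OF z])
      have pN: "p \<bullet> N z (num l) = 0" if "num l \<le> 6" for l
        unfolding p_def inner_sum_left by (rule sum.neutral) (use nN that in auto)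
      have "p \<bullet> q = 0"
        unfolding q_def inner_add_right inner_sum_right by (simp add: pe) (rule sum.neutral, simp add: pN)
      then have "p \<bullet> p = 0" using c pq by (metis add_0 inner_add_right inner_zero_right)
      then have p0: "p = 0" by simp
      have high: "snd c $ l = 0" if l: "6 < num l" for l
      proof -
        have "p \<bullet> nu (G z) $ l = (\<Sum>k\<in>UNIV. if k = l then snd c $ k else 0)"
          unfolding p_def inner_sum_left by (rule sum.cong) (use l in \<open>auto simp: n(2)[OF z]\<close>)
        then show ?thesis using p0 by simp
      qed
      have "frame_map (G z) c = q"
        unfolding frame_map_def q_def by (auto simp: G_def high intro!: sum.cong)
      then have "frame_map (G z) c = 0" using c pq p0 by simp
      then show ?thesis
        using frame_map_inv(2)[OF Gb[OF z], of c] linear_0[OF frame_map_inv(3)[OF Gb[OF z]]] by simp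
    qed
    then have "inj (frame_map (F z))" using linear_injective_0[OF linear_frame_map[of "F z"]] by blast
    moreover have "ee (F z) $ i \<bullet> nu (F z) $ k = 0" for i k
      using n(1)[OF z, of k i] Ne[OF zV num6', of k i] by (auto simp: eF nF inner_commute)
    moreover have "nu (F z) $ k \<bullet> nu (F z) $ l = 0" if "num k \<le> 6" "6 < num l" for k l
      using nN[OF that(2,1)] that by (simp add: nF inner_commute)
    ultimately show ?thesis using e(1)[OF zV] by (simp add: frame_bundle_def bij_frame_map_iff_inj eF)
  qed
  have "II f z (ee (F z) $ i) (ee (F z) $ j) = (\<Sum>a=1..6. Shat a $ i $ j *\<^sub>R nu_at num (F z) a)" if "z \<in> W" for z i j
  proof -
    have "Qm (N z) i j = Qm (nus (F z)) i j" by (rule Qm_cong) (simp add: nus_def nF num6)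
    then show ?thesis using II[of z i j] that W(3) by (auto simp: eF Qm_def)
  qed
  then have "adapted_frame_on num W F"
    unfolding adapted_frame_on_def ptF using W(1,3) Fs fb e(2) by (auto simp: eF)
  moreover have "\<forall>y\<in>W. pt (F y) = f y" by (simp add: F_def)
  ultimately show ?thesis using W V by blast
qed

end

text \<open>The character count speaks about submanifolds only through their frames, hence the local
  existence of adapted frames and their identification with integral manifolds. Nonemptiness of the
  locus keeps the pointwise assertions of involutivity from being vacuous.\<close>

theorem mainTheorem4:
  fixes r :: nat and num :: "'r::finite \<Rightarrow> nat"
  assumes "6 \<le> r"
    and "CARD('n::finite) = 4 + r"
    and "bij_betw num (UNIV :: 'r set) {1..r}"
  shows "(\<forall>U (f :: real^4 \<Rightarrow> real^'n). austere_A_max U f \<longrightarrow>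
            (\<forall>x\<in>U. \<exists>V (F :: real^4 \<Rightarrow> (real^'n, 'r) frame).
               x \<in> V \<and> V \<subseteq> U \<and> adapted_frame_on num V F \<and> (\<forall>y\<in>V. pt (F y) = f y)))
       \<and> (\<forall>U (F :: real^4 \<Rightarrow> (real^'n, 'r) frame).
            (austere_A_max U (\<lambda>x. pt (F x)) \<and> adapted_frame_on num U F)
            \<longleftrightarrow> integral_manifold (locus num) (generators num) omega U F)
       \<and> (locus num :: (real^'n, 'r) frame set) \<noteq> {}
       \<and> involutive_pfaffian (locus num :: (real^'n, 'r) frame set) (generators num) omega
       \<and> last_character (locus num :: (real^'n, 'r) frame set) (generators num) omega
            2 (2 * (r - 1))"
proof -
  have r: "CARD('r) = r" using bij_betw_same_card[OF assms(3)] by simp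
  interpret frame_dim num "TYPE(real^'n)"
    by unfold_locales (use assms r in simp_all)
  have "(austere_A_max U (\<lambda>x. pt (F x)) \<and> adapted_frame_on num U F)
      \<longleftrightarrow> integral_manifold (locus num) (generators num) omega U F"
    for U and F :: "real^4 \<Rightarrow> (real^'n, 'r) frame"
  proof
    assume "austere_A_max U (\<lambda>x. pt (F x)) \<and> adapted_frame_on num U F"
    then show "integral_manifold (locus num) (generators num) omega U F"
      by (intro austere_integral_manifold) (auto simp: austere_A_max_def adapted_frame_on_def)
  next
    assume "integral_manifold (locus num) (generators num) omega U F"
    then show "austere_A_max U (\<lambda>x. pt (F x)) \<and> adapted_frame_on num U F"
      by (intro integral_manifold_austere) (auto simp: integral_manifold_def)
  qed
  moreover have "last_character (locus num :: (real^'n, 'r) frame set) (generators num) omega 2 (2 * (r - 1))"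
    using last_character_locus by (simp add: r)
  ultimately show ?thesis
    using adapted_frame_exists locus_nonempty involutive_pfaffian_locus by blast
qed

end
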